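(* Let $\mathbb{G}$ be a Carnot group with sub-gradient $\nabla$, sub-Laplacian $\Delta$, Carnot–Carathéodory distance $d$, and write $d(x)=d(x,0)$. Let $U:[0,\infty)\to[0,\infty)$ be twice differentiable and increasing, and let $d\mu_U=\frac{1}{Z}e^{-U(d(x))}\,d\lambda(x)$ be a probability measure ($\lambda$ Lebesgue measure, $Z$ the normalization constant). Assume that outside the open unit ball $B=\{x: d(x)<1\}$ one has $|\nabla d|\le 1$ and there exist finite positive constants $K,c_0$ such that $$\Delta d\le K+U'(d)\left(|\nabla d|^2-c_0\right).$$ (i) If moreover $U''\le \beta U'$ outside $B$ for some constant $\beta>0$, then for every $q\in(1,\infty)$ there exist constants $C_q,D_q\in(0,\infty)$, independent of $f$, such that for all (sufficiently regular, e.g. smooth compactly supported) functions $f$, $$\int |f|^q\,|U'(d)|^q\,d\mu_U\le C_q\int|\nabla f|^q\,d\mu_U+D_q\int|f|^q\,d\mu_U .$$ (ii) If in addition $U\le \gamma (U')^q$ outside $B$ for some constant $\gamma>0$ and some $q>1$, then for this $q$ there exist constants $C_q,D_q$, independent of $f$, such that $$\int |f|^q\,U(d)\,d\mu_U\le C_q\int|\nabla f|^q\,d\mu_U+D_q\int|f|^q\,d\mu_U .$$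
   Context: A (homogeneous) Carnot group is $\mathbb{G}=(\mathbb{R}^N,\circ,\delta_\lambda)$, a Lie group on $\mathbb{R}^N=\mathbb{R}^{N_1}\times\cdots\times\mathbb{R}^{N_r}$ whose dilations $\delta_\lambda(x^{(1)},\dots,x^{(r)})=(\lambda x^{(1)},\dots,\lambda^r x^{(r)})$ are group automorphisms, and such that the left-invariant vector fields $Z_1,\dots,Z_{N_1}$ with $Z_j(0)=\partial_{x_j}|_0$ generate a Lie algebra of rank $N$ at every point. The sub-gradient is $\nabla=(Z_1,\dots,Z_{N_1})$, $|\nabla f|=(\sum_i |Z_if|^2)^{1/2}$, and the sub-Laplacian is $\Delta=\sum_{i=1}^{N_1}Z_i^2$. The Carnot–Carathéodory distance $d(x,y)$ is the infimum of $t$ such that there is an absolutely continuous horizontal curve $\gamma:[0,t]\to\mathbb{G}$ (i.e. $\gamma'(s)=\sum_i a_i(s)Z_i(\gamma(s))$ a.e.) with $\gamma(0)=x$, $\gamma(t)=y$ and $(\sum_i a_i(s)^2)^{1/2}\le1$. *)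

theory Defs
  imports "HOL-Analysis.Analysis"
begin

fun Ck :: "nat \<Rightarrow> ('a::euclidean_space \<Rightarrow> 'b::real_normed_vector) \<Rightarrow> bool" where
  "Ck 0 f = continuous_on UNIV f"
| "Ck (Suc k) f = ((\<forall>x. f differentiable (at x)) \<and>
      (\<forall>v\<in>Basis. Ck k (\<lambda>x. frechet_derivative f (at x) v)))"

definition smooth :: "('a::euclidean_space \<Rightarrow> 'b::real_normed_vector) \<Rightarrow> bool" where
  "smooth f \<longleftrightarrow> (\<forall>k. Ck k f)"

text \<open>The group law is gmul; deg i is the homogeneity degree (layer index) of coordinate i,
  so the dilations are delta_lambda x = (lambda^(deg i) * x_i)_i.\<close>

definition dil :: "('n::finite \<Rightarrow> nat) \<Rightarrow> real \<Rightarrow> real^'n \<Rightarrow> real^'n" where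
  "dil deg l x = (\<chi> i. l ^ deg i * x $ i)"

definition horiz :: "('n::finite \<Rightarrow> nat) \<Rightarrow> 'n set" where
  "horiz deg = {i. deg i = 1}"

text \<open>Left-invariant vector field with Z_j(0) = e_j : Z_j(x) = d/dy (x o y)|_{y=0} e_j.\<close>
definition Zvf :: "(real^'n::finite \<Rightarrow> real^'n \<Rightarrow> real^'n) \<Rightarrow> 'n \<Rightarrow> real^'n \<Rightarrow> real^'n" where
  "Zvf gmul j x = frechet_derivative (\<lambda>y. gmul x y) (at 0) (axis j 1)"

definition lie_bracket ::
  "('a::euclidean_space \<Rightarrow> 'a) \<Rightarrow> ('a \<Rightarrow> 'a) \<Rightarrow> 'a \<Rightarrow> 'a" where
  "lie_bracket X Y x = frechet_derivative Y (at x) (X x) - frechet_derivative X (at x) (Y x)"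

inductive_set lie_gen :: "(real^'n::finite \<Rightarrow> real^'n \<Rightarrow> real^'n) \<Rightarrow> ('n \<Rightarrow> nat)
    \<Rightarrow> (real^'n \<Rightarrow> real^'n) set"
  for gmul deg where
  base: "j \<in> horiz deg \<Longrightarrow> Zvf gmul j \<in> lie_gen gmul deg"
| brk: "X \<in> lie_gen gmul deg \<Longrightarrow> Y \<in> lie_gen gmul deg \<Longrightarrow> lie_bracket X Y \<in> lie_gen gmul deg"

definition carnot_group :: "(real^'n::finite \<Rightarrow> real^'n \<Rightarrow> real^'n) \<Rightarrow> ('n \<Rightarrow> nat) \<Rightarrow> bool" where
  "carnot_group gmul deg \<longleftrightarrow>
     \<comment> \<open>group law with neutral element 0\<close>
     (\<forall>x y z. gmul (gmul x y) z = gmul x (gmul y z)) \<and>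
     (\<forall>x. gmul x 0 = x \<and> gmul 0 x = x) \<and>
     (\<exists>inv. (\<forall>x. gmul x (inv x) = 0 \<and> gmul (inv x) x = 0) \<and> smooth inv) \<and>
     \<comment> \<open>Lie group: smooth group law\<close>
     smooth (\<lambda>p :: (real^'n) \<times> (real^'n). gmul (fst p) (snd p)) \<and>
     \<comment> \<open>stratified coordinates and dilations being automorphisms\<close>
     (\<forall>i. deg i \<ge> 1) \<and>
     (\<forall>l>0. \<forall>x y. dil deg l (gmul x y) = gmul (dil deg l x) (dil deg l y)) \<and>
     \<comment> \<open>Hoermander rank condition\<close>
     (\<forall>x. span ((\<lambda>X. X x) ` lie_gen gmul deg) = UNIV)"

definition hderiv :: "(real^'n::finite \<Rightarrow> real^'n \<Rightarrow> real^'n) \<Rightarrow> 'n \<Rightarrow> (real^'n \<Rightarrow> real)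
    \<Rightarrow> real^'n \<Rightarrow> real" where
  "hderiv gmul i f x = deriv (\<lambda>t. f (gmul x (t *\<^sub>R axis i 1))) 0"

definition hdiff_at :: "(real^'n::finite \<Rightarrow> real^'n \<Rightarrow> real^'n) \<Rightarrow> 'n \<Rightarrow> (real^'n \<Rightarrow> real)
    \<Rightarrow> real^'n \<Rightarrow> bool" where
  "hdiff_at gmul i f x \<longleftrightarrow> (\<lambda>t. f (gmul x (t *\<^sub>R axis i 1))) differentiable (at 0)"

definition hgrad_norm :: "(real^'n::finite \<Rightarrow> real^'n \<Rightarrow> real^'n) \<Rightarrow> ('n \<Rightarrow> nat)
    \<Rightarrow> (real^'n \<Rightarrow> real) \<Rightarrow> real^'n \<Rightarrow> real" where
  "hgrad_norm gmul deg f x = sqrt (\<Sum>i\<in>horiz deg. (hderiv gmul i f x)\<^sup>2)"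

definition sublap :: "(real^'n::finite \<Rightarrow> real^'n \<Rightarrow> real^'n) \<Rightarrow> ('n \<Rightarrow> nat)
    \<Rightarrow> (real^'n \<Rightarrow> real) \<Rightarrow> real^'n \<Rightarrow> real" where
  "sublap gmul deg f x = (\<Sum>i\<in>horiz deg. hderiv gmul i (hderiv gmul i f) x)"

definition abs_cont_on :: "real \<Rightarrow> real \<Rightarrow> (real \<Rightarrow> 'a::real_normed_vector) \<Rightarrow> bool" where
  "abs_cont_on a b g \<longleftrightarrow> (\<forall>e>0. \<exists>d>0. \<forall>(n::nat) (l::nat\<Rightarrow>real) u.
      (\<forall>k<n. a \<le> l k \<and> l k \<le> u k \<and> u k \<le> b) \<and>
      (\<forall>j<n. \<forall>k<n. j \<noteq> k \<longrightarrow> u j \<le> l k \<or> u k \<le> l j) \<and>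
      (\<Sum>k<n. u k - l k) < d \<longrightarrow> (\<Sum>k<n. norm (g (u k) - g (l k))) < e)"

definition subunit_horizontal :: "(real^'n::finite \<Rightarrow> real^'n \<Rightarrow> real^'n) \<Rightarrow> ('n \<Rightarrow> nat)
    \<Rightarrow> real \<Rightarrow> (real \<Rightarrow> real^'n) \<Rightarrow> bool" where
  "subunit_horizontal gmul deg t g \<longleftrightarrow> abs_cont_on 0 t g \<and>
     (\<exists>a :: real \<Rightarrow> 'n \<Rightarrow> real. AE s in lebesgue. s \<in> {0..t} \<longrightarrow>
        (g has_vector_derivative (\<Sum>i\<in>horiz deg. a s i *\<^sub>R Zvf gmul i (g s))) (at s) \<and>
        sqrt (\<Sum>i\<in>horiz deg. (a s i)\<^sup>2) \<le> 1)"

definition ccdist :: "(real^'n::finite \<Rightarrow> real^'n \<Rightarrow> real^'n) \<Rightarrow> ('n \<Rightarrow> nat)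
    \<Rightarrow> real^'n \<Rightarrow> real^'n \<Rightarrow> real" where
  "ccdist gmul deg x y = Inf {t. t \<ge> 0 \<and>
      (\<exists>g. subunit_horizontal gmul deg t g \<and> g 0 = x \<and> g t = y)}"

definition dnorm :: "(real^'n::finite \<Rightarrow> real^'n \<Rightarrow> real^'n) \<Rightarrow> ('n \<Rightarrow> nat) \<Rightarrow> real^'n \<Rightarrow> real" where
  "dnorm gmul deg x = ccdist gmul deg x 0"

definition test_fun :: "(real^'n::finite \<Rightarrow> real) \<Rightarrow> bool" where
  "test_fun f \<longleftrightarrow> smooth f \<and> compact (closure {x. f x \<noteq> 0})"

end

(*
  Write rho = exp (- U d).  Testing the Laplacian bound with h = G(d) F, where F = |f|^q and G is a cutoff of
  U'^(q-1) exp (- U), and integrating by parts, the terms U' |grad d|^2 on both sides cancel and leave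
    c0 int U'^q |f|^q rho <= K' int U'^(q-1) |f|^q rho + q int (U' |f|)^(q-1) |grad f| rho + (bounded region),
  because U'' <= beta U'; Young's inequality absorbs the right-hand side.

  U'' need not be continuous: the hypothesis only enters through the monotonicity of U' exp (- beta r), so that
  U'^(q-1) is replaced by Steklov averages, for which the sign of the derivative is all that matters.

  The Laplacian bound is only given for smooth test functions.  The function h is approximated by its averages
  over left translations, which commute with the horizontal fields; that d has the weak horizontal gradient
  given by its pointwise difference quotients follows from invariance of Lebesgue measure under right
  translations.  Both invariances hold because the Jacobians are continuous and invariant under dilations, hence
  equal to their value at the origin.  Finiteness and continuity of d is Chow's theorem: the velocities at the
  origin of curves in the set of accessible points form a Lie algebra containing the first layer.
*)

theory Submission
  imports Defs
begin

section \<open>Functions of class \<open>C\<^sup>k\<close>\<close>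

text \<open>The horizontal gradient of \<open>d\<close> is merely a bounded measurable field outside
  the unit ball, so all regularity in the product of the two gradients has to come from the test
  function, whose averages must have derivatives converging in L1. This convergence rests on finite
  differences, which commute exactly with the averages, and on the L1 contraction of averaging. The
  unit ball is avoided by nested radii: the cutoff lives on d \<ge> 3/2 and equals 1 from 2 on,
  averaging may lower the radius to 5/4, and the Laplacian bound holds for d > 1. In Chow's theorem
  the bracket is a limit of difference quotients of the adjoint action inside a closed subspace.
  Commutators of curves with their square root reparametrisation are avoided, curves differentiable
  at a single parameter are enough, and an open mapping theorem for maps differentiable at one point
  yields a ball. With p = q - 1, the parameter c0 / 4 in Young's inequality is chosen so that its
  two applications consume half of the good term.\<close>

lemma Ck_SucI:
  assumes "\<And>x. (f has_derivative f' x) (at x)" "\<And>v. v \<in> Basis \<Longrightarrow> Ck k (\<lambda>x. f' x v)"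
  shows "Ck (Suc k) f"
proof -
  have "f' x = frechet_derivative f (at x)" for x
    using assms(1) by (rule frechet_derivative_at)
  then show ?thesis using assms by (auto simp: differentiable_def)
qed

lemma Ck_Suc_has_derivative:
  "Ck (Suc k) f \<Longrightarrow> (f has_derivative frechet_derivative f (at x)) (at x)"
  by (simp add: frechet_derivative_works)

lemma Ck_Suc_imp_Ck: "Ck (Suc k) f \<Longrightarrow> Ck k f"
proof (induction k arbitrary: f)
  case 0
  then show ?case
    by (auto intro!: continuous_at_imp_continuous_on differentiable_imp_continuous_within)
qed auto

lemma Ck_mono: "Ck k f \<Longrightarrow> j \<le> k \<Longrightarrow> Ck j f"
  by (induction k) (auto simp: le_Suc_eq intro: Ck_Suc_imp_Ck simp del: Ck.simps)

lemma Ck_imp_continuous_on: "Ck k f \<Longrightarrow> continuous_on S f"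
  using Ck_mono[of k f 0] continuous_on_subset by auto

lemma Ck_bounded_linear_compose:
  assumes "bounded_linear L" "Ck k f" shows "Ck k (\<lambda>x. L (f x))"
  using assms(2)
proof (induction k arbitrary: f)
  case 0
  then show ?case using bounded_linear.continuous_on[OF assms(1)] by auto
next
  case (Suc k)
  show ?case
    by (rule Ck_SucI[OF bounded_linear.has_derivative[OF assms(1) Ck_Suc_has_derivative[OF Suc.prems]]])
      (use Suc in auto)
qed

lemma Ck_const: "Ck k (\<lambda>x. c)"
proof (induction k arbitrary: c)
  case (Suc k)
  show ?case by (rule Ck_SucI[OF has_derivative_const]) (rule Suc)
qed auto

lemma Ck_bounded_linear:
  assumes "bounded_linear L" shows "Ck k L"
proof (cases k)
  case 0
  then show ?thesis using assms by (auto intro: linear_continuous_on)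
next
  case (Suc j)
  show ?thesis unfolding Suc
    by (rule Ck_SucI[OF bounded_linear_imp_has_derivative[OF assms]]) (rule Ck_const)
qed

lemma Ck_ident: "Ck k (\<lambda>x. x)"
  by (rule Ck_bounded_linear) (rule bounded_linear_ident)

lemma Ck_add: "Ck k f \<Longrightarrow> Ck k g \<Longrightarrow> Ck k (\<lambda>x. f x + g x)"
proof (induction k arbitrary: f g)
  case (Suc k)
  show ?case
    by (rule Ck_SucI[OF has_derivative_add[OF Ck_Suc_has_derivative[OF Suc.prems(1)]
          Ck_Suc_has_derivative[OF Suc.prems(2)]]]) (use Suc in auto)
qed (auto intro: continuous_intros)

lemma Ck_sum: "(\<And>i. i \<in> I \<Longrightarrow> Ck k (f i)) \<Longrightarrow> Ck k (\<lambda>x. \<Sum>i\<in>I. f i x)"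
  by (induction I rule: infinite_finite_induct) (auto intro: Ck_add Ck_const)

lemma Ck_bilinear:
  fixes f :: "'a::euclidean_space \<Rightarrow> 'b::real_normed_vector" and g :: "'a \<Rightarrow> 'c::real_normed_vector"
  assumes "bounded_bilinear B" "Ck k f" "Ck k g" shows "Ck k (\<lambda>x. B (f x) (g x))"
  using assms(2,3)
proof (induction k arbitrary: f g)
  case 0
  then show ?case using bounded_bilinear.continuous_on[OF assms(1)] by auto
next
  case (Suc k)
  show ?case
  proof (rule Ck_SucI[OF bounded_bilinear.FDERIV[OF assms(1) Ck_Suc_has_derivative[OF Suc.prems(1)]
          Ck_Suc_has_derivative[OF Suc.prems(2)]]])
    fix v :: 'a assume v: "v \<in> Basis"
    have "Ck k f" "Ck k g" using Suc.prems Ck_Suc_imp_Ck by auto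
    then show "Ck k (\<lambda>x. B (f x) (frechet_derivative g (at x) v) + B (frechet_derivative f (at x) v) (g x))"
      using Suc.prems v by (intro Ck_add Suc.IH) auto
  qed
qed

lemmas Ck_scaleR = Ck_bilinear[OF bounded_bilinear_scaleR]
lemmas Ck_mult = Ck_bilinear[OF bounded_bilinear_mult]
lemmas Ck_inner = Ck_bilinear[OF bounded_bilinear_inner]

lemma linear_sum_Basis:
  fixes D :: "'a::euclidean_space \<Rightarrow> 'b::real_normed_vector"
  assumes "bounded_linear D" shows "D v = (\<Sum>b\<in>Basis. (v \<bullet> b) *\<^sub>R D b)"
proof -
  interpret bounded_linear D by fact
  have "D v = D (\<Sum>b\<in>Basis. (v \<bullet> b) *\<^sub>R b)" by (simp add: euclidean_representation)
  then show ?thesis by (simp add: sum scaleR)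
qed

text \<open>\<open>Ck\<close> constrains only the partial derivatives along \<open>Basis\<close>;
  linearity of the derivative extends this to an arbitrary fixed direction.\<close>

lemma Ck_Suc_directional: "Ck (Suc k) f \<Longrightarrow> Ck k (\<lambda>x. frechet_derivative f (at x) v)"
proof -
  assume f: "Ck (Suc k) f"
  have "frechet_derivative f (at x) v = (\<Sum>b\<in>Basis. (v \<bullet> b) *\<^sub>R frechet_derivative f (at x) b)" for x
    by (rule linear_sum_Basis[OF has_derivative_bounded_linear[OF Ck_Suc_has_derivative[OF f]]])
  moreover have "Ck k (\<lambda>x. \<Sum>b\<in>Basis. (v \<bullet> b) *\<^sub>R frechet_derivative f (at x) b)"
    using f by (intro Ck_sum Ck_bounded_linear_compose[OF bounded_linear_scaleR_right]) auto
  ultimately show ?thesis by simp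
qed

lemma Ck_compose:
  fixes f :: "'b::euclidean_space \<Rightarrow> 'c::real_normed_vector" and g :: "'a::euclidean_space \<Rightarrow> 'b"
  assumes "Ck k f" "Ck k g" shows "Ck k (\<lambda>x. f (g x))"
  using assms
proof (induction k arbitrary: f g)
  case 0
  then show ?case by (auto intro: continuous_on_compose2)
next
  case (Suc k)
  note df = Ck_Suc_has_derivative[OF Suc.prems(1)] and dg = Ck_Suc_has_derivative[OF Suc.prems(2)]
  show ?case
  proof (rule Ck_SucI)
    show "((\<lambda>x. f (g x)) has_derivative
      (\<lambda>v. frechet_derivative f (at (g x)) (frechet_derivative g (at x) v))) (at x)" for x
      using has_derivative_compose[OF dg df] by simp
    fix v :: 'a assume v: "v \<in> Basis"
    \<comment> \<open>The direction itself depends on \<open>x\<close>. Expanded in the basis, the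
      derivative becomes a sum of products of C^k functions, to which the induction hypothesis
      applies.\<close>
    have "frechet_derivative f (at (g x)) (frechet_derivative g (at x) v) =
      (\<Sum>b\<in>Basis. (frechet_derivative g (at x) v \<bullet> b) *\<^sub>R frechet_derivative f (at (g x)) b)" for x
      by (rule linear_sum_Basis[OF has_derivative_bounded_linear[OF df]])
    moreover have "Ck k (\<lambda>x. \<Sum>b\<in>Basis. (frechet_derivative g (at x) v \<bullet> b) *\<^sub>R frechet_derivative f (at (g x)) b)"
      using Suc.prems v
      by (intro Ck_sum Ck_scaleR Ck_inner Ck_const Suc.IH[where g=g] Ck_Suc_imp_Ck[of k g]) auto
    ultimately show "Ck k (\<lambda>x. frechet_derivative f (at (g x)) (frechet_derivative g (at x) v))"
      by simp
  qed
qed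

lemma Ck_Pair: "Ck k f \<Longrightarrow> Ck k g \<Longrightarrow> Ck k (\<lambda>x. (f x, g x))"
proof -
  assume "Ck k f" "Ck k g"
  then have "Ck k (\<lambda>x. (f x, 0) + (0, g x))"
    by (intro Ck_add Ck_bounded_linear_compose[of "\<lambda>y. (y, 0)"] Ck_bounded_linear_compose[of "\<lambda>y. (0, y)"])
      (auto intro: bounded_linear_intros)
  then show ?thesis by simp
qed

lemma Ck_fst: "Ck k f \<Longrightarrow> Ck k (\<lambda>x. fst (f x))"
  and Ck_snd: "Ck k f \<Longrightarrow> Ck k (\<lambda>x. snd (f x))"
  by (rule Ck_bounded_linear_compose[OF bounded_linear_fst] Ck_bounded_linear_compose[OF bounded_linear_snd], assumption)+

lemmas Ck_intros = Ck_const Ck_ident Ck_Pair Ck_fst Ck_snd Ck_add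

lemma smooth_Ck: "smooth f \<Longrightarrow> Ck k f"
  by (simp add: smooth_def)

lemma Ck_has_derivative: "Ck k f \<Longrightarrow> k \<ge> 1 \<Longrightarrow> (f has_derivative frechet_derivative f (at x)) (at x)"
  by (cases k) (auto simp: frechet_derivative_works)

text \<open>The partial derivatives are bounded on the compact ball, their bounds add up to a bound
  of the operator norm, and convexity of the ball allows the mean value inequality.\<close>

lemma Ck_Lipschitz_on_cball:
  fixes f :: "'a::euclidean_space \<Rightarrow> 'b::real_normed_vector"
  assumes "Ck (Suc 0) f"
  obtains L where "L \<ge> 0" "\<And>x y. norm x \<le> R \<Longrightarrow> norm y \<le> R \<Longrightarrow> norm (f x - f y) \<le> L * norm (x - y)"
proof -
  let ?D = "\<lambda>x. frechet_derivative f (at x)"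
  have "\<exists>M\<ge>0. \<forall>x\<in>cball 0 R. norm (?D x b) \<le> M" if "b \<in> Basis" for b
  proof -
    have "compact ((\<lambda>x. ?D x b) ` cball 0 R)"
      using assms that by (intro compact_continuous_image compact_cball) (auto intro: continuous_on_subset)
    then show ?thesis using bounded_pos[of "(\<lambda>x. ?D x b) ` cball 0 R"] compact_imp_bounded
      by (auto intro: less_imp_le)
  qed
  then obtain M where M: "\<And>b. b \<in> Basis \<Longrightarrow> M b \<ge> 0"
    "\<And>b x. b \<in> Basis \<Longrightarrow> x \<in> cball 0 R \<Longrightarrow> norm (?D x b) \<le> M b" by metis
  let ?L = "\<Sum>b\<in>Basis. M b"
  have on: "onorm (?D x) \<le> ?L" if "x \<in> cball 0 R" for x
  proof (rule onorm_le)
    fix v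
    have "norm (?D x v) = norm (\<Sum>b\<in>Basis. (v \<bullet> b) *\<^sub>R ?D x b)"
      by (subst linear_sum_Basis[OF has_derivative_bounded_linear[OF Ck_Suc_has_derivative[OF assms]]]) simp
    also have "\<dots> \<le> (\<Sum>b\<in>Basis. norm v * M b)"
      by (intro sum_norm_le) (auto intro!: mult_mono simp: Basis_le_norm M that[simplified])
    finally show "norm (?D x v) \<le> ?L * norm v" by (simp add: sum_distrib_left mult.commute)
  qed
  show ?thesis
  proof (rule that[of ?L])
    show "?L \<ge> 0" by (simp add: sum_nonneg M)
    fix x y :: 'a assume "norm x \<le> R" "norm y \<le> R"
    then show "norm (f x - f y) \<le> ?L * norm (x - y)"
      by (intro differentiable_bound[of "cball 0 R" f ?D])
        (auto simp: on intro!: has_derivative_at_withinI[OF Ck_Suc_has_derivative[OF assms]])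
  qed
qed

text \<open>Schwarz's theorem in integral form: the increment of \<open>f\<close> along
  \<open>v\<close> is the integral of its derivative along \<open>v\<close>. Differentiating under
  the integral sign in direction \<open>u\<close> gives an identity in \<open>t\<close> whose
  derivative at t = 0 is the claim.\<close>

lemma second_derivative_symmetric:
  fixes f :: "'a::euclidean_space \<Rightarrow> 'b::euclidean_space"
  assumes f: "Ck (Suc (Suc 0)) f"
  shows "frechet_derivative (\<lambda>x. frechet_derivative f (at x) v) (at x) u =
         frechet_derivative (\<lambda>x. frechet_derivative f (at x) u) (at x) v"
proof -
  let ?D = "\<lambda>w x. frechet_derivative f (at x) w"
  have C1: "Ck (Suc 0) (?D w)" for w by (rule Ck_Suc_directional[OF f])
  have df: "(f has_derivative (\<lambda>w. ?D w x)) (at x)" for x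
    using Ck_Suc_has_derivative[OF f] by simp
  define A where "A x = frechet_derivative (?D v) (at x) u" for x
  have A: "continuous_on S A" for S unfolding A_def
    by (rule Ck_imp_continuous_on[OF Ck_Suc_directional[OF C1]])
  have blD: "bounded_linear (\<lambda>w. ?D w x)" for x by (rule has_derivative_bounded_linear[OF df])
  note contD = Ck_imp_continuous_on[OF C1]
  have ftc: "((\<lambda>\<tau>. ?D v (x + s *\<^sub>R u + \<tau> *\<^sub>R v)) has_integral (f (x + s *\<^sub>R u + t *\<^sub>R v) - f (x + s *\<^sub>R u))) {0..t}"
    if "t \<ge> 0" for s t
  proof -
    have "((\<lambda>\<tau>. f (x + s *\<^sub>R u + \<tau> *\<^sub>R v)) has_vector_derivative ?D v (x + s *\<^sub>R u + \<tau> *\<^sub>R v)) (at \<tau> within {0..t})" for \<tau>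
      unfolding has_vector_derivative_def
      by (rule has_derivative_eq_rhs, rule has_derivative_compose[OF _ df])
        (auto intro!: derivative_eq_intros simp: linear_cmul[OF bounded_linear.linear[OF blD]])
    from fundamental_theorem_of_calculus[OF that this] show ?thesis by simp
  qed
  have eq: "?D u (x + t *\<^sub>R v) - ?D u x = integral {0..t} (\<lambda>\<tau>. A (x + \<tau> *\<^sub>R v))" if t: "t \<ge> 0" for t
  proof -
    have l: "((\<lambda>s. integral (cbox 0 t) (\<lambda>\<tau>. ?D v (x + s *\<^sub>R u + \<tau> *\<^sub>R v))) has_vector_derivative
       integral (cbox 0 t) (\<lambda>\<tau>. A (x + 0 *\<^sub>R u + \<tau> *\<^sub>R v))) (at 0 within UNIV)"
    proof (rule leibniz_rule_vector_derivative)
      fix s \<tau>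
      show "((\<lambda>s. ?D v (x + s *\<^sub>R u + \<tau> *\<^sub>R v)) has_vector_derivative A (x + s *\<^sub>R u + \<tau> *\<^sub>R v)) (at s within UNIV)"
        unfolding has_vector_derivative_def A_def
        by (rule has_derivative_eq_rhs, rule has_derivative_compose[OF _ Ck_Suc_has_derivative[OF C1]])
        (auto intro!: derivative_eq_intros simp: linear_cmul[OF bounded_linear.linear[OF has_derivative_bounded_linear[OF Ck_Suc_has_derivative[OF C1]]]])
      show "(\<lambda>\<tau>. ?D v (x + s *\<^sub>R u + \<tau> *\<^sub>R v)) integrable_on cbox 0 t"
        by (intro integrable_continuous continuous_on_compose2[OF contD[of UNIV]] continuous_intros) auto
      show "continuous_on (UNIV \<times> cbox 0 t) (\<lambda>(s, \<tau>). A (x + s *\<^sub>R u + \<tau> *\<^sub>R v))"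
        unfolding split_beta by (intro continuous_on_compose2[OF A[of UNIV]] continuous_intros) auto
    qed auto
    have r: "((\<lambda>s. f (x + s *\<^sub>R u + t *\<^sub>R v) - f (x + s *\<^sub>R u)) has_vector_derivative
       ?D u (x + 0 *\<^sub>R u + t *\<^sub>R v) - ?D u (x + 0 *\<^sub>R u)) (at 0)"
    proof (rule has_vector_derivative_diff)
      have "((\<lambda>s. f (x + s *\<^sub>R u + w)) has_vector_derivative ?D u (x + 0 *\<^sub>R u + w)) (at 0)" for w
        unfolding has_vector_derivative_def
        by (rule has_derivative_eq_rhs, rule has_derivative_compose[OF _ df])
          (auto intro!: derivative_eq_intros simp: linear_cmul[OF bounded_linear.linear[OF blD]])
      from this[of "t *\<^sub>R v"] this[of 0] show
        "((\<lambda>s. f (x + s *\<^sub>R u + t *\<^sub>R v)) has_vector_derivative ?D u (x + 0 *\<^sub>R u + t *\<^sub>R v)) (at 0)"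
        "((\<lambda>s. f (x + s *\<^sub>R u)) has_vector_derivative ?D u (x + 0 *\<^sub>R u)) (at 0)" by auto
    qed
    have "(\<lambda>s. integral (cbox 0 t) (\<lambda>\<tau>. ?D v (x + s *\<^sub>R u + \<tau> *\<^sub>R v))) =
        (\<lambda>s. f (x + s *\<^sub>R u + t *\<^sub>R v) - f (x + s *\<^sub>R u))"
      using ftc[OF t] by (auto intro!: integral_unique)
    with l r show ?thesis by (auto dest: vector_derivative_unique_at)
  qed
  \<comment> \<open>\<open>eq\<close> is available for t \<ge> 0, so the two derivatives are
    compared within {0..1}, where 0 is still a limit point.\<close>
  have 1: "((\<lambda>t. integral {0..t} (\<lambda>\<tau>. A (x + \<tau> *\<^sub>R v))) has_vector_derivative A (x + 0 *\<^sub>R v)) (at 0 within {0..1})"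
    by (rule integral_has_vector_derivative)
      (auto intro!: continuous_on_compose2[OF A[of UNIV]] continuous_intros)
  have "((\<lambda>t. ?D u (x + t *\<^sub>R v)) has_vector_derivative frechet_derivative (?D u) (at (x + 0 *\<^sub>R v)) v) (at 0 within {0..1})"
    unfolding has_vector_derivative_def
    by (rule has_derivative_eq_rhs, rule has_derivative_compose[OF _ Ck_Suc_has_derivative[OF C1]])
      (auto intro!: derivative_eq_intros simp: linear_cmul[OF bounded_linear.linear[OF has_derivative_bounded_linear[OF Ck_Suc_has_derivative[OF C1]]]])
  then have "((\<lambda>t. ?D u (x + t *\<^sub>R v) - ?D u x) has_vector_derivative frechet_derivative (?D u) (at x) v) (at 0 within {0..1})"
    by (auto intro!: derivative_eq_intros)
  then have 2: "((\<lambda>t. integral {0..t} (\<lambda>\<tau>. A (x + \<tau> *\<^sub>R v))) has_vector_derivative frechet_derivative (?D u) (at x) v) (at 0 within {0..1})"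
    by (rule has_vector_derivative_transform[rotated 2]) (auto simp: eq)
  from vector_derivative_unique_within[OF _ 1 2] show ?thesis
    by (auto simp: A_def trivial_limit_within islimpt_Icc)
qed

text \<open>The derivative in \<open>x\<close> is a parameter integral of the same shape with
  \<open>F\<close> replaced by a partial derivative, so the induction runs over all
  \<open>F\<close>. The factor \<open>h\<close> is merely continuous; this is how averaging smooths
  a continuous function.\<close>

lemma Ck_integral_parameter:
  fixes F :: "'a::euclidean_space \<times> 'b::euclidean_space \<Rightarrow> real" and h :: "'b \<Rightarrow> real"
  assumes "Ck k F" and h: "continuous_on (cbox a b) h"
  shows "Ck k (\<lambda>x. integral (cbox a b) (\<lambda>y. h y * F (x, y)))"
  using assms(1)
proof (induction k arbitrary: F)
  case 0
  have "continuous_on (UNIV \<times> cbox a b) (\<lambda>(x, y). h y * F (x, y))"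
    using 0 unfolding split_beta
    by (intro continuous_intros continuous_on_compose2[OF h]) (auto intro: continuous_on_subset)
  then show ?case using integral_continuous_on_param[of UNIV a b "\<lambda>x y. h y * F (x, y)"] by simp
next
  case (Suc k)
  let ?D = "\<lambda>p. frechet_derivative F (at p)"
  have dF: "(F has_derivative ?D p) (at p)" for p by (rule Ck_Suc_has_derivative[OF Suc.prems])
  have bl: "bounded_linear (\<lambda>v. h y * ?D (x, y) (v, 0))" for x y
  proof (rule bounded_linear_const_mult)
    show "bounded_linear (\<lambda>v. ?D (x, y) (v, 0))"
      by (rule bounded_linear_compose[OF has_derivative_bounded_linear[OF dF]])
        (rule bounded_linear_Pair[OF bounded_linear_ident bounded_linear_zero])
  qed
  \<comment> \<open>The Leibniz rule asks for a derivative that is continuous as a map into the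
    bounded linear maps.\<close>
  define fx where "fx x y = Blinfun (\<lambda>v. h y * ?D (x, y) (v, 0))" for x y
  have fx: "blinfun_apply (fx x y) = (\<lambda>v. h y * ?D (x, y) (v, 0))" for x y
    unfolding fx_def by (rule bounded_linear_Blinfun_apply[OF bl])
  have C: "Ck k (\<lambda>p. ?D p w)" for w by (rule Ck_Suc_directional[OF Suc.prems])
  have cfx: "continuous_on (UNIV \<times> cbox a b) (\<lambda>(x, y). fx x y)"
    unfolding split_beta
  proof (rule continuous_on_blinfun_componentwise)
    fix i :: 'a
    have "continuous_on (UNIV \<times> cbox a b) (\<lambda>p. h (snd p) * ?D p (i, 0))"
      by (intro continuous_on_mult continuous_on_compose2[OF h] continuous_on_snd continuous_on_id
          Ck_imp_continuous_on[OF C]) auto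
    then show "continuous_on (UNIV \<times> cbox a b) (\<lambda>p. blinfun_apply (fx (fst p) (snd p)) i)"
      by (simp add: fx)
  qed
  show ?case
  proof (rule Ck_SucI)
    fix x
    show "((\<lambda>x. integral (cbox a b) (\<lambda>y. h y * F (x, y))) has_derivative
        blinfun_apply (integral (cbox a b) (fx x))) (at x)"
    proof (rule leibniz_rule[OF _ _ cfx])
      fix x y
      have "((\<lambda>x. F (x, y)) has_derivative (\<lambda>v. ?D (x, y) (v, 0))) (at x)"
        by (rule has_derivative_compose[OF has_derivative_Pair[OF has_derivative_ident has_derivative_const] dF])
      then show "((\<lambda>x. h y * F (x, y)) has_derivative blinfun_apply (fx x y)) (at x within UNIV)"
        unfolding fx by (rule has_derivative_mult_right)
      show "(\<lambda>y. h y * F (x, y)) integrable_on cbox a b"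
        using Ck_imp_continuous_on[OF Suc.prems, of UNIV]
        by (intro integrable_continuous continuous_on_mult h continuous_on_compose2[of UNIV F "cbox a b" "\<lambda>y. (x, y)"])
          (auto intro!: continuous_intros)
    qed auto
    fix v :: 'a assume "v \<in> Basis"
    have "blinfun_apply (integral (cbox a b) (fx x)) v = integral (cbox a b) (\<lambda>y. h y * ?D (x, y) (v, 0))" for x
    proof -
      have "fx x integrable_on cbox a b"
        using continuous_on_compose2[OF cfx, of "cbox a b" "\<lambda>y. (x, y)"]
          continuous_on_Pair[OF continuous_on_const continuous_on_id, of "cbox a b" x]
        by (intro integrable_continuous) auto
      then have "blinfun_apply (integral (cbox a b) (fx x)) v = integral (cbox a b) (\<lambda>y. blinfun_apply (fx x y) v)"
        using integral_linear[OF _ blinfun.bounded_linear_left[of v], of "fx x" "cbox a b"] by (simp add: o_def)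
      then show ?thesis by (simp add: fx)
    qed
    then show "Ck k (\<lambda>x. blinfun_apply (integral (cbox a b) (fx x)) v)"
      using Suc.IH[OF C] by simp
  qed
qed

section \<open>A smooth bump function\<close>

text \<open>The derivatives of \<open>exp (- 1 / t)\<close> are combinations of the functions below, which is what makes the
  induction in \<open>Ck_flat\<close> work.\<close>

definition flat :: "nat \<Rightarrow> real \<Rightarrow> real" where
  "flat n t = (if t > 0 then exp (- 1 / t) / t ^ n else 0)"

lemma flat_tendsto_0: "(flat n \<longlongrightarrow> 0) (at 0)"
proof -
  have "((\<lambda>s::real. s ^ n / exp s) \<longlongrightarrow> 0) at_top" by (rule tendsto_power_div_exp_0)
  then have "((\<lambda>t::real. (inverse t) ^ n / exp (inverse t)) \<longlongrightarrow> 0) (at_right 0)"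
    by (rule filterlim_compose) (rule filterlim_inverse_at_top_right)
  then have "(flat n \<longlongrightarrow> 0) (at_right 0)"
  proof (rule Lim_transform_eventually)
    show "\<forall>\<^sub>F t in at_right 0. inverse t ^ n / exp (inverse t) = flat n t"
      using eventually_at_right_less[of "0::real"]
      by eventually_elim (simp add: flat_def exp_minus field_simps)
  qed
  moreover have "(flat n \<longlongrightarrow> 0) (at_left 0)"
  proof (rule Lim_transform_eventually[OF tendsto_const])
    show "\<forall>\<^sub>F t in at_left 0. 0 = flat n t"
      by (rule eventually_at_leftI[of "-1"]) (auto simp: flat_def)
  qed
  ultimately show ?thesis by (simp add: filterlim_at_split)
qed

lemma flat_has_derivative:
  "(flat n has_real_derivative (flat (n + 2) t - n * flat (n + 1) t)) (at t)"
proof (cases t "0::real" rule: linorder_cases)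
  case less
  have "(flat n has_real_derivative 0) (at t)"
    by (rule has_field_derivative_transform_within_open[of "\<lambda>_. 0" _ _ "{..<0}"])
      (use less in \<open>auto simp: flat_def\<close>)
  then show ?thesis using less by (simp add: flat_def)
next
  case greater
  have "((\<lambda>t. exp (- 1 / t) / t ^ n) has_real_derivative (flat (n + 2) t - n * flat (n + 1) t)) (at t)"
    using greater
    by (cases n) (auto intro!: derivative_eq_intros simp: flat_def field_simps power2_eq_square,
        metis Suc_pred neq0_conv power_Suc)
  then show ?thesis
    by (rule has_field_derivative_transform_within_open[of _ _ _ "{0<..}"])
      (use greater in \<open>auto simp: flat_def\<close>)
next
  case equal
  \<comment> \<open>At the origin the difference quotient is \<open>flat (n + 1)\<close> itself; for
    t \<le> 0 both sides are zero, at t = 0 by division by zero.\<close>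
  have "flat (n + 1) = (\<lambda>t. (flat n t - flat n 0) / (t - 0))"
    by (auto simp: flat_def fun_eq_iff)
  then show ?thesis using flat_tendsto_0[of "n+1"] equal
    by (simp add: has_field_derivative_iff flat_def)
qed

lemma Ck_flat: "Ck k (flat n)"
proof (induction k arbitrary: n)
  case 0
  then show ?case using flat_has_derivative
    by (auto intro!: continuous_at_imp_continuous_on DERIV_isCont)
next
  case (Suc k)
  show ?case
  proof (rule Ck_SucI[OF flat_has_derivative[unfolded has_field_derivative_def]])
    fix v :: real
    show "Ck k (\<lambda>t. (flat (n + 2) t - real n * flat (n + 1) t) * v)"
      using Ck_mult[OF Ck_add[OF Suc Ck_mult[OF Ck_const Suc]] Ck_const, of "n+2" "- real n" "n+1" v] by simp
  qed
qed

text \<open>The square of the norm is used because it is smooth at 0. The function is not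
  normalised; \<open>moll\<close> divides by its integral.\<close>

definition bump :: "real \<Rightarrow> 'a::euclidean_space \<Rightarrow> real" where
  "bump r z = flat 0 (r\<^sup>2 - z \<bullet> z)"

lemma bump_nonneg: "bump r z \<ge> 0"
  by (simp add: bump_def flat_def)

lemma bump_eq_0: "r > 0 \<Longrightarrow> norm z \<ge> r \<Longrightarrow> bump r z = 0"
proof -
  assume "r > 0" "norm z \<ge> r"
  then have "r\<^sup>2 \<le> z \<bullet> z" by (simp add: dot_square_norm power_mono)
  then show ?thesis by (simp add: bump_def flat_def)
qed

lemma bump_0_pos: "r > 0 \<Longrightarrow> bump r 0 > 0"
  by (simp add: bump_def flat_def)

lemma Ck_bump: "Ck k (bump r)"
proof -
  have "Ck k (\<lambda>z::'a. flat 0 (r\<^sup>2 + (- 1) * (z \<bullet> z)))"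
    by (intro Ck_compose[OF Ck_flat] Ck_add Ck_mult Ck_const Ck_inner Ck_ident)
  then show ?thesis by (simp add: bump_def[abs_def])
qed

section \<open>Volume preservation of homogeneous families of diffeomorphisms\<close>

text \<open>The change of variables theorem in \<open>HOL-Analysis\<close> needs a well-ordered index type; a copy of a
  finite type can be given such an order.\<close>

typedef 'a ordered_copy = "UNIV :: 'a set" morphisms of_copy to_copy
  by simp

instance ordered_copy :: (finite) finite
proof
  have "finite (to_copy ` (UNIV :: 'a set))" by simp
  then show "finite (UNIV :: 'a ordered_copy set)"
    unfolding type_definition.Abs_image[OF type_definition_ordered_copy] .
qed

definition copy_index :: "'a::finite ordered_copy \<Rightarrow> nat" where
  "copy_index x = (SOME f. inj f) (of_copy x)"

lemma inj_copy_index: "inj (copy_index :: 'a::finite ordered_copy \<Rightarrow> nat)"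
proof -
  have "\<exists>f :: 'a \<Rightarrow> nat. inj f" using finite_imp_inj_to_nat_seg[OF finite[of "UNIV :: 'a set"]] by blast
  then have "inj (SOME f :: 'a \<Rightarrow> nat. inj f)" by (rule someI_ex)
  from inj_compose[OF this, of "of_copy"] show ?thesis
    by (simp add: copy_index_def[abs_def] o_def inj_def of_copy_inject)
qed

instantiation ordered_copy :: (finite) wellorder
begin

definition "less_eq_ordered_copy (x :: 'a ordered_copy) y \<longleftrightarrow> copy_index x \<le> copy_index (y :: 'a ordered_copy)"
definition "less_ordered_copy (x :: 'a ordered_copy) y \<longleftrightarrow> copy_index x < copy_index (y :: 'a ordered_copy)"

instance
proof
  fix P :: "'a ordered_copy \<Rightarrow> bool" and a :: "'a ordered_copy" assume *: "\<And>x. (\<And>y. y < x \<Longrightarrow> P y) \<Longrightarrow> P x"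
  show "P a"
    by (induction "copy_index a" arbitrary: a rule: less_induct) (rule *, simp add: less_ordered_copy_def)
next
  fix x y :: "'a ordered_copy"
  assume "x \<le> y" "y \<le> x"
  then show "x = y" by (intro injD[OF inj_copy_index]) (simp add: less_eq_ordered_copy_def)
qed (auto simp: less_eq_ordered_copy_def less_ordered_copy_def)

end

definition to_copy_vec :: "real^'n::finite \<Rightarrow> real^'n ordered_copy" where
  "to_copy_vec x = (\<chi> k. x $ of_copy k)"

definition of_copy_vec :: "real^'n ordered_copy \<Rightarrow> real^'n::finite" where
  "of_copy_vec x = (\<chi> k. x $ to_copy k)"

lemma of_to_copy_vec [simp]: "of_copy_vec (to_copy_vec x) = x"
  and to_of_copy_vec [simp]: "to_copy_vec (of_copy_vec y) = y"
  by (simp_all add: to_copy_vec_def of_copy_vec_def vec_eq_iff of_copy_inverse to_copy_inverse)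

lemma bounded_linear_to_copy_vec: "bounded_linear (to_copy_vec :: real^'n::finite \<Rightarrow> _)"
  and bounded_linear_of_copy_vec: "bounded_linear (of_copy_vec :: _ \<Rightarrow> real^'n::finite)"
  unfolding linear_conv_bounded_linear[symmetric]
  by (auto intro!: linearI simp: to_copy_vec_def of_copy_vec_def vec_eq_iff)

lemma prod_Basis_cart: "(\<Prod>b\<in>Basis. x \<bullet> b) = (\<Prod>i\<in>UNIV. (x :: real^'n) $ i)"
proof -
  have B: "(Basis :: (real^'n) set) = (\<lambda>i. axis i 1) ` UNIV" by (auto simp: Basis_vec_def)
  have inj: "inj (\<lambda>i::'n. axis i (1::real))" by (auto simp: inj_def axis_eq_axis)
  show ?thesis
    unfolding B by (subst prod.reindex[OF inj]) (simp add: inner_axis)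
qed

text \<open>Relabelling coordinates permutes the factors in the volume of a box, and boxes determine
  the measure.\<close>

lemma distr_of_copy_vec: "distr lborel borel of_copy_vec = (lborel :: (real^'n::finite) measure)"
proof (rule lborel_eqI[symmetric])
  have meas: "of_copy_vec \<in> borel_measurable (borel :: (real^'n ordered_copy) measure)"
    by (intro borel_measurable_continuous_onI linear_continuous_on bounded_linear_of_copy_vec)
  fix l u :: "real^'n" assume lu: "\<And>b. b \<in> Basis \<Longrightarrow> l \<bullet> b \<le> u \<bullet> b"
  have le: "l $ i \<le> u $ i" for i using lu[of "axis i 1"] by (simp add: inner_axis)
  have "of_copy_vec -` box l u = box (to_copy_vec l) (to_copy_vec u)"
    by (auto simp: mem_box_cart of_copy_vec_def to_copy_vec_def) (metis of_copy_inverse to_copy_inverse UNIV_I)+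
  then have "emeasure (distr lborel borel of_copy_vec) (box l u) = emeasure lborel (box (to_copy_vec l) (to_copy_vec u))"
    using meas by (subst emeasure_distr) auto
  also have "\<dots> = (\<Prod>b\<in>Basis. (to_copy_vec (u - l)) \<bullet> b)"
  proof -
    have "to_copy_vec l \<bullet> b \<le> to_copy_vec u \<bullet> b" if "b \<in> Basis" for b
      using that le by (auto simp: Basis_vec_def inner_axis to_copy_vec_def)
    then show ?thesis
      by (simp add: emeasure_lborel_box_eq linear_diff[OF bounded_linear.linear[OF bounded_linear_to_copy_vec]])
  qed
  also have "\<dots> = (\<Prod>i\<in>UNIV. (u - l) $ of_copy i)"
    unfolding prod_Basis_cart by (simp add: to_copy_vec_def)
  also have "\<dots> = (\<Prod>i\<in>UNIV. (u - l) $ i)"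
    by (rule arg_cong[where f=ennreal], rule prod.reindex_bij_witness[of _ to_copy of_copy])
      (auto simp: of_copy_inverse to_copy_inverse)
  finally show "emeasure (distr lborel borel of_copy_vec) (box l u) = (\<Prod>b\<in>Basis. (u - l) \<bullet> b)"
    by (simp add: prod_Basis_cart)
qed simp

section \<open>Dilations, Jacobians and invariance of Lebesgue measure\<close>

lemma dil_linear: "bounded_linear (dil deg l)"
  unfolding linear_conv_bounded_linear[symmetric]
  by (auto intro!: linearI simp: dil_def vec_eq_iff algebra_simps)

lemma dil_dil: "dil deg l (dil deg k x) = dil deg (l * k) x"
  by (simp add: dil_def vec_eq_iff power_mult_distrib)

lemma dil_1 [simp]: "dil deg 1 x = x"
  by (simp add: dil_def vec_eq_iff)

lemma dil_0_vec [simp]: "dil deg l 0 = 0"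
  by (simp add: dil_def vec_eq_iff)

lemma dil_0: assumes "\<And>i. deg i \<ge> 1" shows "dil deg 0 x = 0"
proof -
  \<comment> \<open>This excludes 0 ^ 0 = 1, which would keep a coordinate of degree 0
    fixed.\<close>
  have "deg i \<noteq> 0" for i using assms[of i] by simp
  note [simp] = this
  show ?thesis by (simp add: dil_def vec_eq_iff power_0_left)
qed

lemma continuous_on_dil: "continuous_on S (\<lambda>l. dil deg l x)"
  unfolding dil_def by (intro continuous_on_vec_lambda continuous_intros)

text \<open>The second variable of \<open>\<Phi>\<close> is the parameter of the family, so that
  left and right translations both fit. That the parameter 0 gives the identity determines the value
  of the Jacobian at the origin.\<close>

lemma homogeneous_jacobian:
  fixes \<Phi> :: "(real^'m::finite) \<times> (real^'m) \<Rightarrow> real^'m"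
  assumes C: "Ck (Suc 0) \<Phi>" and deg: "\<And>i. deg i \<ge> 1"
    and hom: "\<And>l x y. l > 0 \<Longrightarrow> \<Phi> (dil deg l x, dil deg l y) = dil deg l (\<Phi> (x, y))"
    and id: "\<And>x. \<Phi> (x, 0) = x"
  shows "det (matrix (\<lambda>u. frechet_derivative \<Phi> (at (x, y)) (u, 0))) = 1"
proof -
  let ?D = "\<lambda>x y u. frechet_derivative \<Phi> (at (x, y)) (u, 0)"
  define J where "J x y = det (matrix (?D x y))" for x y
  have der: "((\<lambda>x. \<Phi> (x, y)) has_derivative ?D x y) (at x)" for x y
    by (rule has_derivative_compose[OF has_derivative_Pair[OF has_derivative_ident has_derivative_const]
          Ck_Suc_has_derivative[OF C]])
  have lin: "linear (?D x y)" for x y using der by (blast intro: has_derivative_linear)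
  have lind: "linear (dil deg l)" for l using dil_linear by (rule bounded_linear.linear)
  have "J (dil deg l x) (dil deg l y) = J x y" if l: "l > 0" for l x y
  proof -
    have 1: "((\<lambda>u. \<Phi> (dil deg l u, dil deg l y)) has_derivative (\<lambda>u. ?D (dil deg l x) (dil deg l y) (dil deg l u))) (at x)"
      by (rule has_derivative_compose[OF bounded_linear_imp_has_derivative[OF dil_linear] der])
    have 2: "((\<lambda>u. dil deg l (\<Phi> (u, y))) has_derivative (\<lambda>u. dil deg l (?D x y u))) (at x)"
      by (rule bounded_linear.has_derivative[OF dil_linear der])
    \<comment> \<open>Differentiating \<open>hom\<close> in its first variable shows that the
      derivatives at the two points are conjugate under the dilation. Their determinants agree
      because that of the dilation is not zero.\<close>
    have eq: "?D (dil deg l x) (dil deg l y) \<circ> dil deg l = dil deg l \<circ> ?D x y"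
      using has_derivative_unique[OF 1 2[folded hom[OF l]]] by (simp add: o_def)
    have "matrix (dil deg l) ** matrix (dil deg (1 / l)) = mat 1"
      using l by (simp add: matrix_compose[OF lind lind, symmetric] o_def dil_dil matrix_id_mat_1[unfolded id_def])
    then have "det (matrix (dil deg l)) * det (matrix (dil deg (1 / l))) = 1"
      by (metis det_I det_mul)
    then have "det (matrix (dil deg l)) \<noteq> 0" by auto
    moreover have "J (dil deg l x) (dil deg l y) * det (matrix (dil deg l)) = det (matrix (dil deg l)) * J x y"
      unfolding J_def det_mul[symmetric] matrix_compose[OF lin lind, symmetric] matrix_compose[OF lind lin, symmetric] eq ..
    ultimately show ?thesis by simp
  qed
  then have J: "eventually (\<lambda>l. J (dil deg l x) (dil deg l y) = J x y) (at_right 0)"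
    by (intro eventually_mono[OF eventually_at_right_less[of "0::real"]])
  have "continuous_on UNIV (\<lambda>l. ?D (dil deg l x) (dil deg l y) v)" for v
    using Ck_imp_continuous_on[OF Ck_Suc_directional[OF C], of UNIV "(v, 0)"]
      continuous_on_Pair[OF continuous_on_dil[of UNIV deg x] continuous_on_dil[of UNIV deg y]]
    by (rule continuous_on_compose2) simp
  then have "continuous_on UNIV (\<lambda>l. ?D (dil deg l x) (dil deg l y) v $ i)" for v i
    by (rule continuous_on_component)
  then have "continuous_on UNIV (\<lambda>l. J (dil deg l x) (dil deg l y))"
    unfolding J_def det_def matrix_def by (intro continuous_on_sum continuous_on_mult continuous_on_prod continuous_on_const) simp
  then have "isCont (\<lambda>l. J (dil deg l x) (dil deg l y)) 0"
    by (simp add: continuous_on_eq_continuous_at)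
  then have "((\<lambda>l. J (dil deg l x) (dil deg l y)) \<longlongrightarrow> J 0 0) (at_right 0)"
    using tendsto_within_subset[of _ _ 0 UNIV "{0<..}"] by (simp add: isCont_def dil_0[OF deg])
  from tendsto_unique[OF _ this tendsto_eventually[OF J]] have "J x y = J 0 0" by simp
  also have "?D 0 0 = id"
    using has_derivative_unique[OF der[of 0 0]] has_derivative_ident unfolding id id_def by blast
  then have "J 0 0 = 1" unfolding J_def by (simp add: matrix_id_mat_1 det_I)
  finally show ?thesis by (simp add: J_def)
qed

text \<open>The preimage of a box under \<open>f\<close> is its image under the inverse
  \<open>g\<close>, so the change of variables formula for images is applied to
  \<open>g\<close>.\<close>

lemma distr_lborel_diffeo:
  fixes f g :: "real^'m::{finite,wellorder} \<Rightarrow> real^'m::_"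
  assumes f: "continuous_on UNIV f" and g: "\<And>x. (g has_derivative g' x) (at x)"
    and det: "\<And>x. \<bar>det (matrix (g' x))\<bar> = 1" and fg: "\<And>x. f (g x) = x" "\<And>x. g (f x) = x"
  shows "distr lborel borel f = lborel"
proof (rule lborel_eqI[symmetric])
  have fm: "f \<in> borel_measurable borel" using f by (rule borel_measurable_continuous_onI)
  fix l u :: "real^'m::_" assume lu: "\<And>b. b \<in> Basis \<Longrightarrow> l \<bullet> b \<le> u \<bullet> b"
  let ?B = "box l u"
  have *: "f -` ?B = g ` ?B"
  proof safe
    fix x assume "f x \<in> ?B"
    then show "x \<in> g ` ?B" by (intro image_eqI[of _ _ "f x"]) (simp_all add: fg)
  qed (simp add: fg)
  have inj: "inj_on g ?B" using fg by (metis inj_on_inverseI)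
  have int: "(\<lambda>x. \<bar>det (matrix (g' x))\<bar>) integrable_on ?B"
    unfolding det integrable_on_open_interval by (rule integrable_const)
  note der = has_derivative_at_withinI[OF g]
  have gB: "g ` ?B \<in> lmeasurable"
    by (rule measurable_differentiable_image_eq[OF _ der inj, THEN iffD2]) (simp, rule int)
  have mgB: "measure lebesgue (g ` ?B) = integral ?B (\<lambda>x. \<bar>det (matrix (g' x))\<bar>)"
    by (rule measure_differentiable_image_eq[OF _ der inj int]) simp
  also have "\<dots> = measure lebesgue ?B"
    unfolding det by (rule lmeasure_integral[symmetric]) simp
  also have "\<dots> = measure lborel ?B" by (rule measure_completion) simp
  finally have m: "measure lebesgue (g ` ?B) = measure lborel ?B" .
  have "f -` ?B \<in> sets lborel" using measurable_sets[OF fm, of ?B] by simp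
  then have "emeasure lborel (f -` ?B) = emeasure lebesgue (g ` ?B)"
    unfolding *[symmetric] by (subst emeasure_completion) simp_all
  also have "\<dots> = ennreal (measure lborel ?B)"
    by (simp only: emeasure_eq_measure2[OF gB] m)
  also have "\<dots> = emeasure lborel ?B"
    by (rule emeasure_eq_ennreal_measure[symmetric]) (simp add: emeasure_lborel_box_eq)
  finally have "emeasure lborel (f -` ?B) = emeasure lborel ?B" .
  then show "emeasure (distr lborel borel f) ?B = (\<Prod>b\<in>Basis. (u - l) \<bullet> b)"
    using fm lu by (subst emeasure_distr) (auto simp: emeasure_lborel_box_eq)
qed simp

text \<open>\<open>y\<close> and \<open>z\<close> are the parameters of a translation and of its
  inverse. The claim is proved on the ordered copy of the index type, for the conjugate
  \<open>\<Psi>\<close>, and carried back along the measure-preserving relabelling.\<close>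

lemma distr_lborel_homogeneous:
  fixes \<Phi> :: "(real^'n::finite) \<times> (real^'n) \<Rightarrow> real^'n"
  assumes C: "Ck (Suc 0) \<Phi>" and deg: "\<And>i. deg i \<ge> 1"
    and hom: "\<And>l x y. l > 0 \<Longrightarrow> \<Phi> (dil deg l x, dil deg l y) = dil deg l (\<Phi> (x, y))"
    and id: "\<And>x. \<Phi> (x, 0) = x" and y: "\<And>x. \<Phi> (\<Phi> (x, y), z) = x" "\<And>x. \<Phi> (\<Phi> (x, z), y) = x"
  shows "distr lborel borel (\<lambda>x. \<Phi> (x, y)) = lborel"
proof -
  let ?T = "to_copy_vec :: real^'n \<Rightarrow> _" and ?S = "of_copy_vec :: _ \<Rightarrow> real^'n"
  define \<Psi> where "\<Psi> p = ?T (\<Phi> (?S (fst p), ?S (snd p)))" for p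
  have C\<Psi>: "Ck (Suc 0) \<Psi>" unfolding \<Psi>_def[abs_def]
    by (intro Ck_bounded_linear_compose[OF bounded_linear_to_copy_vec] Ck_compose[OF C] Ck_Pair
        Ck_bounded_linear_compose[OF bounded_linear_of_copy_vec] Ck_fst Ck_snd Ck_ident)
  have dS: "?S (dil (deg \<circ> of_copy) l x) = dil deg l (?S x)" for l x
    by (simp add: of_copy_vec_def dil_def vec_eq_iff to_copy_inverse)
  have dT: "?T (dil deg l x) = dil (deg \<circ> of_copy) l (?T x)" for l x
    by (simp add: to_copy_vec_def dil_def vec_eq_iff)
  have S0: "?S 0 = 0" by (simp add: of_copy_vec_def vec_eq_iff)
  have der: "((\<lambda>x. \<Psi> (x, w)) has_derivative (\<lambda>u. frechet_derivative \<Psi> (at (x, w)) (u, 0))) (at x)" for x w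
    by (rule has_derivative_compose[OF has_derivative_Pair[OF has_derivative_ident has_derivative_const]
          Ck_Suc_has_derivative[OF C\<Psi>]])
  have cont: "continuous_on UNIV (\<lambda>x. \<Psi> (x, w))" for w
    by (intro continuous_on_compose2[OF Ck_imp_continuous_on[OF C\<Psi>, of UNIV]] continuous_intros) auto
  have "distr lborel borel (\<lambda>x. \<Psi> (x, ?T y)) = lborel"
  proof (rule distr_lborel_diffeo[OF cont der])
    have "\<Psi> (dil (deg \<circ> of_copy) l x, dil (deg \<circ> of_copy) l w) = dil (deg \<circ> of_copy) l (\<Psi> (x, w))"
      if "l > 0" for l x w using that by (simp add: \<Psi>_def dS dT hom)
    moreover have "\<Psi> (x, 0) = x" for x by (simp add: \<Psi>_def id S0)
    ultimately have "det (matrix (\<lambda>u. frechet_derivative \<Psi> (at (x, ?T z)) (u, 0))) = 1" for x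
      using deg by (intro homogeneous_jacobian[OF C\<Psi>, of "deg \<circ> of_copy"]) auto
    then show "\<bar>det (matrix (\<lambda>u. frechet_derivative \<Psi> (at (x, ?T z)) (u, 0)))\<bar> = 1" for x by simp
    show "\<Psi> (\<Psi> (x, ?T z), ?T y) = x" "\<Psi> (\<Psi> (x, ?T y), ?T z) = x" for x by (simp_all add: \<Psi>_def y)
  qed
  then have "distr (distr lborel borel (\<lambda>x. \<Psi> (x, ?T y))) borel ?S = distr lborel borel ?S" by simp
  moreover have mS: "?S \<in> borel_measurable borel"
    by (intro borel_measurable_continuous_onI linear_continuous_on bounded_linear_of_copy_vec)
  moreover have "(\<lambda>x. \<Psi> (x, ?T y)) \<in> borel_measurable borel"
    by (rule borel_measurable_continuous_onI[OF cont])
  ultimately have "distr lborel borel (\<lambda>x. \<Phi> (?S x, y)) = lborel"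
    by (simp add: distr_distr o_def \<Psi>_def distr_of_copy_vec)
  moreover have "(\<lambda>x. \<Phi> (x, y)) \<in> borel_measurable borel"
    by (intro borel_measurable_continuous_onI continuous_on_compose2[OF Ck_imp_continuous_on[OF C, of UNIV]]
        continuous_intros) auto
  ultimately have "distr (distr lborel borel ?S) borel (\<lambda>x. \<Phi> (x, y)) = lborel"
    using mS by (subst distr_distr) (auto simp: o_def)
  then show ?thesis by (simp add: distr_of_copy_vec)
qed

section \<open>Group structure and left-invariant fields\<close>

locale carnot =
  fixes gmul :: "real^'n::finite \<Rightarrow> real^'n \<Rightarrow> real^'n" and deg :: "'n \<Rightarrow> nat"
  assumes carnot_group: "carnot_group gmul deg"
begin

definition ginv :: "real^'n \<Rightarrow> real^'n" where
  "ginv = (SOME inv. (\<forall>x. gmul x (inv x) = 0 \<and> gmul (inv x) x = 0) \<and> smooth inv)"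

lemma gmul_assoc: "gmul (gmul x y) z = gmul x (gmul y z)"
  and gmul_0_right [simp]: "gmul x 0 = x"
  and gmul_0_left [simp]: "gmul 0 x = x"
  and deg_ge_1: "deg i \<ge> 1"
  and dil_gmul: "l > 0 \<Longrightarrow> dil deg l (gmul x y) = gmul (dil deg l x) (dil deg l y)"
  and span_lie_gen: "span ((\<lambda>X. X x) ` lie_gen gmul deg) = UNIV"
  and Ck_gmul_pair: "Ck k (\<lambda>p. gmul (fst p) (snd p))"
  using carnot_group unfolding carnot_group_def by (blast intro: smooth_Ck)+

lemma ginv: "gmul x (ginv x) = 0" "gmul (ginv x) x = 0" "Ck k ginv"
proof -
  have "\<exists>inv. (\<forall>x. gmul x (inv x) = 0 \<and> gmul (inv x) x = 0) \<and> smooth inv"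
    using carnot_group unfolding carnot_group_def by blast
  from someI_ex[OF this, folded ginv_def]
  show "gmul x (ginv x) = 0" "gmul (ginv x) x = 0" "Ck k ginv" by (auto intro: smooth_Ck)
qed

lemmas ginv_simps [simp] = ginv(1,2)

lemma gmul_ginv_cancel [simp]: "gmul x (gmul (ginv x) y) = y" "gmul (ginv x) (gmul x y) = y"
  by (simp_all flip: gmul_assoc)

lemma gmul_ginv_cancel_right [simp]: "gmul (gmul y x) (ginv x) = y" "gmul (gmul y (ginv x)) x = y"
  by (simp_all add: gmul_assoc)

lemma ginv_unique: "gmul x y = 0 \<Longrightarrow> y = ginv x"
  by (metis gmul_0_right gmul_ginv_cancel(2))

lemma ginv_0 [simp]: "ginv 0 = 0"
  by (metis ginv(1) gmul_0_left)

lemma Ck_gmul: "Ck k f \<Longrightarrow> Ck k g \<Longrightarrow> Ck k (\<lambda>x. gmul (f x) (g x))"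
  using Ck_compose[OF Ck_gmul_pair Ck_Pair] by fastforce

lemma Ck_ginv: "Ck k f \<Longrightarrow> Ck k (\<lambda>x. ginv (f x))"
  by (rule Ck_compose[OF ginv(3)])

lemma continuous_on_gmul [continuous_intros]:
  "continuous_on S f \<Longrightarrow> continuous_on S g \<Longrightarrow> continuous_on S (\<lambda>x. gmul (f x) (g x))"
  using continuous_on_compose2[OF Ck_imp_continuous_on[OF Ck_gmul_pair, of UNIV] continuous_on_Pair] by fastforce

lemma continuous_on_ginv [continuous_intros]:
  "continuous_on S f \<Longrightarrow> continuous_on S (\<lambda>x. ginv (f x))"
  by (rule continuous_on_compose2[OF Ck_imp_continuous_on[OF ginv(3), of UNIV]]) auto

lemma dil_ginv: "l > 0 \<Longrightarrow> dil deg l (ginv x) = ginv (dil deg l x)"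
  by (rule ginv_unique) (simp flip: dil_gmul)

text \<open>The differential of the group law. With \<open>u = 0\<close> it is the differential of a
  left translation, with \<open>v = 0\<close> that of a right translation.\<close>

definition Dgmul :: "real^'n \<Rightarrow> real^'n \<Rightarrow> real^'n \<Rightarrow> real^'n \<Rightarrow> real^'n" where
  "Dgmul x y u v = frechet_derivative (\<lambda>p. gmul (fst p) (snd p)) (at (x, y)) (u, v)"

lemma has_derivative_gmul:
  assumes "(f has_derivative f') (at x within S)" "(g has_derivative g') (at x within S)"
  shows "((\<lambda>x. gmul (f x) (g x)) has_derivative (\<lambda>h. Dgmul (f x) (g x) (f' h) (g' h))) (at x within S)"
  using has_derivative_compose[OF has_derivative_Pair[OF assms] Ck_has_derivative[OF Ck_gmul_pair[of 1]]]
  by (simp add: Dgmul_def)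

lemma has_vector_derivative_gmul:
  assumes "(f has_vector_derivative f') (at x within S)" "(g has_vector_derivative g') (at x within S)"
  shows "((\<lambda>x. gmul (f x) (g x)) has_vector_derivative Dgmul (f x) (g x) f' g') (at x within S)"
proof -
  have "Dgmul (f x) (g x) (h *\<^sub>R f') (h *\<^sub>R g') = h *\<^sub>R Dgmul (f x) (g x) f' g'" for h
    using linear_cmul[OF has_derivative_linear[OF Ck_has_derivative[OF Ck_gmul_pair[of 1]]], of "(f x, g x)" h "(f', g')"]
    by (simp add: Dgmul_def)
  then show ?thesis
    using has_derivative_gmul[OF assms[unfolded has_vector_derivative_def]]
    by (simp add: has_vector_derivative_def)
qed

lemma linear_Dgmul_pair: "linear (\<lambda>p. Dgmul x y (fst p) (snd p))"
  using has_derivative_linear[OF Ck_has_derivative[OF Ck_gmul_pair[of 1]]] by (simp add: Dgmul_def)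

lemma Dgmul_add: "Dgmul x y (u + u') (v + v') = Dgmul x y u v + Dgmul x y u' v'"
  using linear_add[OF linear_Dgmul_pair, of x y "(u, v)" "(u', v')"] by simp

lemma Dgmul_scaleR: "Dgmul x y (c *\<^sub>R u) (c *\<^sub>R v) = c *\<^sub>R Dgmul x y u v"
  using linear_cmul[OF linear_Dgmul_pair, of x y c "(u, v)"] by simp

lemma Dgmul_split: "Dgmul x y u v = Dgmul x y u 0 + Dgmul x y 0 v"
  using Dgmul_add[of x y u 0 0 v] by simp

lemma Dgmul_right_0 [simp]: "Dgmul x 0 u 0 = u"
proof -
  have "((\<lambda>x. gmul x 0) has_derivative (\<lambda>u. Dgmul x 0 u 0)) (at x)"
    by (rule has_derivative_gmul) auto
  from has_derivative_unique[OF this] show ?thesis by (metis gmul_0_right has_derivative_ident ext)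
qed

lemma Dgmul_left_0 [simp]: "Dgmul 0 x 0 u = u"
proof -
  have "((\<lambda>x. gmul 0 x) has_derivative (\<lambda>u. Dgmul 0 x 0 u)) (at x)"
    by (rule has_derivative_gmul) auto
  from has_derivative_unique[OF this] show ?thesis by (metis gmul_0_left has_derivative_ident ext)
qed

lemma Dgmul_0_0 [simp]: "Dgmul 0 0 u v = u + v"
  by (subst Dgmul_split) simp

lemma Ck_Dgmul: "Ck k f \<Longrightarrow> Ck k g \<Longrightarrow> Ck k (\<lambda>x. Dgmul (f x) (g x) u v)"
  unfolding Dgmul_def using Ck_compose[OF Ck_Suc_directional[OF Ck_gmul_pair] Ck_Pair] by fastforce

text \<open>The left-invariant vector field with value \<open>v\<close> at the origin; its
  invariance is \<open>linv_left_translate\<close>.\<close>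

definition linv :: "real^'n \<Rightarrow> real^'n \<Rightarrow> real^'n" where
  "linv v x = Dgmul x 0 0 v"

lemma Zvf_eq_linv: "Zvf gmul i = linv (axis i 1)"
proof
  fix x
  have "((\<lambda>y. gmul x y) has_derivative (\<lambda>u. Dgmul x 0 0 u)) (at 0)"
    by (rule has_derivative_gmul) auto
  from frechet_derivative_at[OF this] show "Zvf gmul i x = linv (axis i 1) x"
    by (simp add: Zvf_def linv_def)
qed

lemma Ck_linv: "Ck k (linv v)"
  unfolding linv_def[abs_def] by (intro Ck_Dgmul Ck_intros)

lemma linv_0 [simp]: "linv v 0 = v"
  by (simp add: linv_def)

text \<open>Associativity z(xy) = (zx)y, differentiated in y at the origin.\<close>

lemma linv_left_translate: "Dgmul z x 0 (linv v x) = linv v (gmul z x)"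
proof -
  have "((\<lambda>y. gmul z (gmul x y)) has_derivative (\<lambda>u. Dgmul z (gmul x 0) 0 (Dgmul x 0 0 u))) (at 0)"
    by (intro has_derivative_gmul has_derivative_const has_derivative_ident)
  moreover have "((\<lambda>y. gmul (gmul z x) y) has_derivative (\<lambda>u. Dgmul (gmul z x) 0 0 u)) (at 0)"
    by (intro has_derivative_gmul has_derivative_const has_derivative_ident)
  ultimately have "(\<lambda>u. Dgmul z (gmul x 0) 0 (Dgmul x 0 0 u)) = (\<lambda>u. Dgmul (gmul z x) 0 0 u)"
    unfolding gmul_assoc by (rule has_derivative_unique)
  from fun_cong[OF this, of v] show ?thesis by (simp add: linv_def)
qed

text \<open>The automorphism property of dilations, differentiated in the second factor at the
  origin.\<close>

lemma dil_linv: "l > 0 \<Longrightarrow> dil deg l (linv v x) = linv (dil deg l v) (dil deg l x)"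
proof -
  assume l: "l > 0"
  have "((\<lambda>y. dil deg l (gmul x y)) has_derivative (\<lambda>u. dil deg l (Dgmul x 0 0 u))) (at 0)"
    by (intro bounded_linear.has_derivative[OF dil_linear] has_derivative_gmul has_derivative_const has_derivative_ident)
  moreover have "((\<lambda>y. gmul (dil deg l x) (dil deg l y)) has_derivative (\<lambda>u. Dgmul (dil deg l x) (dil deg l 0) 0 (dil deg l u))) (at 0)"
    by (intro has_derivative_gmul has_derivative_const bounded_linear_imp_has_derivative dil_linear)
  ultimately have "(\<lambda>u. dil deg l (Dgmul x 0 0 u)) = (\<lambda>u. Dgmul (dil deg l x) (dil deg l 0) 0 (dil deg l u))"
    unfolding dil_gmul[OF l] by (rule has_derivative_unique)
  from fun_cong[OF this, of v] show ?thesis by (simp add: linv_def)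
qed

lemma dil_axis: "dil deg l (axis i c) = l ^ deg i *\<^sub>R axis i c"
  by (simp add: dil_def vec_eq_iff axis_def)

lemma linear_linv: "linear (\<lambda>v. linv v x)"
  unfolding linv_def
  by (rule linearI) (metis Dgmul_add add.right_neutral, metis Dgmul_scaleR scaleR_zero_right)

lemma dil_Zvf: "l > 0 \<Longrightarrow> i \<in> horiz deg \<Longrightarrow> dil deg l (Zvf gmul i x) = l *\<^sub>R Zvf gmul i (dil deg l x)"
  by (simp add: Zvf_eq_linv dil_linv dil_axis horiz_def linear_cmul[OF linear_linv])

text \<open>Differentiate x x^-1 = 0 at the origin, where the differential of the group law is
  addition.\<close>

lemma ginv_has_derivative_0: "(ginv has_derivative uminus) (at 0)"
proof -
  let ?I = "frechet_derivative ginv (at 0)"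
  have I: "(ginv has_derivative ?I) (at 0)" by (rule Ck_has_derivative[OF ginv(3)[of 1]]) simp
  have "((\<lambda>x. gmul x (ginv x)) has_derivative (\<lambda>u. Dgmul 0 (ginv 0) u (?I u))) (at 0)"
    by (intro has_derivative_gmul I has_derivative_ident)
  then have "(\<lambda>u. u + ?I u) = (\<lambda>u. 0)"
    using has_derivative_unique[OF _ has_derivative_const[of 0]] by (simp add: )
  then have "?I = uminus" by (metis add_eq_0_iff ext)
  then show ?thesis using I by simp
qed

lemma distr_right_translation: "distr lborel borel (\<lambda>x. gmul x y) = lborel"
  using distr_lborel_homogeneous[of "\<lambda>p. gmul (fst p) (snd p)" deg y "ginv y", OF Ck_gmul_pair deg_ge_1]
  by (simp add: dil_gmul)

lemma distr_left_translation: "distr lborel borel (\<lambda>x. gmul y x) = lborel"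
  using distr_lborel_homogeneous[of "\<lambda>p. gmul (snd p) (fst p)" deg y "ginv y",
      OF Ck_gmul[OF Ck_snd[OF Ck_ident] Ck_fst[OF Ck_ident]] deg_ge_1]
  by (simp add: dil_gmul)

section \<open>Integral curves of the horizontal fields\<close>

lemma norm_dil_le: assumes "0 \<le> l" "l \<le> 1" shows "norm (dil deg l x) \<le> norm x"
  by (rule norm_le_componentwise_cart) (use assms in \<open>auto simp: dil_def abs_mult power_le_one mult_left_le_one_le\<close>)

text \<open>After dilation by \<open>l\<close> the two points differ only in coordinates of degree
  above \<open>p\<close>, hence by O(l^(p+1)), while the values differ by l^p times the original
  difference. A Lipschitz bound and l -> 0 make that difference vanish.\<close>

lemma homogeneous_indep:
  fixes g :: "real^'n \<Rightarrow> real"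
  assumes C: "Ck (Suc 0) g" and hom: "\<And>l x. l > 0 \<Longrightarrow> g (dil deg l x) = l ^ p * g x"
    and eq: "\<And>j. deg j \<le> p \<Longrightarrow> x $ j = y $ j"
  shows "g x = g y"
proof -
  obtain L where L: "L \<ge> 0" "\<And>u v. norm u \<le> norm x + norm y \<Longrightarrow> norm v \<le> norm x + norm y \<Longrightarrow>
    norm (g u - g v) \<le> L * norm (u - v)"
    using Ck_Lipschitz_on_cball[OF C] by metis
  have "\<bar>g x - g y\<bar> \<le> l * (L * norm (x - y))" if l: "0 < l" "l \<le> 1" for l
  proof -
    have "l ^ p * \<bar>g x - g y\<bar> = norm (g (dil deg l x) - g (dil deg l y))"
      using l by (simp add: hom abs_mult flip: right_diff_distrib)
    also have "\<dots> \<le> L * norm (dil deg l x - dil deg l y)"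
      using norm_dil_le[of l x] norm_dil_le[of l y] l norm_ge_zero[of x] norm_ge_zero[of y]
      by (intro L(2)) linarith+
    finally have 1: "l ^ p * \<bar>g x - g y\<bar> \<le> L * norm (dil deg l x - dil deg l y)" .
    have "norm (dil deg l x - dil deg l y) \<le> norm (l ^ Suc p *\<^sub>R (x - y))"
    proof (rule norm_le_componentwise_cart)
      fix j
      show "norm ((dil deg l x - dil deg l y) $ j) \<le> norm ((l ^ Suc p *\<^sub>R (x - y)) $ j)"
      proof (cases "deg j \<le> p")
        case False
        then have "l ^ deg j \<le> l ^ Suc p" using l by (intro power_decreasing) auto
        then have "\<bar>l ^ deg j\<bar> \<le> \<bar>l ^ Suc p\<bar>" using l by simp
        then show ?thesis
          unfolding dil_def by (simp only: vector_minus_component vec_lambda_beta vector_scaleR_component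
              real_norm_def abs_mult real_scaleR_def flip: right_diff_distrib) (intro mult_right_mono, auto)
      qed (simp add: eq dil_def)
    qed
    also have "\<dots> = l ^ p * (l * norm (x - y))" using l by (simp add: abs_mult)
    finally have "L * norm (dil deg l x - dil deg l y) \<le> L * (l ^ p * (l * norm (x - y)))"
      using L(1) by (rule mult_left_mono)
    with 1 have "l ^ p * \<bar>g x - g y\<bar> \<le> l ^ p * (l * (L * norm (x - y)))"
      by (simp add: mult_ac)
    then show ?thesis using l by simp
  qed
  then have "eventually (\<lambda>l. \<bar>g x - g y\<bar> \<le> l * (L * norm (x - y))) (at_right 0)"
    by (intro eventually_at_rightI[of _ 1]) auto
  moreover have "((\<lambda>l. l * (L * norm (x - y))) \<longlongrightarrow> 0 * (L * norm (x - y))) (at_right 0)"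
    by (intro tendsto_intros)
  ultimately have "\<bar>g x - g y\<bar> \<le> 0 * (L * norm (x - y))"
    by (intro tendsto_lowerbound) auto
  then show ?thesis by simp
qed

lemma Zvf_component_homogeneous:
  assumes "i \<in> horiz deg" "l > 0"
  shows "Zvf gmul i (dil deg l x) $ k = l ^ (deg k - 1) * Zvf gmul i x $ k"
proof -
  have "l ^ deg k * Zvf gmul i x $ k = l * Zvf gmul i (dil deg l x) $ k"
    using arg_cong[OF dil_Zvf[OF assms(2,1), of x], of "\<lambda>v. v $ k"] by (simp add: dil_def)
  \<comment> \<open>Degrees are positive, so the subtraction does not truncate.\<close>
  moreover have "l ^ deg k = l * l ^ (deg k - 1)" using deg_ge_1[of k] by (simp flip: power_Suc)
  ultimately show ?thesis using assms(2) by simp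
qed

text \<open>Component \<open>k\<close> of the field is homogeneous of degree
  \<open>deg k - 1\<close>, so coordinates of degree \<open>deg k\<close> or more cannot influence
  it.\<close>

lemma Zvf_component_indep:
  assumes "i \<in> horiz deg" "\<And>j. deg j < deg k \<Longrightarrow> x $ j = y $ j"
  shows "Zvf gmul i x $ k = Zvf gmul i y $ k"
proof (rule homogeneous_indep[where p="deg k - 1" and g="\<lambda>x. Zvf gmul i x $ k"])
  show "Ck (Suc 0) (\<lambda>x. Zvf gmul i x $ k)"
    unfolding Zvf_eq_linv by (intro Ck_bounded_linear_compose[OF bounded_linear_vec_nth] Ck_linv)
  fix j assume "deg j \<le> deg k - 1"
  then have "deg j < deg k" using deg_ge_1[of k] by simp
  then show "x $ j = y $ j" by (rule assms(2))
qed (use assms(1) in \<open>simp add: Zvf_component_homogeneous\<close>)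

text \<open>The integral curve of \<open>Z\<^sub>i\<close> through \<open>0\<close> is \<open>s \<mapsto> dil deg s c\<close>: the equation for \<open>c\<close> is triangular with
  respect to the layers, so it is solved by finitely many iterations.\<close>

lemma integral_curve_endpoint:
  assumes i: "i \<in> horiz deg"
  obtains c where "\<And>k. real (deg k) * c $ k = Zvf gmul i c $ k"
proof -
  define G where "G c = (\<chi> k. Zvf gmul i c $ k / real (deg k))" for c
  \<comment> \<open>Each iteration settles one more layer, because component \<open>k\<close> of
    \<open>G\<close> reads only coordinates of lower degree.\<close>
  have agree: "\<forall>j. deg j \<le> n \<longrightarrow> (G ^^ n) 0 $ j = (G ^^ Suc n) 0 $ j" for n
  proof (induction n)
    case 0
    show ?case using deg_ge_1 by (metis not_one_le_zero le_zero_eq)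
  next
    case (Suc n)
    show ?case
    proof safe
      fix k assume "deg k \<le> Suc n"
      then have "Zvf gmul i ((G ^^ n) 0) $ k = Zvf gmul i ((G ^^ Suc n) 0) $ k"
        using Suc by (intro Zvf_component_indep[OF i]) auto
      then have "G ((G ^^ n) 0) $ k = G ((G ^^ Suc n) 0) $ k" by (simp add: G_def)
      then show "(G ^^ Suc n) 0 $ k = (G ^^ Suc (Suc n)) 0 $ k" by simp
    qed
  qed
  define n where "n = Max (range deg)"
  have "deg j \<le> n" for j unfolding n_def by (intro Max_ge) auto
  then have "G ((G ^^ n) 0) = (G ^^ n) 0" using agree[of n] by (simp add: vec_eq_iff)
  then have "Zvf gmul i ((G ^^ n) 0) $ k / real (deg k) = (G ^^ n) 0 $ k" for k
    using arg_cong[of "G ((G ^^ n) 0)" _ "\<lambda>c. c $ k"] by (simp only: G_def vec_lambda_beta)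
  moreover have "real (deg k) \<noteq> 0" for k using deg_ge_1[of k] by simp
  ultimately have "real (deg k) * (G ^^ n) 0 $ k = Zvf gmul i ((G ^^ n) 0) $ k" for k
    by (simp add: divide_eq_eq mult.commute)
  then show ?thesis by (rule that)
qed

text \<open>The point reached at time 1 by the integral curve from the origin. The equation equates,
  at s = 1, the velocity of the dilation orbit of \<open>c\<close> with the field.\<close>

definition cpt :: "'n \<Rightarrow> real^'n" where
  "cpt i = (SOME c. \<forall>k. real (deg k) * c $ k = Zvf gmul i c $ k)"

lemma cpt: assumes "i \<in> horiz deg" shows "real (deg k) * cpt i $ k = Zvf gmul i (cpt i) $ k"
proof -
  have "\<exists>c. \<forall>k. real (deg k) * c $ k = Zvf gmul i c $ k"
    using integral_curve_endpoint[OF assms] by blast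
  from someI_ex[OF this] show ?thesis unfolding cpt_def by blast
qed

lemma dil_has_vector_derivative:
  "((\<lambda>s. dil deg s x) has_vector_derivative (\<chi> k. real (deg k) * s ^ (deg k - 1) * x $ k)) (at s within S)"
  unfolding dil_def has_vector_derivative_def
  by (subst has_derivative_componentwise_within)
    (auto simp: Basis_vec_def inner_axis intro!: derivative_eq_intros)

lemma integral_curve:
  assumes i: "i \<in> horiz deg" and s: "s > 0"
  shows "((\<lambda>s. dil deg s (cpt i)) has_vector_derivative Zvf gmul i (dil deg s (cpt i))) (at s within S)"
proof -
  have "(\<chi> k. real (deg k) * s ^ (deg k - 1) * cpt i $ k) = Zvf gmul i (dil deg s (cpt i))"
    by (simp add: vec_eq_iff Zvf_component_homogeneous[OF i s] mult_ac flip: cpt[OF i])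
  then show ?thesis using dil_has_vector_derivative[of "cpt i" s S] by simp
qed

lemma integral_curve_0:
  assumes i: "i \<in> horiz deg"
  shows "((\<lambda>s. dil deg s (cpt i)) has_vector_derivative axis i 1) (at 0 within S)"
proof -
  \<comment> \<open>In the first layer the power is 0 ^ 0 = 1 and the component of the field is
    constant; in the higher layers the power vanishes.\<close>
  have "real (deg k) * 0 ^ (deg k - 1) * cpt i $ k = axis i 1 $ k" for k
  proof (cases "deg k = 1")
    case True
    then have "Zvf gmul i (cpt i) $ k = Zvf gmul i 0 $ k"
      using deg_ge_1 by (intro Zvf_component_indep[OF i]) (metis not_one_le_zero less_one)
    then show ?thesis using cpt[OF i, of k] True by (simp add: Zvf_eq_linv)
  next
    case False
    then have "k \<noteq> i" "deg k - 1 \<noteq> 0" using i deg_ge_1[of k] by (auto simp: horiz_def)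
    then show ?thesis by (simp add: axis_def)
  qed
  then have "(\<chi> k. real (deg k) * 0 ^ (deg k - 1) * cpt i $ k) = axis i 1"
    by (simp add: vec_eq_iff)
  then show ?thesis using dil_has_vector_derivative[of "cpt i" 0 S] by simp
qed

end

section \<open>Absolutely continuous curves\<close>

text \<open>The families of intervals of \<open>abs_cont_on\<close> as a predicate of their own, so
  that a change of parameter can be applied to a whole family.\<close>

definition intervals :: "real \<Rightarrow> real \<Rightarrow> nat \<Rightarrow> (nat \<Rightarrow> real) \<Rightarrow> (nat \<Rightarrow> real) \<Rightarrow> bool" where
  "intervals a b n l u \<longleftrightarrow> (\<forall>k<n. a \<le> l k \<and> l k \<le> u k \<and> u k \<le> b) \<and>
      (\<forall>j<n. \<forall>k<n. j \<noteq> k \<longrightarrow> u j \<le> l k \<or> u k \<le> l j)"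

lemma intervalsD:
  "intervals a b n l u \<Longrightarrow> k < n \<Longrightarrow> a \<le> l k"
  "intervals a b n l u \<Longrightarrow> k < n \<Longrightarrow> l k \<le> u k"
  "intervals a b n l u \<Longrightarrow> k < n \<Longrightarrow> u k \<le> b"
  by (simp_all add: intervals_def)

lemma abs_cont_on_iff:
  "abs_cont_on a b g \<longleftrightarrow> (\<forall>e>0. \<exists>d>0. \<forall>n l u. intervals a b n l u \<longrightarrow>
     (\<Sum>k<n. u k - l k) < d \<longrightarrow> (\<Sum>k<n. norm (g (u k) - g (l k))) < e)"
  unfolding abs_cont_on_def intervals_def imp_conjL by (rule refl)

lemma abs_cont_onD:
  assumes "abs_cont_on a b g" "e > 0"
  obtains d where "d > 0"
    "\<And>n l u. intervals a b n l u \<Longrightarrow> (\<Sum>k<n. u k - l k) < d \<Longrightarrow> (\<Sum>k<n. norm (g (u k) - g (l k))) < e"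
proof -
  from assms(1)[unfolded abs_cont_on_iff, rule_format, OF assms(2)]
  show ?thesis by (elim exE conjE) (rule that, assumption, blast)
qed

lemma abs_cont_onI:
  assumes "\<And>e. e > 0 \<Longrightarrow> \<exists>d>0. \<forall>n l u. intervals a b n l u \<longrightarrow>
     (\<Sum>k<n. u k - l k) < d \<longrightarrow> (\<Sum>k<n. norm (g (u k) - g (l k))) < e"
  shows "abs_cont_on a b g"
  using assms unfolding abs_cont_on_iff by blast

lemma intervals_mono:
  assumes lu: "intervals a' b' n l u"
    and \<theta>: "\<And>l u. a' \<le> l \<Longrightarrow> l \<le> u \<Longrightarrow> u \<le> b' \<Longrightarrow> a \<le> \<theta> l \<and> \<theta> l \<le> \<theta> u \<and> \<theta> u \<le> b"
  shows "intervals a b n (\<lambda>k. \<theta> (l k)) (\<lambda>k. \<theta> (u k))"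
  unfolding intervals_def
proof (intro conjI[where Q="\<forall>j<n. _ j"] allI impI)
  fix k assume "k < n"
  then show "a \<le> \<theta> (l k) \<and> \<theta> (l k) \<le> \<theta> (u k) \<and> \<theta> (u k) \<le> b"
    by (intro \<theta> intervalsD[OF lu])
next
  fix j k assume jk: "j < n" "k < n" "j \<noteq> k"
  have *: "\<theta> (u j) \<le> \<theta> (l k)" if "u j \<le> l k" "j < n" "k < n" for j k
  proof -
    have "a' \<le> u j" "l k \<le> b'" using intervalsD[OF lu that(2)] intervalsD[OF lu that(3)] by linarith+
    then show ?thesis using \<theta>[of "u j" "l k"] that(1) by blast
  qed
  have "u j \<le> l k \<or> u k \<le> l j" using lu jk unfolding intervals_def by blast
  then show "\<theta> (u j) \<le> \<theta> (l k) \<or> \<theta> (u k) \<le> \<theta> (l j)" using jk * by blast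
qed

lemma abs_cont_on_compose_mono:
  assumes g: "abs_cont_on a b g" and M: "M > 0"
    and \<theta>: "\<And>l u. a' \<le> l \<Longrightarrow> l \<le> u \<Longrightarrow> u \<le> b' \<Longrightarrow> a \<le> \<theta> l \<and> \<theta> l \<le> \<theta> u \<and> \<theta> u \<le> b \<and> \<theta> u - \<theta> l \<le> M * (u - l)"
  shows "abs_cont_on a' b' (\<lambda>s. g (\<theta> s))"
proof (rule abs_cont_onI)
  fix e :: real assume "e > 0"
  then obtain d where d: "d > 0"
    "\<And>n l u. intervals a b n l u \<Longrightarrow> (\<Sum>k<n. u k - l k) < d \<Longrightarrow> (\<Sum>k<n. norm (g (u k) - g (l k))) < e"
    using abs_cont_onD[OF g] by blast
  show "\<exists>d>0. \<forall>n l u. intervals a' b' n l u \<longrightarrow>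
      (\<Sum>k<n. u k - l k) < d \<longrightarrow> (\<Sum>k<n. norm (g (\<theta> (u k)) - g (\<theta> (l k)))) < e"
  proof (intro exI[of _ "d / M"] conjI allI impI)
    fix n l u
    assume lu: "intervals a' b' n l u" and sum: "(\<Sum>k<n. u k - l k) < d / M"
    show "(\<Sum>k<n. norm (g (\<theta> (u k)) - g (\<theta> (l k)))) < e"
    proof (rule d(2))
      show "intervals a b n (\<lambda>k. \<theta> (l k)) (\<lambda>k. \<theta> (u k))"
        using \<theta> by (intro intervals_mono[OF lu]) blast
      have "(\<Sum>k<n. \<theta> (u k) - \<theta> (l k)) \<le> (\<Sum>k<n. M * (u k - l k))"
        using intervalsD[OF lu] \<theta> by (intro sum_mono) simp
      also have "\<dots> < d" using sum M by (simp add: pos_less_divide_eq mult.commute flip: sum_distrib_left)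
      finally show "(\<Sum>k<n. \<theta> (u k) - \<theta> (l k)) < d" .
    qed
  qed (use d(1) M in simp)
qed

lemma intervals_reflect:
  "intervals 0 t n l u \<Longrightarrow> intervals 0 t n (\<lambda>k. t - u k) (\<lambda>k. t - l k)"
  unfolding intervals_def by (auto simp: disj_commute)

lemma abs_cont_on_reflect:
  assumes g: "abs_cont_on 0 t g" shows "abs_cont_on 0 t (\<lambda>s. g (t - s))"
proof (rule abs_cont_onI)
  fix e :: real assume "e > 0"
  then obtain d where d: "d > 0"
    "\<And>n l u. intervals 0 t n l u \<Longrightarrow> (\<Sum>k<n. u k - l k) < d \<Longrightarrow> (\<Sum>k<n. norm (g (u k) - g (l k))) < e"
    using abs_cont_onD[OF g] by blast
  show "\<exists>d>0. \<forall>n l u. intervals 0 t n l u \<longrightarrow>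
      (\<Sum>k<n. u k - l k) < d \<longrightarrow> (\<Sum>k<n. norm (g (t - u k) - g (t - l k))) < e"
    using d(1) d(2)[OF intervals_reflect] by (intro exI[of _ d]) (simp add: norm_minus_commute)
qed

lemma abs_cont_on_add_const:
  assumes g: "abs_cont_on a b g" and h: "abs_cont_on a b h"
  shows "abs_cont_on a b (\<lambda>s. g s + h s + c)"
proof (rule abs_cont_onI)
  fix e :: real assume "e > 0"
  then have e: "e / 2 > 0" by simp
  obtain d where d: "d > 0"
    "\<And>n l u. intervals a b n l u \<Longrightarrow> (\<Sum>k<n. u k - l k) < d \<Longrightarrow> (\<Sum>k<n. norm (g (u k) - g (l k))) < e / 2"
    using abs_cont_onD[OF g e] by blast
  obtain d' where d': "d' > 0"
    "\<And>n l u. intervals a b n l u \<Longrightarrow> (\<Sum>k<n. u k - l k) < d' \<Longrightarrow> (\<Sum>k<n. norm (h (u k) - h (l k))) < e / 2"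
    using abs_cont_onD[OF h e] by blast
  show "\<exists>d>0. \<forall>n l u. intervals a b n l u \<longrightarrow>
      (\<Sum>k<n. u k - l k) < d \<longrightarrow> (\<Sum>k<n. norm ((g (u k) + h (u k) + c) - (g (l k) + h (l k) + c))) < e"
  proof (intro exI[of _ "min d d'"] conjI allI impI)
    fix n l u
    assume lu: "intervals a b n l u" and sum: "(\<Sum>k<n. u k - l k) < min d d'"
    have "norm ((g (u k) + h (u k) + c) - (g (l k) + h (l k) + c)) \<le> norm (g (u k) - g (l k)) + norm (h (u k) - h (l k))" for k
      using norm_triangle_ineq[of "g (u k) - g (l k)" "h (u k) - h (l k)"] by (simp add: algebra_simps)
    then have "(\<Sum>k<n. norm ((g (u k) + h (u k) + c) - (g (l k) + h (l k) + c)))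
      \<le> (\<Sum>k<n. norm (g (u k) - g (l k)) + norm (h (u k) - h (l k)))"
      by (rule sum_mono)
    also have "\<dots> = (\<Sum>k<n. norm (g (u k) - g (l k))) + (\<Sum>k<n. norm (h (u k) - h (l k)))"
      by (rule sum.distrib)
    also have "\<dots> < e / 2 + e / 2"
      using sum by (intro add_strict_mono d(2) d'(2) lu) simp_all
    finally show "(\<Sum>k<n. norm ((g (u k) + h (u k) + c) - (g (l k) + h (l k) + c))) < e" by simp
  qed (use d(1) d'(1) in simp)
qed

text \<open>Stated by domination of increments because a C^1 map is Lipschitz only on the bounded
  range of the curve. With the identity for \<open>g\<close> it also covers Lipschitz
  curves.\<close>

lemma abs_cont_on_Lipschitz_compose:
  assumes g: "abs_cont_on a b g" and L: "L \<ge> 0"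
    and \<Psi>: "\<And>s t. s \<in> {a..b} \<Longrightarrow> t \<in> {a..b} \<Longrightarrow> norm (\<Psi> s - \<Psi> t) \<le> L * norm (g s - g t)"
  shows "abs_cont_on a b \<Psi>"
proof (rule abs_cont_onI)
  fix e :: real assume "e > 0"
  then have "e / (L + 1) > 0" using L by simp
  then obtain d where d: "d > 0"
    "\<And>n l u. intervals a b n l u \<Longrightarrow> (\<Sum>k<n. u k - l k) < d \<Longrightarrow> (\<Sum>k<n. norm (g (u k) - g (l k))) < e / (L + 1)"
    using abs_cont_onD[OF g] by blast
  show "\<exists>d>0. \<forall>n l u. intervals a b n l u \<longrightarrow>
      (\<Sum>k<n. u k - l k) < d \<longrightarrow> (\<Sum>k<n. norm (\<Psi> (u k) - \<Psi> (l k))) < e"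
  proof (intro exI[of _ d] conjI allI impI)
    fix n l u
    assume lu: "intervals a b n l u" and sum: "(\<Sum>k<n. u k - l k) < d"
    have s: "(\<Sum>k<n. norm (g (u k) - g (l k))) < e / (L + 1)" using lu sum by (rule d(2))
    have "(\<Sum>k<n. norm (\<Psi> (u k) - \<Psi> (l k))) \<le> (\<Sum>k<n. L * norm (g (u k) - g (l k)))"
    proof (intro sum_mono \<Psi>)
      fix k assume "k \<in> {..<n}"
      then show "u k \<in> {a..b}" "l k \<in> {a..b}" using intervalsD[OF lu, of k] by auto
    qed
    also have "\<dots> \<le> (L + 1) * (\<Sum>k<n. norm (g (u k) - g (l k)))"
      unfolding sum_distrib_left[symmetric] by (intro mult_right_mono sum_nonneg) auto
    also have "\<dots> < e" using s L by (simp add: pos_less_divide_eq mult.commute)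
    finally show "(\<Sum>k<n. norm (\<Psi> (u k) - \<Psi> (l k))) < e" .
  qed (rule d(1))
qed

lemma abs_cont_on_ident: "abs_cont_on a b (\<lambda>s::real. s)"
proof (rule abs_cont_onI)
  fix e :: real assume "e > 0"
  moreover have "(\<Sum>k<n. norm (u k - l k)) = (\<Sum>k<n. u k - l k)" if "intervals a b n l u" for n l u
    using intervalsD(2)[OF that] by (intro sum.cong) auto
  ultimately show "\<exists>d>0. \<forall>n l u. intervals a b n l u \<longrightarrow>
      (\<Sum>k<n. u k - l k) < d \<longrightarrow> (\<Sum>k<n. norm (u k - l k)) < e"
    by (intro exI[of _ e]) simp
qed

lemma abs_cont_on_continuous:
  assumes g: "abs_cont_on a b g" shows "continuous_on {a..b} g"
  unfolding continuous_on_iff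
proof (intro ballI allI impI)
  fix x e :: real assume x: "x \<in> {a..b}" "e > 0"
  then obtain d where d: "d > 0"
    "\<And>n l u. intervals a b n l u \<Longrightarrow> (\<Sum>k<n. u k - l k) < d \<Longrightarrow> (\<Sum>k<n. norm (g (u k) - g (l k))) < e"
    using abs_cont_onD[OF g] by blast
  show "\<exists>d>0. \<forall>x'\<in>{a..b}. dist x' x < d \<longrightarrow> dist (g x') (g x) < e"
  proof (intro exI[of _ d] conjI ballI impI d(1))
    fix x' assume x': "x' \<in> {a..b}" "dist x' x < d"
    have "intervals a b 1 (\<lambda>_. min x x') (\<lambda>_. max x x')" using x x' by (auto simp: intervals_def)
    from d(2)[OF this] have "norm (g (max x x') - g (min x x')) < e"
      using x' by (simp add: dist_real_def)
    then show "dist (g x') (g x) < e"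
      by (cases "x \<le> x'") (simp_all add: dist_norm max_def min_def norm_minus_commute)
  qed
qed

text \<open>The joined curve is the sum of the two pieces, each held constant outside its own
  interval, minus the common value. Thus no interval has to be split at the joint.\<close>

lemma abs_cont_on_join:
  assumes g: "abs_cont_on 0 s g" and h: "abs_cont_on 0 t h" and eq: "g s = h 0" and st: "s \<ge> 0" "t \<ge> 0"
  shows "abs_cont_on 0 (s + t) (\<lambda>r. if r \<le> s then g r else h (r - s))"
proof -
  have 1: "abs_cont_on 0 (s + t) (\<lambda>r. g (min r s))"
    by (rule abs_cont_on_compose_mono[OF g, of 1]) (use st in auto)
  have 2: "abs_cont_on 0 (s + t) (\<lambda>r. h (max r s - s))"
    by (rule abs_cont_on_compose_mono[OF h, of 1]) (use st in auto)
  have "(\<lambda>r. if r \<le> s then g r else h (r - s)) = (\<lambda>r. g (min r s) + h (max r s - s) + - g s)"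
    by (auto simp: eq)
  then show ?thesis using abs_cont_on_add_const[OF 1 2, of "- g s"] by (simp only:)
qed

lemma AE_lebesgue_affine:
  assumes "AE s in lebesgue. P s" "c \<noteq> 0"
  shows "AE s in lebesgue. P (b + c * s :: real)"
proof -
  from assms(1) have "AE s in lborel. P s" by (simp add: AE_completion_iff)
  \<comment> \<open>The exceptional set need not be Borel; a Borel null set around it can be
    transformed.\<close>
  then obtain N where N: "{s. \<not> P s} \<subseteq> N" "N \<in> null_sets lborel"
    by (auto simp: eventually_ae_filter)
  then have [measurable]: "N \<in> sets borel" by auto
  have "AE s in lborel. s \<notin> N" using N(2) by (rule AE_not_in)
  then have "AE s in lborel. b + c * s \<notin> N"
    by (intro AE_borel_affine assms(2)) auto
  then have "AE s in lborel. P (b + c * s)" by eventually_elim (use N(1) in auto)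
  then show ?thesis by (simp add: AE_completion_iff)
qed

text \<open>This moves the controls of a curve inside the almost-everywhere quantifier, where they
  can be chosen separately for each time.\<close>

lemma AE_choice: "(\<exists>a. AE s in M. P s (a s)) \<longleftrightarrow> (AE s in M. \<exists>a. P s a)"
proof
  assume "AE s in M. \<exists>a. P s a"
  then have "AE s in M. P s (SOME a. P s a)" by eventually_elim (rule someI_ex)
  then show "\<exists>a. AE s in M. P s (a s)" by (rule exI[of _ "\<lambda>s. SOME a. P s a"])
qed (elim exE, auto elim: AE_mp)

lemma AE_lebesgue_neq: "AE s in lebesgue. s \<noteq> (c::real)"
  by (simp add: AE_completion_iff AE_lborel_singleton)

context carnot
begin

section \<open>Horizontal curves\<close>

text \<open>Speaking of the velocity instead of the controls turns translation, dilation and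
  reversal of curves into statements about single vectors.\<close>

definition subunit_vec :: "real^'n \<Rightarrow> real^'n \<Rightarrow> bool" where
  "subunit_vec x v \<longleftrightarrow> (\<exists>a. v = (\<Sum>i\<in>horiz deg. a i *\<^sub>R Zvf gmul i x) \<and> sqrt (\<Sum>i\<in>horiz deg. (a i)\<^sup>2) \<le> 1)"

lemma subunit_horizontal_iff:
  "subunit_horizontal gmul deg t g \<longleftrightarrow> abs_cont_on 0 t g \<and>
    (AE s in lebesgue. s \<in> {0..t} \<longrightarrow> (\<exists>v. subunit_vec (g s) v \<and> (g has_vector_derivative v) (at s)))"
proof -
  let ?P = "\<lambda>s a. s \<in> {0..t} \<longrightarrow> (g has_vector_derivative (\<Sum>i\<in>horiz deg. a i *\<^sub>R Zvf gmul i (g s))) (at s) \<and>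
        sqrt (\<Sum>i\<in>horiz deg. (a i)\<^sup>2) \<le> 1"
  have "(\<exists>a. AE s in lebesgue. ?P s (a s)) \<longleftrightarrow> (AE s in lebesgue. \<exists>a. ?P s a)"
    by (rule AE_choice)
  moreover have "(\<exists>a. ?P s a) \<longleftrightarrow> (s \<in> {0..t} \<longrightarrow> (\<exists>v. subunit_vec (g s) v \<and> (g has_vector_derivative v) (at s)))" for s
    unfolding subunit_vec_def by blast
  ultimately show ?thesis unfolding subunit_horizontal_def by simp
qed

lemma subunit_vec_uminus: "subunit_vec x v \<Longrightarrow> subunit_vec x (- v)"
  unfolding subunit_vec_def by (elim exE, rule_tac x="\<lambda>i. - a i" in exI) (auto simp: sum_negf)

lemma subunit_vec_gmul: "subunit_vec x v \<Longrightarrow> subunit_vec (gmul z x) (Dgmul z x 0 v)"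
proof -
  have "linear (\<lambda>v. Dgmul z x 0 v)"
    by (rule linearI) (metis Dgmul_add add.right_neutral, metis Dgmul_scaleR scaleR_zero_right)
  then show "subunit_vec x v \<Longrightarrow> subunit_vec (gmul z x) (Dgmul z x 0 v)"
    unfolding subunit_vec_def Zvf_eq_linv
    by (auto simp: linear_sum linear_cmul linv_left_translate)
qed

lemma subunit_vec_dil: "l > 0 \<Longrightarrow> subunit_vec x v \<Longrightarrow> subunit_vec (dil deg l x) ((1 / l) *\<^sub>R dil deg l v)"
  unfolding subunit_vec_def
proof (elim exE conjE)
  fix a assume l: "l > 0" and v: "v = (\<Sum>i\<in>horiz deg. a i *\<^sub>R Zvf gmul i x)" and a: "sqrt (\<Sum>i\<in>horiz deg. (a i)\<^sup>2) \<le> 1"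
  have lin: "linear (dil deg l)" by (rule bounded_linear.linear[OF dil_linear])
  have "(1 / l) *\<^sub>R dil deg l v = (\<Sum>i\<in>horiz deg. a i *\<^sub>R Zvf gmul i (dil deg l x))"
    unfolding v linear_sum[OF lin] scaleR_sum_right
    using l by (intro sum.cong refl) (simp add: linear_cmul[OF lin] dil_Zvf)
  with a show "\<exists>a. (1 / l) *\<^sub>R dil deg l v = (\<Sum>i\<in>horiz deg. a i *\<^sub>R Zvf gmul i (dil deg l x)) \<and>
    sqrt (\<Sum>i\<in>horiz deg. (a i)\<^sup>2) \<le> 1" by blast
qed

lemma subunit_horizontal_translate:
  assumes "subunit_horizontal gmul deg t g"
  shows "subunit_horizontal gmul deg t (\<lambda>s. gmul z (g s))"
  unfolding subunit_horizontal_iff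
proof
  have ac: "abs_cont_on 0 t g" using assms by (simp add: subunit_horizontal_iff)
  \<comment> \<open>The curve has compact range, on which the translation is Lipschitz.\<close>
  have "compact (g ` {0..t})"
    by (intro compact_continuous_image abs_cont_on_continuous[OF ac] compact_Icc)
  from compact_imp_bounded[OF this] obtain R where "\<forall>x\<in>g ` {0..t}. norm x \<le> R"
    unfolding bounded_iff by (elim exE)
  then have R: "\<And>s. s \<in> {0..t} \<Longrightarrow> norm (g s) \<le> R" by simp
  have "Ck (Suc 0) (\<lambda>x. gmul z x)" by (intro Ck_gmul Ck_const Ck_ident)
  then obtain L where "L \<ge> 0" "\<And>x y. norm x \<le> R \<Longrightarrow> norm y \<le> R \<Longrightarrow> norm (gmul z x - gmul z y) \<le> L * norm (x - y)"
    using Ck_Lipschitz_on_cball[of "\<lambda>x. gmul z x" R] by blast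
  then show "abs_cont_on 0 t (\<lambda>s. gmul z (g s))"
    using R by (intro abs_cont_on_Lipschitz_compose[OF ac, of L]) auto
  have "AE s in lebesgue. s \<in> {0..t} \<longrightarrow> (\<exists>v. subunit_vec (g s) v \<and> (g has_vector_derivative v) (at s))"
    using assms by (simp add: subunit_horizontal_iff)
  then show "AE s in lebesgue. s \<in> {0..t} \<longrightarrow> (\<exists>v. subunit_vec (gmul z (g s)) v \<and> ((\<lambda>s. gmul z (g s)) has_vector_derivative v) (at s))"
  proof eventually_elim
    case (elim s)
    show ?case
    proof
      assume "s \<in> {0..t}"
      with elim obtain v where v: "subunit_vec (g s) v" "(g has_vector_derivative v) (at s)" by (elim impE exE conjE)
      have "((\<lambda>s. gmul z (g s)) has_vector_derivative Dgmul z (g s) 0 v) (at s)"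
        by (rule has_vector_derivative_gmul[OF has_vector_derivative_const v(2)])
      with subunit_vec_gmul[OF v(1)]
      show "\<exists>v. subunit_vec (gmul z (g s)) v \<and> ((\<lambda>s. gmul z (g s)) has_vector_derivative v) (at s)" by (intro exI conjI)
    qed
  qed
qed

text \<open>A dilation multiplies horizontal velocities by \<open>l\<close>, and the parameter
  \<open>s / l\<close> compensates this factor.\<close>

lemma subunit_horizontal_dil:
  assumes g: "subunit_horizontal gmul deg t g" and l: "l > 0" and t: "t \<ge> 0"
  shows "subunit_horizontal gmul deg (l * t) (\<lambda>s. dil deg l (g (s / l)))"
  unfolding subunit_horizontal_iff
proof
  have ac: "abs_cont_on 0 t g" using g by (simp add: subunit_horizontal_iff)
  have ac': "abs_cont_on 0 (l * t) (\<lambda>s. g (s / l))"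
    by (rule abs_cont_on_compose_mono[OF ac, of "1 / l"]) (use l in \<open>auto simp: field_simps\<close>)
  obtain B where "\<And>x. norm (dil deg l x) \<le> B * norm x" "B \<ge> 0"
    using bounded_linear.nonneg_bounded[OF dil_linear] by (metis mult.commute)
  then show "abs_cont_on 0 (l * t) (\<lambda>s. dil deg l (g (s / l)))"
    by (intro abs_cont_on_Lipschitz_compose[OF ac']) (auto simp flip: linear_diff[OF bounded_linear.linear[OF dil_linear]])
  have "AE s in lebesgue. s \<in> {0..t} \<longrightarrow> (\<exists>v. subunit_vec (g s) v \<and> (g has_vector_derivative v) (at s))"
    using g by (simp add: subunit_horizontal_iff)
  from AE_lebesgue_affine[OF this, of "1 / l" 0] l have "AE s in lebesgue. s / l \<in> {0..t} \<longrightarrow> (\<exists>v. subunit_vec (g (s / l)) v \<and> (g has_vector_derivative v) (at (s / l)))"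
    by simp
  then show "AE s in lebesgue. s \<in> {0..l * t} \<longrightarrow> (\<exists>v. subunit_vec (dil deg l (g (s / l))) v \<and>
    ((\<lambda>s. dil deg l (g (s / l))) has_vector_derivative v) (at s))"
  proof eventually_elim
    case (elim s)
    show ?case
    proof
      assume "s \<in> {0..l * t}"
      then have "s / l \<in> {0..t}" using l by (auto simp: field_simps)
      with elim obtain v where v: "subunit_vec (g (s / l)) v" "(g has_vector_derivative v) (at (s / l))" by blast
      have "((\<lambda>s. s / l) has_vector_derivative 1 / l) (at s)"
        using l by (auto intro!: derivative_eq_intros simp flip: has_real_derivative_iff_has_vector_derivative)
      from vector_diff_chain_at[OF this v(2)]
      have "((\<lambda>s. g (s / l)) has_vector_derivative (1 / l) *\<^sub>R v) (at s)" by (simp add: o_def)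
      from bounded_linear.has_vector_derivative[OF dil_linear this]
      have "((\<lambda>s. dil deg l (g (s / l))) has_vector_derivative (1 / l) *\<^sub>R dil deg l v) (at s)"
        by (simp only: linear_cmul[OF bounded_linear.linear[OF dil_linear]])
      with subunit_vec_dil[OF l v(1)] show "\<exists>v. subunit_vec (dil deg l (g (s / l))) v \<and>
        ((\<lambda>s. dil deg l (g (s / l))) has_vector_derivative v) (at s)" by blast
    qed
  qed
qed

lemma subunit_horizontal_reflect:
  assumes g: "subunit_horizontal gmul deg t g"
  shows "subunit_horizontal gmul deg t (\<lambda>s. g (t - s))"
  unfolding subunit_horizontal_iff
proof
  show "abs_cont_on 0 t (\<lambda>s. g (t - s))"
    using g by (intro abs_cont_on_reflect) (simp add: subunit_horizontal_iff)
  have "AE s in lebesgue. s \<in> {0..t} \<longrightarrow> (\<exists>v. subunit_vec (g s) v \<and> (g has_vector_derivative v) (at s))"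
    using g by (simp add: subunit_horizontal_iff)
  from AE_lebesgue_affine[OF this, of "-1" t]
  have "AE s in lebesgue. t - s \<in> {0..t} \<longrightarrow> (\<exists>v. subunit_vec (g (t - s)) v \<and> (g has_vector_derivative v) (at (t - s)))"
    by simp
  then show "AE s in lebesgue. s \<in> {0..t} \<longrightarrow> (\<exists>v. subunit_vec (g (t - s)) v \<and> ((\<lambda>s. g (t - s)) has_vector_derivative v) (at s))"
  proof eventually_elim
    case (elim s)
    show ?case
    proof
      assume "s \<in> {0..t}"
      with elim obtain v where v: "subunit_vec (g (t - s)) v" "(g has_vector_derivative v) (at (t - s))" by auto
      have "((\<lambda>s. t - s) has_vector_derivative - 1) (at s)"
        by (auto intro!: derivative_eq_intros)
      from vector_diff_chain_at[OF this v(2)]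
      have "((\<lambda>s. g (t - s)) has_vector_derivative - v) (at s)" by (simp add: o_def)
      with subunit_vec_uminus[OF v(1)] show "\<exists>v. subunit_vec (g (t - s)) v \<and> ((\<lambda>s. g (t - s)) has_vector_derivative v) (at s)"
        by blast
    qed
  qed
qed

lemma subunit_horizontal_join:
  assumes g: "subunit_horizontal gmul deg s g" and h: "subunit_horizontal gmul deg t h"
    and eq: "g s = h 0" and st: "s \<ge> 0" "t \<ge> 0"
  shows "subunit_horizontal gmul deg (s + t) (\<lambda>r. if r \<le> s then g r else h (r - s))" (is "subunit_horizontal _ _ _ ?j")
  unfolding subunit_horizontal_iff
proof
  show "abs_cont_on 0 (s + t) ?j"
    using g h eq st by (intro abs_cont_on_join) (simp_all add: subunit_horizontal_iff)
  have g': "AE r in lebesgue. r \<in> {0..s} \<longrightarrow> (\<exists>v. subunit_vec (g r) v \<and> (g has_vector_derivative v) (at r))"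
    using g by (simp add: subunit_horizontal_iff)
  have "AE r in lebesgue. r \<in> {0..t} \<longrightarrow> (\<exists>v. subunit_vec (h r) v \<and> (h has_vector_derivative v) (at r))"
    using h by (simp add: subunit_horizontal_iff)
  from AE_lebesgue_affine[OF this, of 1 "- s"]
  have h': "AE r in lebesgue. r - s \<in> {0..t} \<longrightarrow> (\<exists>v. subunit_vec (h (r - s)) v \<and> (h has_vector_derivative v) (at (r - s)))"
    by simp
  \<comment> \<open>The joint is discarded as a null set, since the curve may have a corner
    there.\<close>
  show "AE r in lebesgue. r \<in> {0..s + t} \<longrightarrow> (\<exists>v. subunit_vec (?j r) v \<and> (?j has_vector_derivative v) (at r))"
    using g' h' AE_lebesgue_neq[of s]
  proof eventually_elim
    case (elim r)
    show ?case
    proof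
      assume r: "r \<in> {0..s + t}"
      show "\<exists>v. subunit_vec (?j r) v \<and> (?j has_vector_derivative v) (at r)"
      proof (cases "r < s")
        case True
        then obtain v where v: "subunit_vec (g r) v" "(g has_vector_derivative v) (at r)" using elim r by auto
        have "(?j has_vector_derivative v) (at r)"
          by (rule has_vector_derivative_transform_within_open[OF v(2), of "{..<s}"]) (use True in auto)
        with v(1) True show ?thesis by auto
      next
        case False
        then have rs: "r > s" using elim(3) by simp
        then obtain v where v: "subunit_vec (h (r - s)) v" "(h has_vector_derivative v) (at (r - s))" using elim r by auto
        have "((\<lambda>r. r - s) has_vector_derivative 1) (at r)"
          by (auto intro!: derivative_eq_intros)
        from vector_diff_chain_at[OF this v(2)]
        have v': "((\<lambda>r. h (r - s)) has_vector_derivative v) (at r)" by (simp add: o_def)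
        have "(?j has_vector_derivative v) (at r)"
          by (rule has_vector_derivative_transform_within_open[OF v', of "{s<..}"]) (use rs in auto)
        with v(1) rs show ?thesis by auto
      qed
    qed
  qed
qed

text \<open>Curves run from \<open>x\<close> to the origin, as in \<open>dnorm\<close>, which is the
  infimum of these times.\<close>

definition reach :: "real \<Rightarrow> real^'n \<Rightarrow> bool" where
  "reach t x \<longleftrightarrow> t \<ge> 0 \<and> (\<exists>g. subunit_horizontal gmul deg t g \<and> g 0 = x \<and> g t = 0)"

text \<open>The curve of \<open>y\<close>, translated by \<open>x\<close> on the left, leads from
  the product to \<open>x\<close>, and the curve of \<open>x\<close> continues to the origin. The
  order is dictated by left translations being those that preserve horizontality here.\<close>

lemma reach_gmul: "reach s x \<Longrightarrow> reach t y \<Longrightarrow> reach (s + t) (gmul x y)"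
proof -
  assume "reach s x" "reach t y"
  then obtain g h where *: "s \<ge> 0" "t \<ge> 0" "subunit_horizontal gmul deg s g" "g 0 = x" "g s = 0"
    "subunit_horizontal gmul deg t h" "h 0 = y" "h t = 0" by (auto simp: reach_def)
  have "subunit_horizontal gmul deg (t + s) (\<lambda>r. if r \<le> t then gmul x (h r) else g (r - t))"
    using * by (intro subunit_horizontal_join subunit_horizontal_translate) auto
  then show ?thesis using * unfolding reach_def
    by (intro conjI exI[of _ "\<lambda>r. if r \<le> t then gmul x (h r) else g (r - t)"]) (auto simp: add.commute)
qed

lemma reach_dil: "reach t x \<Longrightarrow> l > 0 \<Longrightarrow> reach (l * t) (dil deg l x)"
  unfolding reach_def using subunit_horizontal_dil[of t _ l] by fastforce

text \<open>The reversed curve leads from the origin to \<open>x\<close>; translated by the inverse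
  of \<open>x\<close> it ends at the origin.\<close>

lemma reach_ginv: "reach t x \<Longrightarrow> reach t (ginv x)"
proof -
  assume "reach t x"
  then obtain g where *: "t \<ge> 0" "subunit_horizontal gmul deg t g" "g 0 = x" "g t = 0" by (auto simp: reach_def)
  then show ?thesis unfolding reach_def
    by (intro conjI exI[of _ "\<lambda>s. gmul (ginv x) (g (t - s))"] subunit_horizontal_translate subunit_horizontal_reflect) auto
qed

lemma Ck_dil: "Ck (Suc 0) (\<lambda>s. dil deg s x)"
  by (rule Ck_SucI[OF dil_has_vector_derivative[unfolded has_vector_derivative_def]])
    (auto intro!: continuous_intros)

lemma reach_cpt:
  assumes i: "i \<in> horiz deg" and t: "t \<ge> 0"
  shows "reach t (dil deg t (cpt i))"
proof -
  have "subunit_horizontal gmul deg t (\<lambda>s. dil deg s (cpt i))"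
    unfolding subunit_horizontal_iff
  proof
    obtain L where L: "L \<ge> 0" "\<And>s r :: real. norm s \<le> t \<Longrightarrow> norm r \<le> t \<Longrightarrow>
        norm (dil deg s (cpt i) - dil deg r (cpt i)) \<le> L * norm (s - r)"
      using Ck_Lipschitz_on_cball[OF Ck_dil] by metis
    show "abs_cont_on 0 t (\<lambda>s. dil deg s (cpt i))"
      by (rule abs_cont_on_Lipschitz_compose[OF abs_cont_on_ident L(1)]) (use L(2) in auto)
    \<comment> \<open>\<open>integral_curve\<close> covers s > 0, and the initial time is a null
      set.\<close>
    show "AE s in lebesgue. s \<in> {0..t} \<longrightarrow> (\<exists>v. subunit_vec (dil deg s (cpt i)) v \<and> ((\<lambda>s. dil deg s (cpt i)) has_vector_derivative v) (at s))"
      using AE_lebesgue_neq[of 0]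
    proof eventually_elim
      case (elim s)
      have "subunit_vec (dil deg s (cpt i)) (Zvf gmul i (dil deg s (cpt i)))"
        unfolding subunit_vec_def
        using i by (intro exI[of _ "\<lambda>j. if j = i then 1 else 0"]) (simp add: if_distrib if_distribR cong: if_cong)
      then show ?case using integral_curve[OF i, of s UNIV] elim by (auto intro!: exI)
    qed
  qed
  from subunit_horizontal_reflect[OF this] show ?thesis
    unfolding reach_def using t by (intro conjI exI[of _ "\<lambda>s. dil deg (t - s) (cpt i)"]) (auto simp: dil_0[OF deg_ge_1])
qed

end

section \<open>Accessibility by horizontal curves\<close>

text \<open>The product rule at a zero of \<open>a\<close>: the derivative of \<open>P\<close> is
  multiplied by \<open>a x0 = 0\<close> and drops out.\<close>

lemma has_derivative_linear_family:
  fixes P :: "'a::real_normed_vector \<Rightarrow> 'b::euclidean_space \<Rightarrow> 'c::real_normed_vector"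
  assumes P: "\<And>x. bounded_linear (P x)" and dP: "\<And>b. ((\<lambda>x. P x b) has_derivative P' b) (at x0)"
    and a: "(a has_derivative a') (at x0)" and a0: "a x0 = 0"
  shows "((\<lambda>x. P x (a x)) has_derivative (\<lambda>h. P x0 (a' h))) (at x0)"
proof -
  have eq: "P x w = (\<Sum>b\<in>Basis. (w \<bullet> b) *\<^sub>R P x b)" for x w
    by (rule linear_sum_Basis[OF P])
  have "((\<lambda>x. \<Sum>b\<in>Basis. (a x \<bullet> b) *\<^sub>R P x b) has_derivative
      (\<lambda>h. \<Sum>b\<in>Basis. (a x0 \<bullet> b) *\<^sub>R P' b h + (a' h \<bullet> b) *\<^sub>R P x0 b)) (at x0)"
    by (intro has_derivative_sum has_derivative_scaleR has_derivative_inner_left a dP)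
  then show ?thesis by (simp add: a0 flip: eq)
qed

lemma has_vector_derivative_quotient:
  assumes "(f has_vector_derivative v) (at 0)"
  shows "((\<lambda>t. (1 / t) *\<^sub>R (f t - f 0)) \<longlongrightarrow> v) (at 0)"
proof -
  have "((\<lambda>t. (1 / norm (t - 0)) *\<^sub>R (f t - (f 0 + (t - 0) *\<^sub>R v))) \<longlongrightarrow> 0) (at 0)"
    using assms unfolding has_vector_derivative_def has_derivative_within by blast
  then have "((\<lambda>t. norm ((1 / norm (t - 0)) *\<^sub>R (f t - (f 0 + (t - 0) *\<^sub>R v)))) \<longlongrightarrow> 0) (at 0)"
    by (rule tendsto_norm_zero)
  then have "((\<lambda>t. norm ((1 / t) *\<^sub>R (f t - f 0) - v)) \<longlongrightarrow> 0) (at 0)"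
  proof (rule Lim_transform_eventually)
    have "norm ((1 / norm (t - 0)) *\<^sub>R (f t - (f 0 + (t - 0) *\<^sub>R v))) = norm ((1 / t) *\<^sub>R (f t - f 0) - v)"
      if "t \<noteq> 0" for t
    proof -
      have "(1 / t) *\<^sub>R (f t - f 0) - v = (1 / t) *\<^sub>R (f t - (f 0 + t *\<^sub>R v))"
        using that by (simp add: algebra_simps)
      then show ?thesis by simp
    qed
    then show "\<forall>\<^sub>F t in at 0. norm ((1 / norm (t - 0)) *\<^sub>R (f t - (f 0 + (t - 0) *\<^sub>R v))) = norm ((1 / t) *\<^sub>R (f t - f 0) - v)"
      by (simp add: eventually_at_filter)
  qed
  then show ?thesis using Lim_null tendsto_norm_zero_iff by blast
qed

context carnot
begin

section \<open>Invariant fields, the adjoint action and the bracket\<close>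

lemma linear_Dgmul_left: "linear (\<lambda>u. Dgmul x y u 0)"
  by (rule linearI) (metis Dgmul_add add.right_neutral, metis Dgmul_scaleR scaleR_zero_right)

lemma linear_Dgmul_right: "linear (\<lambda>v. Dgmul x y 0 v)"
  by (rule linearI) (metis Dgmul_add add.right_neutral, metis Dgmul_scaleR scaleR_zero_right)

lemma Ck_Dgmul_left:
  assumes "Ck k f" "Ck k g" "Ck k u"
  shows "Ck k (\<lambda>x. Dgmul (f x) (g x) (u x) 0)"
proof -
  have eq: "Dgmul x y w 0 = (\<Sum>b\<in>Basis. (w \<bullet> b) *\<^sub>R Dgmul x y b 0)" for x y w
    by (rule linear_sum_Basis[OF linear_Dgmul_left[unfolded linear_conv_bounded_linear]])
  have "Ck k (\<lambda>x. \<Sum>b\<in>Basis. (u x \<bullet> b) *\<^sub>R Dgmul (f x) (g x) b 0)"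
    by (intro Ck_sum Ck_scaleR Ck_inner Ck_const Ck_Dgmul assms)
  then show ?thesis by (subst eq)
qed

text \<open>The right-invariant vector field with value \<open>v\<close> at the origin.\<close>

definition rinv :: "real^'n \<Rightarrow> real^'n \<Rightarrow> real^'n" where
  "rinv v x = Dgmul 0 x v 0"

text \<open>The value at the origin of the Lie bracket of the left-invariant fields of
  \<open>u\<close> and \<open>v\<close>.\<close>

definition bracket :: "real^'n \<Rightarrow> real^'n \<Rightarrow> real^'n" where
  "bracket u v = frechet_derivative (linv v) (at 0) u - frechet_derivative (linv u) (at 0) v"

lemma linv_has_derivative: "(linv v has_derivative frechet_derivative (linv v) (at x)) (at x)"
  using Ck_has_derivative[OF Ck_linv[of 1]] by simp

text \<open>Both sides are mixed second derivatives of the group law at the origin, taken in the two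
  possible orders.\<close>

lemma rinv_derivative: "(rinv v has_derivative (\<lambda>u. frechet_derivative (linv u) (at 0) v)) (at 0)"
proof -
  let ?m = "\<lambda>p. gmul (fst p) (snd p)"
  let ?D = "\<lambda>w p. frechet_derivative ?m (at p) w"
  have C: "Ck (Suc 0) (?D w)" for w by (rule Ck_Suc_directional[OF Ck_gmul_pair])
  have d: "(?D w has_derivative frechet_derivative (?D w) (at p)) (at p)" for w p
    by (rule Ck_Suc_has_derivative[OF C])
  have 1: "(rinv v has_derivative (\<lambda>u. frechet_derivative (?D (v, 0)) (at (0, 0)) (0, u))) (at 0)"
    unfolding rinv_def[abs_def] Dgmul_def
    by (rule has_derivative_compose[OF has_derivative_Pair[OF has_derivative_const has_derivative_ident] d])
  have "(linv u has_derivative (\<lambda>v. frechet_derivative (?D (0, u)) (at (0, 0)) (v, 0))) (at 0)" for u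
    unfolding linv_def[abs_def] Dgmul_def
    by (rule has_derivative_compose[OF has_derivative_Pair[OF has_derivative_ident has_derivative_const] d])
  from fun_cong[OF frechet_derivative_at[OF this, symmetric]]
  have 2: "frechet_derivative (linv u) (at 0) v = frechet_derivative (?D (0, u)) (at (0, 0)) (v, 0)" for u .
  have "frechet_derivative (?D (v, 0)) (at (0, 0)) (0, u) = frechet_derivative (?D (0, u)) (at (0, 0)) (v, 0)" for u
    by (rule second_derivative_symmetric[OF Ck_gmul_pair])
  then show ?thesis using 1 unfolding 2 by simp
qed

definition Ad :: "real^'n \<Rightarrow> real^'n \<Rightarrow> real^'n" where
  "Ad g v = Dgmul g (ginv g) (linv v g) 0"

lemma Ad_has_derivative: "((\<lambda>y. gmul (gmul g y) (ginv g)) has_derivative Ad g) (at 0)"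
proof -
  have "((\<lambda>y. gmul (gmul g y) (ginv g)) has_derivative (\<lambda>v. Dgmul (gmul g 0) (ginv g) (Dgmul g 0 0 v) 0)) (at 0)"
    by (intro has_derivative_gmul has_derivative_const has_derivative_ident)
  then show ?thesis by (simp add: Ad_def[abs_def] linv_def)
qed

lemma Ad_0 [simp]: "Ad 0 v = v"
  by (simp add: Ad_def)

text \<open>Conjugation by \<open>g\<close> followed by right translation by \<open>g\<close> is
  left translation. Reading the adjoint action through this identity avoids second derivatives of
  the inverse map.\<close>

lemma rinv_Ad: "rinv (Ad g v) g = linv v g"
proof -
  have "((\<lambda>y. gmul (gmul (gmul g y) (ginv g)) g) has_derivative
      (\<lambda>v. Dgmul (gmul (gmul g 0) (ginv g)) g (Ad g v) 0)) (at 0)"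
    by (intro has_derivative_gmul Ad_has_derivative has_derivative_const)
  moreover have "((\<lambda>y. gmul (gmul (gmul g y) (ginv g)) g) has_derivative (\<lambda>v. Dgmul g 0 0 v)) (at 0)"
    unfolding gmul_ginv_cancel_right by (intro has_derivative_gmul has_derivative_const has_derivative_ident)
  ultimately have "(\<lambda>v. Dgmul (gmul (gmul g 0) (ginv g)) g (Ad g v) 0) = (\<lambda>v. Dgmul g 0 0 v)"
    by (rule has_derivative_unique)
  from fun_cong[OF this, of v] show ?thesis by (simp add: rinv_def linv_def)
qed

text \<open>The identity \<open>rinv_Ad\<close> is differentiated at the origin. Subtracting
  \<open>v\<close> makes the argument of \<open>rinv\<close> vanish there, so
  \<open>has_derivative_linear_family\<close> applies, and \<open>rinv_derivative\<close> turns the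
  other side into the bracket.\<close>

lemma Ad_derivative: "((\<lambda>g. Ad g v) has_derivative (\<lambda>u. bracket u v)) (at 0)"
proof -
  let ?A = "\<lambda>u. frechet_derivative (\<lambda>g. Ad g v) (at 0) u"
  have "Ck 1 (\<lambda>g. Ad g v)"
    unfolding Ad_def by (intro Ck_Dgmul_left Ck_linv Ck_ident ginv(3))
  then have A: "((\<lambda>g. Ad g v) has_derivative ?A) (at 0)" by (rule Ck_has_derivative) simp
  have bl: "bounded_linear (\<lambda>w. rinv w x)" for x
    using linear_Dgmul_left by (simp add: rinv_def linear_conv_bounded_linear)
  have "((\<lambda>g. Ad g v - v) has_derivative ?A) (at 0)"
    using has_derivative_diff[OF A has_derivative_const[of v]] by simp
  then have 1: "((\<lambda>g. rinv (Ad g v - v) g) has_derivative (\<lambda>u. rinv (?A u) 0)) (at 0)"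
    by (rule has_derivative_linear_family[OF bl rinv_derivative]) simp
  have eq: "(\<lambda>g. rinv (Ad g v - v) g) = (\<lambda>g. linv v g - rinv v g)"
    by (simp add: rinv_Ad linear_diff[OF bounded_linear.linear[OF bl]])
  have "((\<lambda>g. rinv (Ad g v - v) g) has_derivative (\<lambda>u. bracket u v)) (at 0)"
    unfolding eq bracket_def by (intro has_derivative_diff linv_has_derivative rinv_derivative)
  then have "(\<lambda>u. rinv (?A u) 0) = (\<lambda>u. bracket u v)" using has_derivative_unique[OF 1] by blast
  then have "?A = (\<lambda>u. bracket u v)" by (simp add: rinv_def)
  then show ?thesis using A by simp
qed

text \<open>Differentiating \<open>linv_left_translate\<close> produces, besides the expected term,
  a second derivative of the translation by \<open>z\<close>; being symmetric in \<open>u\<close>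
  and \<open>v\<close>, it cancels in the bracket.\<close>

lemma lie_bracket_linv: "lie_bracket (linv u) (linv v) = linv (bracket u v)"
proof
  fix z
  have bl: "bounded_linear (\<lambda>w. Dgmul z x 0 w)" for x
    using linear_Dgmul_right by (simp add: linear_conv_bounded_linear)
  let ?L = "\<lambda>y. gmul z y"
  let ?D = "\<lambda>w x. frechet_derivative ?L (at x) w"
  have CL: "Ck k ?L" for k by (intro Ck_gmul Ck_const Ck_ident)
  have "(?L has_derivative (\<lambda>w. Dgmul z x 0 w)) (at x)" for x
    by (intro has_derivative_gmul has_derivative_const has_derivative_ident)
  from frechet_derivative_at[OF this] have D: "?D w x = Dgmul z x 0 w" for w x by metis
  have dD: "((\<lambda>x. Dgmul z x 0 w) has_derivative frechet_derivative (?D w) (at x)) (at x)" for w x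
    unfolding D[symmetric] by (rule Ck_Suc_has_derivative[OF Ck_Suc_directional[OF CL]])
  have key: "frechet_derivative (linv v) (at z) (linv u z) =
      linv (frechet_derivative (linv v) (at 0) u) z + frechet_derivative (?D v) (at 0) u" for u v
  proof -
    have 1: "((\<lambda>x. linv v (gmul z x)) has_derivative (\<lambda>u. frechet_derivative (linv v) (at (gmul z 0)) (Dgmul z 0 0 u))) (at 0)"
      by (rule has_derivative_compose[OF _ linv_has_derivative])
        (intro has_derivative_gmul has_derivative_const has_derivative_ident)
    have "((\<lambda>x. linv v x - v) has_derivative frechet_derivative (linv v) (at 0)) (at 0)"
      using has_derivative_diff[OF linv_has_derivative has_derivative_const[of v]] by simp
    then have 2: "((\<lambda>x. Dgmul z x 0 (linv v x - v)) has_derivative (\<lambda>u. Dgmul z 0 0 (frechet_derivative (linv v) (at 0) u))) (at 0)"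
      by (rule has_derivative_linear_family[OF bl dD]) simp
    have eq: "(\<lambda>x. Dgmul z x 0 (linv v x - v) + Dgmul z x 0 v) = (\<lambda>x. linv v (gmul z x))"
      by (simp add: linear_diff[OF bounded_linear.linear[OF bl]] linv_left_translate)
    have "((\<lambda>x. linv v (gmul z x)) has_derivative
        (\<lambda>u. Dgmul z 0 0 (frechet_derivative (linv v) (at 0) u) + frechet_derivative (?D v) (at 0) u)) (at 0)"
      unfolding eq[symmetric] by (rule has_derivative_add[OF 2 dD])
    from fun_cong[OF has_derivative_unique[OF 1 this], of u] show ?thesis by (simp add: linv_def)
  qed
  have "frechet_derivative (?D v) (at 0) u = frechet_derivative (?D u) (at 0) v"
    by (rule second_derivative_symmetric[OF CL])
  then show "lie_bracket (linv u) (linv v) z = linv (bracket u v) z"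
    unfolding lie_bracket_def key bracket_def by (simp add: linear_diff[OF linear_linv])
qed

section \<open>Accessible points and their velocities at the origin\<close>

definition reach_within :: "real \<Rightarrow> real^'n \<Rightarrow> bool" where
  "reach_within M x \<longleftrightarrow> (\<exists>s\<le>M. reach s x)"

lemma reach_within_gmul: "reach_within M x \<Longrightarrow> reach_within N y \<Longrightarrow> reach_within (M + N) (gmul x y)"
  unfolding reach_within_def by (meson add_mono reach_gmul)

lemma reach_within_ginv: "reach_within M x \<Longrightarrow> reach_within M (ginv x)"
  unfolding reach_within_def by (meson reach_ginv)

text \<open>Without a first layer there would be no generators, against the rank condition. So some
  integral curve exists, and at time 0 it is the trivial one.\<close>

lemma reach_0: "reach 0 0"
proof -
  have "horiz deg \<noteq> {}"
  proof
    assume "horiz deg = {}"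
    then have "X \<notin> lie_gen gmul deg" for X
      by (intro notI) (erule lie_gen.induct, simp_all)
    then have "lie_gen gmul deg = {}" by blast
    then have "span {} = (UNIV :: (real^'n) set)" using span_lie_gen[of 0] by simp
    then show False by (metis UNIV_I axis_eq_0_iff singletonD span_empty zero_neq_one)
  qed
  then obtain i where "i \<in> horiz deg" by blast
  from reach_cpt[OF this, of 0] show ?thesis by (simp add: dil_0[OF deg_ge_1])
qed

text \<open>Differentiability is asked at the parameter 0, not horizontality: this is what products,
  conjugates and rescalings inherit and what the open mapping argument in
  \<open>reach_within_ball\<close> uses. The time bound on bounded sets of parameters makes the
  constant obtained there uniform.\<close>

definition tangent :: "real^'n \<Rightarrow> bool" where
  "tangent v \<longleftrightarrow> (\<exists>\<sigma>. continuous_on UNIV \<sigma> \<and> \<sigma> 0 = 0 \<and> (\<sigma> has_vector_derivative v) (at 0) \<and>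
     (\<forall>B. \<exists>M. \<forall>t. \<bar>t\<bar> \<le> B \<longrightarrow> reach_within M (\<sigma> t)))"

lemma tangentE:
  assumes "tangent v"
  obtains \<sigma> M where "continuous_on UNIV \<sigma>" "\<sigma> 0 = 0" "(\<sigma> has_vector_derivative v) (at 0)"
    "\<And>B t. \<bar>t\<bar> \<le> B \<Longrightarrow> reach_within (M B) (\<sigma> t)"
proof -
  from assms obtain \<sigma> where \<sigma>: "continuous_on UNIV \<sigma>" "\<sigma> 0 = 0" "(\<sigma> has_vector_derivative v) (at 0)"
    "\<forall>B. \<exists>M. \<forall>t. \<bar>t\<bar> \<le> B \<longrightarrow> reach_within M (\<sigma> t)" unfolding tangent_def by (elim exE conjE)
  from choice[OF \<sigma>(4)] obtain M where "\<forall>B t. \<bar>t\<bar> \<le> B \<longrightarrow> reach_within (M B) (\<sigma> t)" by (elim exE)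
  with \<sigma> show ?thesis by (intro that[of \<sigma> M]) simp_all
qed

lemma tangentI:
  assumes "continuous_on UNIV \<sigma>" "\<sigma> 0 = 0" "(\<sigma> has_vector_derivative v) (at 0)"
    "\<And>B t. \<bar>t\<bar> \<le> B \<Longrightarrow> reach_within (M B) (\<sigma> t)"
  shows "tangent v"
  unfolding tangent_def
proof (intro exI[of _ \<sigma>] conjI allI)
  show "\<exists>M. \<forall>t. \<bar>t\<bar> \<le> B \<longrightarrow> reach_within M (\<sigma> t)" for B using assms(4)[of _ B] by (intro exI[of _ "M B"]) simp
qed (use assms in simp_all)

lemma tangent_0: "tangent 0"
  by (rule tangentI[of "\<lambda>_. 0" _ "\<lambda>_. 0"]) (auto simp: reach_within_def intro: reach_0)

text \<open>The pointwise product of the curves works because the differential of the group law at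
  the origin is addition.\<close>

lemma tangent_add: assumes "tangent u" "tangent v" shows "tangent (u + v)"
proof -
  from assms(1) obtain \<sigma> M where 1: "continuous_on UNIV \<sigma>" "\<sigma> 0 = 0" "(\<sigma> has_vector_derivative u) (at 0)"
    "\<And>B t. \<bar>t\<bar> \<le> B \<Longrightarrow> reach_within (M B) (\<sigma> t)" by (rule tangentE) (rule that)
  from assms(2) obtain \<tau> N where 2: "continuous_on UNIV \<tau>" "\<tau> 0 = 0" "(\<tau> has_vector_derivative v) (at 0)"
    "\<And>B t. \<bar>t\<bar> \<le> B \<Longrightarrow> reach_within (N B) (\<tau> t)" by (rule tangentE) (rule that)
  show ?thesis
  proof (rule tangentI)
    show "continuous_on UNIV (\<lambda>t. gmul (\<sigma> t) (\<tau> t))" by (intro continuous_on_gmul 1 2)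
    show "((\<lambda>t. gmul (\<sigma> t) (\<tau> t)) has_vector_derivative u + v) (at 0)"
      using has_vector_derivative_gmul[OF 1(3) 2(3)] by (simp add: 1(2) 2(2))
    show "reach_within (M B + N B) (gmul (\<sigma> t) (\<tau> t))" if "\<bar>t\<bar> \<le> B" for B t
      using that by (intro reach_within_gmul 1 2)
  qed (simp add: 1(2) 2(2))
qed

lemma tangent_scaleR: assumes "tangent v" shows "tangent (c *\<^sub>R v)"
proof -
  from assms obtain \<sigma> M where 1: "continuous_on UNIV \<sigma>" "\<sigma> 0 = 0" "(\<sigma> has_vector_derivative v) (at 0)"
    "\<And>B t. \<bar>t\<bar> \<le> B \<Longrightarrow> reach_within (M B) (\<sigma> t)" by (rule tangentE) (rule that)
  show ?thesis
  proof (rule tangentI)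
    show "continuous_on UNIV (\<lambda>t. \<sigma> (c * t))"
      by (intro continuous_on_compose2[OF 1(1)] continuous_intros) simp
    have "((\<lambda>t. c * t) has_vector_derivative c) (at 0)"
      by (auto intro!: derivative_eq_intros)
    from vector_diff_chain_at[OF this, of \<sigma> v] 1(3)
    show "((\<lambda>t. \<sigma> (c * t)) has_vector_derivative c *\<^sub>R v) (at 0)" by (simp add: o_def)
    show "reach_within (M (\<bar>c\<bar> * B)) (\<sigma> (c * t))" if "\<bar>t\<bar> \<le> B" for B t
      using that by (intro 1) (simp add: abs_mult mult_left_mono)
  qed (simp add: 1(2))
qed

lemma subspace_tangent: "subspace {v. tangent v}"
  by (rule subspaceI) (simp_all add: tangent_0 tangent_add tangent_scaleR)

lemma tangent_Ad: assumes "tangent v" "reach_within K g" shows "tangent (Ad g v)"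
proof -
  from assms(1) obtain \<sigma> M where 1: "continuous_on UNIV \<sigma>" "\<sigma> 0 = 0" "(\<sigma> has_vector_derivative v) (at 0)"
    "\<And>B t. \<bar>t\<bar> \<le> B \<Longrightarrow> reach_within (M B) (\<sigma> t)" by (rule tangentE) (rule that)
  show ?thesis
  proof (rule tangentI)
    show "continuous_on UNIV (\<lambda>t. gmul (gmul g (\<sigma> t)) (ginv g))"
      by (intro continuous_on_gmul continuous_on_const 1)
    have "((\<lambda>y. gmul (gmul g y) (ginv g)) has_derivative Ad g) (at (\<sigma> 0))"
      using Ad_has_derivative by (simp add: 1(2))
    from vector_derivative_diff_chain_within[OF 1(3) has_derivative_at_withinI[OF this]]
    show "((\<lambda>t. gmul (gmul g (\<sigma> t)) (ginv g)) has_vector_derivative Ad g v) (at 0)" by (simp add: o_def)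
    show "reach_within (K + M B + K) (gmul (gmul g (\<sigma> t)) (ginv g))" if "\<bar>t\<bar> \<le> B" for B t
      using that by (intro reach_within_gmul reach_within_ginv assms(2) 1)
  qed (simp add: 1(2))
qed

text \<open>Conjugation by accessible elements preserves tangent vectors, so the difference
  quotients of \<open>Ad (\<sigma> t) v\<close> are tangent. A subspace of a finite-dimensional
  space is closed and hence contains their limit, the bracket.\<close>

lemma tangent_bracket: assumes "tangent u" "tangent v" shows "tangent (bracket u v)"
proof -
  from assms(1) obtain \<sigma> M where 1: "continuous_on UNIV \<sigma>" "\<sigma> 0 = 0" "(\<sigma> has_vector_derivative u) (at 0)"
    "\<And>B t. \<bar>t\<bar> \<le> B \<Longrightarrow> reach_within (M B) (\<sigma> t)" by (rule tangentE) (rule that)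
  have "((\<lambda>g. Ad g v) has_derivative (\<lambda>u. bracket u v)) (at (\<sigma> 0))"
    using Ad_derivative by (simp add: 1(2))
  from vector_derivative_diff_chain_within[OF 1(3) has_derivative_at_withinI[OF this]]
  have "((\<lambda>t. Ad (\<sigma> t) v) has_vector_derivative bracket u v) (at 0)" by (simp add: o_def)
  then have lim: "((\<lambda>t. (1 / t) *\<^sub>R (Ad (\<sigma> t) v - v)) \<longlongrightarrow> bracket u v) (at 0)"
    using has_vector_derivative_quotient[of "\<lambda>t. Ad (\<sigma> t) v"] by (simp add: 1(2))
  have "(1 / t) *\<^sub>R (Ad (\<sigma> t) v - v) \<in> {v. tangent v}" for t
  proof -
    have "tangent (Ad (\<sigma> t) v)" using tangent_Ad[OF assms(2) 1(4)[OF order_refl]] .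
    then show ?thesis
      by (intro subspace_scale[OF subspace_tangent] subspace_diff[OF subspace_tangent]) (simp_all add: assms(2))
  qed
  then have "bracket u v \<in> {v. tangent v}"
    by (intro Lim_in_closed_set[OF closed_subspace[OF subspace_tangent] _ _ lim]) simp_all
  then show ?thesis by simp
qed

lemma has_vector_derivative_glue:
  fixes f :: "real \<Rightarrow> real^'n"
  assumes "(f has_vector_derivative v) (at x within {x..})" "(f has_vector_derivative v) (at x within {..x})"
  shows "(f has_vector_derivative v) (at x)"
proof -
  have "(f has_derivative (\<lambda>h. h *\<^sub>R v)) (at x within {x..} \<union> {..x})"
    using assms unfolding has_vector_derivative_def has_derivative_within by (simp add: Lim_Un)
  moreover have "{x..} \<union> {..x} = (UNIV :: real set)" by auto
  ultimately show ?thesis by (simp add: has_vector_derivative_def)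
qed

text \<open>The dilation orbit is a curve for t \<ge> 0. For negative \<open>t\<close> the inverses
  of its points are taken, and since inversion has derivative -1 at the origin the one-sided
  derivatives agree.\<close>

lemma tangent_axis: assumes i: "i \<in> horiz deg" shows "tangent (axis i 1)"
proof (rule tangentI[where \<sigma>="\<lambda>t. if 0 \<le> t then dil deg t (cpt i) else ginv (dil deg (- t) (cpt i))" and M="\<lambda>B. B"])
  let ?p = "\<lambda>t. dil deg t (cpt i)"
  let ?\<sigma> = "\<lambda>t. if 0 \<le> t then ?p t else ginv (?p (- t))"
  show "?\<sigma> 0 = 0" by (simp add: dil_0[OF deg_ge_1])
  have c2: "continuous_on {..0} (\<lambda>t. ginv (?p (- t)))"
    by (intro continuous_on_ginv continuous_on_compose2[OF continuous_on_dil[of UNIV]] continuous_intros) simp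
  have "continuous_on ({0..} \<union> {..0}) ?\<sigma>"
    by (rule continuous_on_cases[OF _ _ continuous_on_dil c2])
      (auto simp: dil_0[OF deg_ge_1])
  moreover have "{0..} \<union> {..0} = (UNIV :: real set)" by auto
  ultimately show "continuous_on UNIV ?\<sigma>" by simp
  have p0: "(?p has_vector_derivative axis i 1) (at 0 within S)" for S by (rule integral_curve_0[OF i])
  have "((\<lambda>t. - t) has_vector_derivative - 1) (at 0 within {..0})"
    by (auto intro!: derivative_eq_intros)
  from vector_diff_chain_within[OF this, of ?p "axis i 1"] p0
  have "((\<lambda>t. ?p (- t)) has_vector_derivative - axis i 1) (at 0 within {..0})" by (simp add: o_def)
  from vector_derivative_diff_chain_within[OF this, of ginv uminus] ginv_has_derivative_0
  have m: "((\<lambda>t. ginv (?p (- t))) has_vector_derivative axis i 1) (at 0 within {..0})"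
    by (simp add: o_def dil_0[OF deg_ge_1] has_derivative_at_withinI)
  show "(?\<sigma> has_vector_derivative axis i 1) (at 0)"
  proof (rule has_vector_derivative_glue)
    show "(?\<sigma> has_vector_derivative axis i 1) (at 0 within {0..})"
      by (rule has_vector_derivative_transform[OF _ _ p0]) simp_all
    show "(?\<sigma> has_vector_derivative axis i 1) (at 0 within {..0})"
      by (rule has_vector_derivative_transform[OF _ _ m]) (simp_all add: dil_0[OF deg_ge_1] antisym_conv)
  qed
  fix B t :: real assume "\<bar>t\<bar> \<le> B"
  then show "reach_within B (?\<sigma> t)"
    unfolding reach_within_def by (intro exI[of _ "\<bar>t\<bar>"]) (auto intro!: reach_ginv reach_cpt[OF i])
qed

text \<open>By induction along the brackets, every generated field is left-invariant with a tangent
  value at the origin, where the rank condition makes these values span everything.\<close>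

lemma tangent_all: "tangent v"
proof -
  have "\<exists>v. tangent v \<and> X = linv v" if "X \<in> lie_gen gmul deg" for X
    using that
  proof induction
    case (base j)
    then show ?case using tangent_axis Zvf_eq_linv by (intro exI[of _ "axis j 1"]) simp
  next
    case (brk X Y)
    then show ?case using tangent_bracket lie_bracket_linv by blast
  qed
  then have "(\<lambda>X. X 0) ` lie_gen gmul deg \<subseteq> {v. tangent v}" by fastforce
  then have "span ((\<lambda>X. X 0) ` lie_gen gmul deg) \<subseteq> {v. tangent v}"
    by (rule span_minimal[OF _ subspace_tangent])
  then show ?thesis unfolding span_lie_gen by blast
qed

text \<open>The product of curves tangent to the coordinate axes, one for each coordinate, is a map
  with identity derivative at the origin, so its image contains a ball.\<close>

lemma reach_within_ball: obtains r M where "r > 0" "\<And>x. norm x < r \<Longrightarrow> reach_within M x"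
proof -
  have "\<forall>k. \<exists>\<sigma>. continuous_on UNIV \<sigma> \<and> \<sigma> 0 = 0 \<and> (\<sigma> has_vector_derivative axis k 1) (at 0) \<and>
     (\<forall>B. \<exists>M. \<forall>t. \<bar>t\<bar> \<le> B \<longrightarrow> reach_within M (\<sigma> t))"
    using tangent_all unfolding tangent_def by blast
  from choice[OF this] obtain \<sigma> where
    "\<forall>k. continuous_on UNIV (\<sigma> k) \<and> \<sigma> k 0 = 0 \<and> (\<sigma> k has_vector_derivative axis k 1) (at 0) \<and>
     (\<forall>B. \<exists>M. \<forall>t. \<bar>t\<bar> \<le> B \<longrightarrow> reach_within M (\<sigma> k t))" by (elim exE)
  then have \<sigma>: "\<And>k. continuous_on UNIV (\<sigma> k)" "\<And>k. \<sigma> k 0 = 0"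
    "\<And>k. (\<sigma> k has_vector_derivative axis k 1) (at 0)"
    "\<And>k. \<exists>M. \<forall>t. \<bar>t\<bar> \<le> 1 \<longrightarrow> reach_within M (\<sigma> k t)" by simp_all
  define F where "F ks t = foldr (\<lambda>k y. gmul (\<sigma> k (t $ k)) y) ks 0" for ks and t :: "real^'n"
  have F0: "F ks 0 = 0" for ks by (induction ks) (simp_all add: F_def \<sigma>(2))
  have Fc: "continuous_on UNIV (F ks)" for ks
  proof (induction ks)
    case (Cons k ks)
    have "continuous_on UNIV (\<lambda>t :: real^'n. \<sigma> k (t $ k))"
      by (rule continuous_on_compose2[OF \<sigma>(1) continuous_on_component[OF continuous_on_id]]) simp
    from continuous_on_gmul[OF this Cons] show ?case by (simp add: F_def[abs_def])
  qed (simp add: F_def[abs_def])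
  have Fd: "(F ks has_derivative (\<lambda>h. \<Sum>k\<leftarrow>ks. (h $ k) *\<^sub>R axis k 1)) (at 0)" for ks
  proof (induction ks)
    case (Cons k ks)
    have "((\<lambda>t :: real^'n. t $ k) has_derivative (\<lambda>h. h $ k)) (at 0)"
      by (rule bounded_linear_imp_has_derivative[OF bounded_linear_vec_nth])
    from has_derivative_compose[OF this, of "\<sigma> k" "\<lambda>s. s *\<^sub>R axis k 1"] \<sigma>(3)[of k]
    have "((\<lambda>t :: real^'n. \<sigma> k (t $ k)) has_derivative (\<lambda>h. (h $ k) *\<^sub>R axis k 1)) (at 0)"
      by (simp add: has_vector_derivative_def)
    from has_derivative_gmul[OF this Cons]
    have "((\<lambda>t. gmul (\<sigma> k (t $ k)) (F ks t)) has_derivative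
        (\<lambda>h. (h $ k) *\<^sub>R axis k 1 + (\<Sum>k\<leftarrow>ks. (h $ k) *\<^sub>R axis k 1))) (at 0)"
      by (simp only: F0 zero_index \<sigma>(2) Dgmul_0_0)
    moreover have "F (k # ks) = (\<lambda>t. gmul (\<sigma> k (t $ k)) (F ks t))" by (simp add: F_def fun_eq_iff)
    ultimately show ?case by simp
  qed (simp add: F_def[abs_def])
  have Fw: "\<exists>M. \<forall>t. norm t < 1 \<longrightarrow> reach_within M (F ks t)" for ks
  proof (induction ks)
    case Nil
    then show ?case using reach_0 by (auto simp: F_def reach_within_def)
  next
    case (Cons k ks)
    then obtain M where M: "\<forall>t. norm t < 1 \<longrightarrow> reach_within M (F ks t)" by (elim exE)
    obtain N where N: "\<forall>t. \<bar>t\<bar> \<le> 1 \<longrightarrow> reach_within N (\<sigma> k t)" using \<sigma>(4)[of k] by (elim exE)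
    have "reach_within (N + M) (F (k # ks) t)" if "norm t < 1" for t
    proof -
      have "\<bar>t $ k\<bar> \<le> 1" using that component_le_norm_cart[of t k] by linarith
      then have "reach_within (N + M) (gmul (\<sigma> k (t $ k)) (F ks t))" using M N that by (intro reach_within_gmul) simp_all
      then show ?thesis by (simp add: F_def)
    qed
    then show ?case by blast
  qed
  obtain ks where ks: "set ks = (UNIV :: 'n set)" "distinct ks"
    using finite_distinct_list[OF finite[of UNIV]] by blast
  have id: "(\<lambda>h. \<Sum>k\<leftarrow>ks. (h $ k) *\<^sub>R axis k 1) = (id :: real^'n \<Rightarrow> _)"
    by (simp add: sum_list_distinct_conv_sum_set[OF ks(2)] ks(1) fun_eq_iff basis_expansion flip: scalar_mult_eq_scaleR)
  \<comment> \<open>The map is known to be differentiable at a single point, so an open mapping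
    theorem for continuous maps takes the place of the inverse function theorem.\<close>
  have "F ks 0 \<in> interior (F ks ` ball 0 1)"
    by (rule sussmann_open_mapping[OF open_UNIV Fc _ Fd[of ks, unfolded id] bounded_linear_ident[folded id_def]])
      simp_all
  then obtain r where r: "r > 0" "ball 0 r \<subseteq> F ks ` ball 0 1"
    unfolding mem_interior F0 by blast
  obtain M where M: "\<forall>t. norm t < 1 \<longrightarrow> reach_within M (F ks t)" using Fw by blast
  show ?thesis
  proof (rule that[OF r(1)])
    fix x :: "real^'n" assume "norm x < r"
    then have "x \<in> F ks ` ball 0 1" using r(2) by (auto simp: dist_norm)
    then show "reach_within M x" using M by (auto simp: dist_norm)
  qed
qed

end

section \<open>Integration of compactly supported functions\<close>

text \<open>Completeness of Lebesgue measure: the part of a preimage inside the exceptional null set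
  is measurable whatever it is.\<close>

lemma borel_measurable_lebesgue_AE_eq:
  fixes f g :: "'a::euclidean_space \<Rightarrow> real"
  assumes g: "g \<in> borel_measurable lebesgue" and eq: "AE x in lebesgue. g x = f x"
  shows "f \<in> borel_measurable lebesgue"
proof (rule measurableI)
  fix A :: "real set" assume A: "A \<in> sets borel"
  from eq obtain N where N: "{x. g x \<noteq> f x} \<subseteq> N" "N \<in> null_sets lebesgue"
    by (auto simp: eventually_ae_filter)
  have N': "g x = f x" if "x \<notin> N" for x using N(1) that by auto
  have "f -` A \<inter> N \<in> sets lebesgue"
    using N(2) null_sets_completion_iff2[of "f -` A \<inter> N" lborel] null_sets_completion_iff2[of N lborel]
    by (auto simp: null_sets_def)
  moreover have "(g -` A \<inter> space lebesgue) - N \<in> sets lebesgue"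
    using measurable_sets[OF g A] N(2) by (intro sets.Diff) auto
  moreover have "f -` A \<inter> space lebesgue = ((g -` A \<inter> space lebesgue) - N) \<union> (f -` A \<inter> N)"
    by (auto simp: N')
  ultimately show "f -` A \<inter> space lebesgue \<in> sets lebesgue" by (metis sets.Un)
qed simp

lemma borel_measurable_lebesgue_AE_LIMSEQ:
  fixes f :: "'a::euclidean_space \<Rightarrow> real"
  assumes s: "\<And>n. s n \<in> borel_measurable lebesgue" and lim: "AE x in lebesgue. (\<lambda>n. s n x) \<longlonglongrightarrow> f x"
  shows "f \<in> borel_measurable lebesgue"
proof (rule borel_measurable_lebesgue_AE_eq)
  show "(\<lambda>x. lim (\<lambda>n. s n x)) \<in> borel_measurable lebesgue" by (intro borel_measurable_lim_metric s)
  show "AE x in lebesgue. lim (\<lambda>n. s n x) = f x" using lim by eventually_elim (rule limI)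
qed

text \<open>With an explicit radius, the translates, difference quotients and averages of one
  function share one ball and hence one dominating function.\<close>

definition supported :: "real \<Rightarrow> ('a::real_normed_vector \<Rightarrow> real) \<Rightarrow> bool" where
  "supported R f \<longleftrightarrow> (\<forall>x. f x \<noteq> 0 \<longrightarrow> norm x \<le> R)"

lemma supportedD: "supported R f \<Longrightarrow> norm x > R \<Longrightarrow> f x = 0"
  unfolding supported_def by (metis not_le)

lemma supported_mono: "supported R f \<Longrightarrow> R \<le> S \<Longrightarrow> supported S f"
  unfolding supported_def by (meson order_trans)

lemma continuous_lebesgue_measurable:
  fixes f :: "'a::euclidean_space \<Rightarrow> real"
  assumes "continuous_on UNIV f" shows "f \<in> borel_measurable lebesgue"
  by (rule measurable_completion) (use borel_measurable_continuous_onI[OF assms] in simp)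

lemma integrable_lebesgue_bounded_supported:
  fixes f :: "'a::euclidean_space \<Rightarrow> real"
  assumes f: "f \<in> borel_measurable lebesgue" and b: "AE x in lebesgue. \<bar>f x\<bar> \<le> B * indicator (cball 0 R) x"
  shows "integrable lebesgue f"
proof (rule Bochner_Integration.integrable_bound[OF _ f])
  have "integrable lebesgue (indicator (cball (0::'a) R) :: 'a \<Rightarrow> real)"
    by (rule integrable_real_indicator) (simp_all add: emeasure_bounded_finite[OF bounded_cball, unfolded infinity_ennreal_def])
  then show "integrable lebesgue (\<lambda>x. B * indicator (cball (0::'a) R) x :: real)"
    by (rule integrable_mult_right)
  show "AE x in lebesgue. norm (f x) \<le> norm (B * indicator (cball 0 R) x)"
    using b by eventually_elim auto
qed

lemma dominated_convergence_supported:
  fixes f :: "'a::euclidean_space \<Rightarrow> real"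
  assumes f: "f \<in> borel_measurable lebesgue" and s: "\<And>n. s n \<in> borel_measurable lebesgue"
    and lim: "AE x in lebesgue. (\<lambda>n. s n x) \<longlonglongrightarrow> f x"
    and b: "\<And>n. AE x in lebesgue. \<bar>s n x\<bar> \<le> B * indicator (cball 0 R) x"
  shows "integrable lebesgue f" "(\<lambda>n. integral\<^sup>L lebesgue (s n)) \<longlonglongrightarrow> integral\<^sup>L lebesgue f"
proof -
  have "integrable lebesgue (indicator (cball (0::'a) R) :: 'a \<Rightarrow> real)"
    by (rule integrable_real_indicator) (simp_all add: emeasure_bounded_finite[OF bounded_cball, unfolded infinity_ennreal_def])
  then have i: "integrable lebesgue (\<lambda>x. B * indicator (cball (0::'a) R) x :: real)"
    by (rule integrable_mult_right)
  show "integrable lebesgue f"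
    by (rule integrable_dominated_convergence[OF f s i lim]) (use b in simp)
  show "(\<lambda>n. integral\<^sup>L lebesgue (s n)) \<longlonglongrightarrow> integral\<^sup>L lebesgue f"
    by (rule integral_dominated_convergence[OF f s i lim]) (use b in simp)
qed

lemma continuous_bounded_on_cball:
  fixes f :: "'a::euclidean_space \<Rightarrow> 'b::real_normed_vector"
  assumes "continuous_on UNIV f"
  obtains B where "B \<ge> 0" "\<And>x. norm x \<le> R \<Longrightarrow> norm (f x) \<le> B"
proof -
  have "compact (f ` cball 0 R)"
    by (intro compact_continuous_image compact_cball continuous_on_subset[OF assms]) simp
  from compact_imp_bounded[OF this] obtain B where "\<forall>x\<in>f ` cball 0 R. norm x \<le> B"
    unfolding bounded_iff by (elim exE)
  then have "norm (f x) \<le> max B 0" if "norm x \<le> R" for x using that by (force simp: dist_norm)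
  then show ?thesis by (intro that[of "max B 0"]) simp_all
qed

lemma continuous_supported_bounded:
  fixes f :: "'a::euclidean_space \<Rightarrow> real"
  assumes "continuous_on UNIV f" "supported R f"
  obtains B where "B \<ge> 0" "\<And>x. \<bar>f x\<bar> \<le> B * indicator (cball 0 R) x" "\<And>x. \<bar>f x\<bar> \<le> B"
proof -
  obtain B where B: "B \<ge> 0" "\<And>x. norm x \<le> R \<Longrightarrow> norm (f x) \<le> B" using continuous_bounded_on_cball[OF assms(1)] by blast
  have 1: "\<bar>f x\<bar> \<le> B * indicator (cball 0 R) x" for x
    using B supportedD[OF assms(2), of x] by (cases "norm x \<le> R") (simp_all add: dist_norm)
  have "\<bar>f x\<bar> \<le> B" for x
    using B supportedD[OF assms(2), of x] by (cases "norm x \<le> R") simp_all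
  with B(1) 1 show ?thesis by (rule that)
qed

lemma integrable_continuous_supported:
  fixes f :: "'a::euclidean_space \<Rightarrow> real"
  assumes "continuous_on UNIV f" "supported R f"
  shows "integrable lebesgue f"
proof -
  obtain B where "B \<ge> 0" "\<And>x. \<bar>f x\<bar> \<le> B * indicator (cball 0 R) x" "\<And>x. \<bar>f x\<bar> \<le> B"
    by (rule continuous_supported_bounded[OF assms]) (rule that)
  then show ?thesis by (intro integrable_lebesgue_bounded_supported[of f B R] continuous_lebesgue_measurable assms) simp
qed

context carnot
begin

section \<open>The Carnot--Caratheodory norm\<close>

abbreviation d :: "real^'n \<Rightarrow> real" where "d \<equiv> dnorm gmul deg"

lemma d_eq_Inf: "d x = Inf {t. reach t x}"
  by (simp add: dnorm_def ccdist_def reach_def)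

text \<open>Dilate \<open>x\<close> into the ball of \<open>reach_within_ball\<close> and dilate the
  curve back.\<close>

lemma reach_exists: "\<exists>t. reach t x"
proof -
  obtain r M where r: "r > 0" "\<And>x. norm x < r \<Longrightarrow> reach_within M x" using reach_within_ball by blast
  have "isCont (\<lambda>l. dil deg l x) 0" using continuous_on_dil[of UNIV deg x] by (simp add: continuous_on_eq_continuous_at)
  then have "((\<lambda>l. dil deg l x) \<longlongrightarrow> dil deg 0 x) (at_right 0)"
    unfolding isCont_def by (rule tendsto_within_subset) simp
  then have "\<forall>\<^sub>F l in at_right 0. norm (dil deg l x) < r"
    using r(1) by (auto simp: dil_0[OF deg_ge_1] tendsto_iff dist_norm)
  then have "\<forall>\<^sub>F l in at_right (0::real). norm (dil deg l x) < r \<and> 0 < l"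
    using eventually_at_right_less[of "0::real"] by eventually_elim simp
  then obtain l where l: "norm (dil deg l x) < r" "l > 0"
    using eventually_happens'[of "at_right (0::real)"] by force
  from r(2)[OF l(1)] obtain s where "reach s (dil deg l x)" unfolding reach_within_def by blast
  from reach_dil[OF this, of "1 / l"] l(2) show ?thesis by (auto simp: dil_dil)
qed

lemma d_le: "reach t x \<Longrightarrow> d x \<le> t"
  unfolding d_eq_Inf by (rule cInf_lower) (auto simp: reach_def intro: bdd_belowI[of _ 0])

lemma d_nonneg: "d x \<ge> 0"
  unfolding d_eq_Inf by (rule cInf_greatest) (use reach_exists[of x] in simp, simp add: reach_def)

lemma d_lessD: "d x < t \<Longrightarrow> \<exists>s<t. reach s x"
proof -
  have "{t. reach t x} \<noteq> {}" using reach_exists[of x] by blast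
  moreover have "bdd_below {t. reach t x}" by (rule bdd_belowI[of _ 0]) (simp add: reach_def)
  ultimately show "d x < t \<Longrightarrow> \<exists>s<t. reach s x" unfolding d_eq_Inf by (simp add: cInf_less_iff) blast
qed

lemma d_le_reach_within: "reach_within M x \<Longrightarrow> d x \<le> M"
  unfolding reach_within_def using d_le order_trans by blast

lemma d_0 [simp]: "d 0 = 0"
  using d_le[OF reach_0] d_nonneg[of 0] by simp

lemma d_gmul: "d (gmul x y) \<le> d x + d y"
proof (rule field_le_epsilon)
  fix e :: real assume "e > 0"
  then obtain s t where "s < d x + e / 2" "reach s x" "t < d y + e / 2" "reach t y"
    using d_lessD[of x "d x + e / 2"] d_lessD[of y "d y + e / 2"] by auto
  then show "d (gmul x y) \<le> d x + d y + e" using d_le[OF reach_gmul] by force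
qed

lemma d_dil_le: assumes "l > 0" shows "d (dil deg l x) \<le> l * d x"
proof (rule field_le_epsilon)
  fix e :: real assume "e > 0"
  then obtain s where s: "s < d x + e / l" "reach s x"
    using d_lessD[of x "d x + e / l"] assms by auto
  then have "d (dil deg l x) \<le> l * s" using d_le[OF reach_dil[OF s(2) assms]] by simp
  also have "\<dots> \<le> l * (d x + e / l)" using s(1) assms by (intro mult_left_mono) auto
  finally show "d (dil deg l x) \<le> l * d x + e" using assms by (simp add: distrib_left)
qed

lemma d_dil: assumes "l > 0" shows "d (dil deg l x) = l * d x"
proof (rule antisym[OF d_dil_le[OF assms]])
  have "d x \<le> (1 / l) * d (dil deg l x)"
    using d_dil_le[of "1 / l" "dil deg l x"] assms by (simp add: dil_dil)
  then show "l * d x \<le> d (dil deg l x)" using assms by (simp add: field_simps)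
qed

lemma d_ginv_le: "d x \<le> d (gmul x y) + d (ginv y)"
  using d_gmul[of "gmul x y" "ginv y"] by simp

lemma d_tendsto_0: "(d \<longlongrightarrow> 0) (at 0)"
proof (rule tendstoI)
  fix e :: real assume e: "e > 0"
  obtain r M where r: "r > 0" "\<And>x. norm x < r \<Longrightarrow> reach_within M x" using reach_within_ball by blast
  \<comment> \<open>The time bound \<open>M\<close> becomes \<open>l * M\<close> after dilation by
    \<open>l\<close>; the summand 1 keeps the denominator positive and the final bound
    strict.\<close>
  define l where "l = e / (\<bar>M\<bar> + 1)"
  have l: "l > 0" using e by (simp add: l_def add_nonneg_pos)
  have "continuous_on UNIV (dil deg (1 / l))" by (intro linear_continuous_on dil_linear)
  then have "(dil deg (1 / l) \<longlongrightarrow> dil deg (1 / l) 0) (at 0)" by (simp only: continuous_on_eq_continuous_at[OF open_UNIV] isCont_def UNIV_I ball_UNIV)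
  then have "\<forall>\<^sub>F x in at 0. norm (dil deg (1 / l) x) < r" using r(1) by (auto simp: tendsto_iff dist_norm)
  then show "\<forall>\<^sub>F x in at 0. dist (d x) 0 < e"
  proof eventually_elim
    case (elim x)
    have "d x = l * d (dil deg (1 / l) x)" using d_dil[OF l, of "dil deg (1 / l) x"] l by (simp add: dil_dil)
    also have "\<dots> \<le> l * M" using l by (intro mult_left_mono d_le_reach_within r(2) elim) simp
    also have "\<dots> < l * (\<bar>M\<bar> + 1)" using l by (intro mult_strict_left_mono) simp_all
    also have "\<dots> = e" by (simp add: l_def)
    finally show ?case using d_nonneg[of x] by simp
  qed
qed

text \<open>The triangle inequality bounds the change of \<open>d\<close> from \<open>x\<close> to
  \<open>y\<close> by the values of \<open>d\<close> at x^-1 y and at its inverse, which reduces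
  continuity to the origin.\<close>

lemma continuous_on_d_UNIV: "continuous_on UNIV d"
  unfolding continuous_on_eq_continuous_at[OF open_UNIV]
proof
  fix x :: "real^'n"
  have "isCont d 0" using d_tendsto_0 by (simp add: isCont_def)
  then have c: "isCont d (gmul (ginv x) x)" "isCont d (ginv (gmul (ginv x) x))" by simp_all
  have g: "isCont (\<lambda>y. gmul (ginv x) y) x"
    using continuous_on_gmul[OF continuous_on_const continuous_on_id, of UNIV "ginv x"] by (simp add: continuous_on_eq_continuous_at)
  have i: "isCont (\<lambda>y. ginv (gmul (ginv x) y)) x"
    using continuous_on_ginv[OF continuous_on_gmul[OF continuous_on_const continuous_on_id, of UNIV "ginv x"]] by (simp add: continuous_on_eq_continuous_at)
  have "((\<lambda>y. d (gmul (ginv x) y) + d (ginv (gmul (ginv x) y))) \<longlongrightarrow> 0 + 0) (at x)"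
    using isCont_o2[OF g c(1)] isCont_o2[OF i c(2)] by (intro tendsto_add) (simp_all add: isCont_def)
  then have "((\<lambda>y. d y - d x) \<longlongrightarrow> 0) (at x)"
  proof (rule Lim_null_comparison[rotated, OF tendsto_eq_rhs])
    show "\<forall>\<^sub>F y in at x. norm (d y - d x) \<le> d (gmul (ginv x) y) + d (ginv (gmul (ginv x) y))"
    proof (rule always_eventually, rule allI)
      fix y
      show "norm (d y - d x) \<le> d (gmul (ginv x) y) + d (ginv (gmul (ginv x) y))"
        using d_gmul[of x "gmul (ginv x) y"] d_ginv_le[of x "gmul (ginv x) y"]
          d_nonneg[of "gmul (ginv x) y"] d_nonneg[of "ginv (gmul (ginv x) y)"]
        unfolding gmul_ginv_cancel real_norm_def by linarith
    qed
  qed simp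
  then show "isCont d x" unfolding isCont_def by (simp add: LIM_zero_iff)
qed

lemma continuous_on_d [continuous_intros]: "continuous_on S f \<Longrightarrow> continuous_on S (\<lambda>x. d (f x))"
  by (rule continuous_on_compose2[OF continuous_on_d_UNIV]) auto

section \<open>Difference quotients along horizontal directions\<close>

text \<open>Uniform in the base point, so that \<open>L\<close> dominates all difference quotients
  with steps up to 1.\<close>

definition hlip :: "'n \<Rightarrow> real \<Rightarrow> (real^'n \<Rightarrow> real) \<Rightarrow> bool" where
  "hlip i L h \<longleftrightarrow> (\<forall>x t. \<bar>t\<bar> \<le> 1 \<longrightarrow> \<bar>h (gmul x (t *\<^sub>R axis i 1)) - h x\<bar> \<le> L * \<bar>t\<bar>)"

lemma hlipD: "hlip i L h \<Longrightarrow> \<bar>t\<bar> \<le> 1 \<Longrightarrow> \<bar>h (gmul x (t *\<^sub>R axis i 1)) - h x\<bar> \<le> L * \<bar>t\<bar>"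
  by (simp add: hlip_def)

text \<open>An increment in the first layer is a dilated unit vector, so \<open>d\<close> of it is
  linear in the length. Dilations have positive factors, so the negative unit vector is treated
  separately; the inverses account for the lower bound on the increment.\<close>

lemma hlip_d: assumes i: "i \<in> horiz deg" obtains C where "C \<ge> 0" "hlip i C d"
proof -
  let ?e = "axis i 1 :: real^'n"
  define C where "C = d ?e + d (ginv ?e) + d (- ?e) + d (ginv (- ?e))"
  have *: "d (t *\<^sub>R ?e) \<le> C * \<bar>t\<bar> \<and> d (ginv (t *\<^sub>R ?e)) \<le> C * \<bar>t\<bar>" for t
  proof (cases t "0::real" rule: linorder_cases)
    case greater
    have "t *\<^sub>R ?e = dil deg t ?e" using i by (simp add: dil_axis horiz_def)
    then have "d (t *\<^sub>R ?e) = t * d ?e" "d (ginv (t *\<^sub>R ?e)) = t * d (ginv ?e)"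
      using greater by (simp_all add: d_dil flip: dil_ginv)
    moreover have "d ?e \<le> C" "d (ginv ?e) \<le> C" using d_nonneg by (simp_all add: C_def add_nonneg_nonneg)
    ultimately show ?thesis using greater by (simp add: mult.commute[of C] mult_left_mono)
  next
    case less
    have "- ?e = axis i (- 1)" by (simp add: axis_def vec_eq_iff)
    then have "dil deg (- t) (- ?e) = (- t) *\<^sub>R axis i (- 1)" using i by (simp only: dil_axis) (simp add: horiz_def)
    then have "t *\<^sub>R ?e = dil deg (- t) (- ?e)" by (simp add: vec_eq_iff axis_def)
    then have "d (t *\<^sub>R ?e) = (- t) * d (- ?e)" "d (ginv (t *\<^sub>R ?e)) = (- t) * d (ginv (- ?e))"
      using less by (simp_all only: d_dil neg_0_less_iff_less flip: dil_ginv)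
    moreover have "d (- ?e) \<le> C" "d (ginv (- ?e)) \<le> C" using d_nonneg by (simp_all add: C_def add_nonneg_nonneg)
    ultimately show ?thesis using less mult_left_mono[of _ C "- t"] by (simp add: mult.commute[of C])
  qed simp
  have "hlip i C d"
    unfolding hlip_def
  proof (intro allI impI)
    fix x t
    show "\<bar>d (gmul x (t *\<^sub>R ?e)) - d x\<bar> \<le> C * \<bar>t\<bar>"
      using *[of t] d_gmul[of x "t *\<^sub>R ?e"] d_ginv_le[of x "t *\<^sub>R ?e"] by linarith
  qed
  moreover have "C \<ge> 0" using d_nonneg by (simp add: C_def add_nonneg_nonneg)
  ultimately show ?thesis using that by blast
qed

section \<open>Supports of translates and horizontal derivatives of C^1 functions\<close>

lemma gmul_bounded: obtains B where "B \<ge> 0" "\<And>x y. norm x \<le> R \<Longrightarrow> norm y \<le> R \<Longrightarrow> norm (gmul x y) \<le> B"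
proof -
  obtain B where B: "B \<ge> 0" "\<And>p. norm p \<le> 2 * \<bar>R\<bar> \<Longrightarrow> norm (gmul (fst p) (snd p)) \<le> B"
    using continuous_bounded_on_cball[OF Ck_imp_continuous_on[OF Ck_gmul_pair]] by blast
  have "norm (gmul x y) \<le> B" if "norm x \<le> R" "norm y \<le> R" for x y
    using B(2)[of "(x, y)"] norm_Pair_le[of x y] that by simp
  with B(1) show ?thesis by (rule that)
qed

lemma gmul_ginv_bounded: obtains B where "B \<ge> 0" "\<And>x y. norm x \<le> R \<Longrightarrow> norm y \<le> R \<Longrightarrow> norm (gmul x (ginv y)) \<le> B"
  "\<And>x y. norm x \<le> R \<Longrightarrow> norm y \<le> R \<Longrightarrow> norm (gmul (ginv x) y) \<le> B"
proof -
  obtain I where I: "I \<ge> 0" "\<And>x. norm x \<le> R \<Longrightarrow> norm (ginv x) \<le> I"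
    using continuous_bounded_on_cball[OF Ck_imp_continuous_on[OF ginv(3)]] by blast
  obtain B where B: "B \<ge> 0" "\<And>x y. norm x \<le> max R I \<Longrightarrow> norm y \<le> max R I \<Longrightarrow> norm (gmul x y) \<le> B"
    using gmul_bounded by blast
  have "norm (gmul x (ginv y)) \<le> B" if "norm x \<le> R" "norm y \<le> R" for x y
    using I(2)[OF that(2)] that(1) by (intro B(2)) simp_all
  moreover have "norm (gmul (ginv x) y) \<le> B" if "norm x \<le> R" "norm y \<le> R" for x y
    using I(2)[OF that(1)] that(2) by (intro B(2)) simp_all
  ultimately show ?thesis using B(1) that by blast
qed

lemma supported_right_translates:
  assumes "supported R f" obtains S where "S \<ge> R" "\<And>y. norm y \<le> 1 \<Longrightarrow> supported S (\<lambda>x. f (gmul x y))"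
proof -
  obtain B where B: "B \<ge> 0" "\<And>x y. norm x \<le> max R 1 \<Longrightarrow> norm y \<le> max R 1 \<Longrightarrow> norm (gmul x (ginv y)) \<le> B"
    "\<And>x y. norm x \<le> max R 1 \<Longrightarrow> norm y \<le> max R 1 \<Longrightarrow> norm (gmul (ginv x) y) \<le> B"
    by (rule gmul_ginv_bounded) (rule that)
  have "supported (max R B) (\<lambda>x. f (gmul x y))" if "norm y \<le> 1" for y
    unfolding supported_def
  proof (intro allI impI)
    fix x assume "f (gmul x y) \<noteq> 0"
    then have "norm (gmul x y) \<le> R" using assms by (simp add: supported_def)
    then have "norm (gmul (gmul x y) (ginv y)) \<le> B" using that by (intro B(2)) simp_all
    then show "norm x \<le> max R B" by simp
  qed
  then show ?thesis by (intro that[of "max R B"]) simp_all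
qed

lemma supported_left_translates:
  assumes "supported R f" obtains S where "S \<ge> R" "\<And>y. norm y \<le> 1 \<Longrightarrow> supported S (\<lambda>x. f (gmul y x))"
proof -
  obtain B where B: "B \<ge> 0" "\<And>x y. norm x \<le> max R 1 \<Longrightarrow> norm y \<le> max R 1 \<Longrightarrow> norm (gmul x (ginv y)) \<le> B"
    "\<And>x y. norm x \<le> max R 1 \<Longrightarrow> norm y \<le> max R 1 \<Longrightarrow> norm (gmul (ginv x) y) \<le> B"
    by (rule gmul_ginv_bounded) (rule that)
  have "supported (max R B) (\<lambda>x. f (gmul y x))" if "norm y \<le> 1" for y
    unfolding supported_def
  proof (intro allI impI)
    fix x assume "f (gmul y x) \<noteq> 0"
    then have "norm (gmul y x) \<le> R" using assms by (simp add: supported_def)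
    then have "norm (gmul (ginv y) (gmul y x)) \<le> B" using that by (intro B(3)) simp_all
    then show "norm x \<le> max R B" by simp
  qed
  then show ?thesis by (intro that[of "max R B"]) simp_all
qed

lemma integral_right_translate:
  fixes f :: "real^'n \<Rightarrow> real"
  assumes "continuous_on UNIV f"
  shows "integral\<^sup>L lebesgue (\<lambda>x. f (gmul x y)) = integral\<^sup>L lebesgue f"
proof -
  have g: "(\<lambda>x. gmul x y) \<in> borel_measurable borel"
    by (intro borel_measurable_continuous_onI continuous_on_gmul continuous_on_id continuous_on_const)
  have f: "f \<in> borel_measurable borel" by (rule borel_measurable_continuous_onI[OF assms])
  have "integral\<^sup>L lborel f = integral\<^sup>L (distr lborel borel (\<lambda>x. gmul x y)) f"
    by (simp only: distr_right_translation)
  also have "\<dots> = integral\<^sup>L lborel (\<lambda>x. f (gmul x y))"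
    using g f by (intro integral_distr) simp_all
  finally show ?thesis using f g measurable_compose[OF g f] by (simp add: integral_completion)
qed

lemma step_has_derivative:
  assumes "(\<phi> has_derivative D) (at x)"
  shows "((\<lambda>t. \<phi> (gmul x (t *\<^sub>R axis i 1))) has_real_derivative D (Zvf gmul i x)) (at 0)"
proof -
  have "((\<lambda>t. t *\<^sub>R axis i 1 :: real^'n) has_vector_derivative axis i 1) (at 0)"
    by (auto intro!: derivative_eq_intros)
  from has_vector_derivative_gmul[OF has_vector_derivative_const this, of x]
  have "((\<lambda>t. gmul x (t *\<^sub>R axis i 1)) has_vector_derivative Zvf gmul i x) (at 0)"
    by (simp add: Zvf_eq_linv linv_def)
  moreover have "(\<phi> has_derivative D) (at (gmul x (0 *\<^sub>R axis i 1)))" using assms by simp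
  ultimately have "((\<phi> \<circ> (\<lambda>t. gmul x (t *\<^sub>R axis i 1))) has_vector_derivative D (Zvf gmul i x)) (at 0)"
    by (rule vector_derivative_diff_chain_within[OF _ has_derivative_at_withinI])
  then show ?thesis by (simp add: o_def has_real_derivative_iff_has_vector_derivative)
qed

lemma hderiv_eq: "(\<phi> has_derivative D) (at x) \<Longrightarrow> hderiv gmul i \<phi> x = D (Zvf gmul i x)"
  unfolding hderiv_def by (rule DERIV_imp_deriv) (rule step_has_derivative)

lemma hdiff_at_Ck: "Ck (Suc 0) \<phi> \<Longrightarrow> hdiff_at gmul i \<phi> x"
  unfolding hdiff_at_def using step_has_derivative[OF Ck_Suc_has_derivative]
  by (metis real_differentiable_def)

lemma hdiff_at_quotient_tendsto:
  assumes "hdiff_at gmul i \<phi> x"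
  shows "((\<lambda>t. (\<phi> (gmul x (t *\<^sub>R axis i 1)) - \<phi> x) / t) \<longlongrightarrow> hderiv gmul i \<phi> x) (at 0)"
proof -
  have "((\<lambda>t. \<phi> (gmul x (t *\<^sub>R axis i 1))) has_real_derivative hderiv gmul i \<phi> x) (at 0)"
    using assms unfolding hdiff_at_def hderiv_def by (metis DERIV_deriv_iff_real_differentiable)
  then show ?thesis by (simp add: has_field_derivative_iff)
qed

lemma hderiv_Ck:
  assumes "Ck (Suc k) \<phi>" shows "Ck k (hderiv gmul i \<phi>)"
proof -
  note D = Ck_Suc_has_derivative[OF assms]
  have "hderiv gmul i \<phi> x = (\<Sum>b\<in>Basis. (Zvf gmul i x \<bullet> b) *\<^sub>R frechet_derivative \<phi> (at x) b)" for x
    unfolding hderiv_eq[OF D] by (rule linear_sum_Basis[OF has_derivative_bounded_linear[OF D]])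
  moreover have "Ck k (\<lambda>x. \<Sum>b\<in>Basis. (Zvf gmul i x \<bullet> b) *\<^sub>R frechet_derivative \<phi> (at x) b)"
    unfolding Zvf_eq_linv
    by (intro Ck_sum Ck_scaleR Ck_inner Ck_const Ck_linv Ck_Suc_directional[OF assms])
  ultimately show ?thesis by presburger
qed

lemma hderiv_zero:
  assumes "open S" "x \<in> S" "\<And>y. y \<in> S \<Longrightarrow> \<phi> y = 0"
  shows "hderiv gmul i \<phi> x = 0"
proof -
  have "(\<phi> has_derivative (\<lambda>_. 0)) (at x)"
    by (rule has_derivative_transform_within_open[OF has_derivative_const assms(1,2)]) (simp add: assms(3))
  from hderiv_eq[OF this] show ?thesis by simp
qed

lemma supported_hderiv: "supported R \<phi> \<Longrightarrow> supported R (hderiv gmul i \<phi>)"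
  unfolding supported_def[of R "hderiv gmul i \<phi>"]
proof (intro allI impI, rule ccontr)
  fix x assume s: "supported R \<phi>" and h: "hderiv gmul i \<phi> x \<noteq> 0" "\<not> norm x \<le> R"
  have "open (- cball (0::real^'n) R)" by (simp add: open_Compl)
  then have "hderiv gmul i \<phi> x = 0"
    by (rule hderiv_zero) (use h(2) supportedD[OF s] in \<open>auto simp: dist_norm\<close>)
  with h(1) show False by simp
qed

text \<open>Outside a ball both values vanish, and on it the group law followed by
  \<open>\<phi>\<close> is Lipschitz in both variables together.\<close>

lemma hlip_Ck:
  assumes C: "Ck (Suc 0) \<phi>" and s: "supported R \<phi>"
  obtains L where "L \<ge> 0" "\<And>i. hlip i L \<phi>"
proof -
  obtain S where S: "S \<ge> R" "\<And>y. norm y \<le> 1 \<Longrightarrow> supported S (\<lambda>x. \<phi> (gmul x y))"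
    using supported_right_translates[OF s] by blast
  have "Ck (Suc 0) (\<lambda>p. \<phi> (gmul (fst p) (snd p)))" by (rule Ck_compose[OF C Ck_gmul_pair])
  from Ck_Lipschitz_on_cball[OF this, of "\<bar>S\<bar> + 1"] obtain L where L: "L \<ge> 0"
    "\<And>p q :: (real^'n) \<times> (real^'n). norm p \<le> \<bar>S\<bar> + 1 \<Longrightarrow> norm q \<le> \<bar>S\<bar> + 1 \<Longrightarrow>
      norm (\<phi> (gmul (fst p) (snd p)) - \<phi> (gmul (fst q) (snd q))) \<le> L * norm (p - q)" by blast
  have "hlip i L \<phi>" for i
    unfolding hlip_def
  proof (intro allI impI)
    fix x and t :: real assume t: "\<bar>t\<bar> \<le> 1"
    let ?e = "t *\<^sub>R axis i 1 :: real^'n"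
    have e: "norm ?e = \<bar>t\<bar>" by simp
    show "\<bar>\<phi> (gmul x ?e) - \<phi> x\<bar> \<le> L * \<bar>t\<bar>"
    proof (cases "norm x \<le> S")
      case True
      have "norm (x, ?e) \<le> \<bar>S\<bar> + 1" "norm (x, 0 :: real^'n) \<le> \<bar>S\<bar> + 1"
        using norm_Pair_le[of x ?e] norm_Pair_le[of x "0 :: real^'n"] True t e norm_zero[where 'a="real^'n"] by linarith+
      from L(2)[OF this] have "\<bar>\<phi> (gmul x ?e) - \<phi> x\<bar> \<le> L * norm ((x, ?e) - (x, 0))" by simp
      also have "norm ((x, ?e) - (x, 0)) = \<bar>t\<bar>" by (simp add: norm_Pair)
      finally show ?thesis .
    next
      case False
      then have "\<phi> (gmul x ?e) = 0" "\<phi> x = 0"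
        using supportedD[OF S(2)[of ?e], of x] supportedD[OF s, of x] t e S(1) by simp_all
      then show ?thesis using L(1) by simp
    qed
  qed
  with L(1) show ?thesis by (rule that)
qed

text \<open>Moving the increment from \<open>a\<close> to \<open>\<phi>\<close> uses only that Lebesgue measure is invariant under right
  translations; no differentiability of \<open>a\<close> beyond the hypothesis is involved.\<close>

lemma integration_by_parts:
  assumes a: "continuous_on UNIV a" "hlip i C a" and \<phi>: "Ck (Suc 0) \<phi>" "supported R \<phi>"
    and diff: "AE x in lebesgue. \<phi> x \<noteq> 0 \<longrightarrow> hdiff_at gmul i a x"
  shows "integrable lebesgue (\<lambda>x. hderiv gmul i a x * \<phi> x)"
    and "integral\<^sup>L lebesgue (\<lambda>x. hderiv gmul i a x * \<phi> x) = - integral\<^sup>L lebesgue (\<lambda>x. a x * hderiv gmul i \<phi> x)"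
proof -
  define t where "t n = 1 / real (Suc n)" for n
  have t: "t n > 0" "\<bar>t n\<bar> \<le> 1" "t n \<noteq> 0" for n by (simp_all add: t_def)
  have t0: "filterlim t (at 0) sequentially"
    unfolding filterlim_at t_def using LIMSEQ_inverse_real_of_nat by (simp add: inverse_eq_divide)
  let ?s = "\<lambda>n x. gmul x (t n *\<^sub>R axis i 1)"
  have c\<phi>: "continuous_on UNIV \<phi>" by (rule Ck_imp_continuous_on[OF \<phi>(1)])
  have cs: "continuous_on UNIV (?s n)" for n
    by (intro continuous_on_gmul continuous_on_id continuous_on_const)
  have cas: "continuous_on UNIV (\<lambda>x. a (?s n x))" for n by (rule continuous_on_compose2[OF a(1) cs]) simp
  have c\<phi>s: "continuous_on UNIV (\<lambda>x. \<phi> (?s n x))" for n by (rule continuous_on_compose2[OF c\<phi> cs]) simp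
  obtain S where S: "S \<ge> R" "\<And>y. norm y \<le> 1 \<Longrightarrow> supported S (\<lambda>x. \<phi> (gmul x y))"
    using supported_right_translates[OF \<phi>(2)] by blast
  have sup: "supported S (\<lambda>x. \<phi> (?s n x))" "supported S \<phi>" for n
    using S(2)[of "t n *\<^sub>R axis i 1"] t supported_mono[OF \<phi>(2) S(1)] by simp_all
  obtain M where M: "M \<ge> 0" "\<And>x. \<bar>\<phi> x\<bar> \<le> M * indicator (cball 0 R) x" "\<And>x. \<bar>\<phi> x\<bar> \<le> M"
    by (rule continuous_supported_bounded[OF c\<phi> \<phi>(2)]) (rule that)
  obtain L where L': "L \<ge> 0" "\<And>i. hlip i L \<phi>" by (rule hlip_Ck[OF \<phi>]) (rule that)
  note L = L'(1) L'(2)[of i]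
  \<comment> \<open>\<open>?q\<close> puts the increment on \<open>a\<close> and \<open>?r\<close>
    puts it on \<open>\<phi>\<close>. They differ pointwise but have equal integrals, and their
    limits are the two sides of the formula.\<close>
  let ?q = "\<lambda>n x. (a (?s n x) - a x) / t n * \<phi> x"
  let ?r = "\<lambda>n x. a (?s n x) * ((\<phi> x - \<phi> (?s n x)) / t n)"
  have ql: "AE x in lebesgue. (\<lambda>n. ?q n x) \<longlonglongrightarrow> hderiv gmul i a x * \<phi> x"
    using diff
  proof eventually_elim
    case (elim x)
    show ?case
    proof (cases "\<phi> x = 0")
      case False
      from filterlim_compose[OF hdiff_at_quotient_tendsto t0] elim False
      have "(\<lambda>n. (a (?s n x) - a x) / t n) \<longlonglongrightarrow> hderiv gmul i a x" by blast
      then show ?thesis by (rule tendsto_mult_right)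
    qed simp
  qed
  have qm: "?q n \<in> borel_measurable lebesgue" for n
    using t by (intro continuous_lebesgue_measurable continuous_intros cas a(1) c\<phi>) auto
  have qb: "\<bar>?q n x\<bar> \<le> (C * M) * indicator (cball 0 R) x" for n x
  proof -
    have "\<bar>(a (?s n x) - a x) / t n\<bar> \<le> C"
      using hlipD[OF a(2) t(2)[of n], of x] t(1)[of n] by (simp add: pos_divide_le_eq)
    moreover from this have "C \<ge> 0" by linarith
    ultimately have "\<bar>?q n x\<bar> \<le> C * (M * indicator (cball 0 R) x)"
      unfolding abs_mult using M(2) by (intro mult_mono) auto
    then show ?thesis by (simp add: mult.assoc)
  qed
  have m: "(\<lambda>x. hderiv gmul i a x * \<phi> x) \<in> borel_measurable lebesgue"
    by (rule borel_measurable_lebesgue_AE_LIMSEQ[OF qm ql])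
  note dc = dominated_convergence_supported[OF m qm ql AE_I2[OF qb]]
  show "integrable lebesgue (\<lambda>x. hderiv gmul i a x * \<phi> x)" by (rule dc(1))
  have ch: "continuous_on UNIV (hderiv gmul i \<phi>)" by (rule Ck_imp_continuous_on[OF hderiv_Ck[OF \<phi>(1)]])
  have rl: "(\<lambda>n. ?r n x) \<longlonglongrightarrow> a x * - hderiv gmul i \<phi> x" for x
  proof (rule tendsto_mult)
    have "continuous_on UNIV (\<lambda>t::real. gmul x (t *\<^sub>R axis i 1))"
      by (intro continuous_on_gmul continuous_on_scaleR continuous_on_const continuous_on_id)
    then have "continuous_on UNIV (\<lambda>t::real. a (gmul x (t *\<^sub>R axis i 1)))"
      by (rule continuous_on_compose2[OF a(1)]) simp
    then have "isCont (\<lambda>t. a (gmul x (t *\<^sub>R axis i 1))) 0"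
      by (simp add: continuous_on_eq_continuous_at)
    then have "((\<lambda>t. a (gmul x (t *\<^sub>R axis i 1))) \<longlongrightarrow> a x) (at 0)" by (simp add: isCont_def)
    from filterlim_compose[OF this t0] show "(\<lambda>n. a (?s n x)) \<longlonglongrightarrow> a x" .
    from filterlim_compose[OF hdiff_at_quotient_tendsto[OF hdiff_at_Ck[OF \<phi>(1)]] t0]
    have "(\<lambda>n. - ((\<phi> (?s n x) - \<phi> x) / t n)) \<longlonglongrightarrow> - hderiv gmul i \<phi> x" by (rule tendsto_minus)
    then show "(\<lambda>n. (\<phi> x - \<phi> (?s n x)) / t n) \<longlonglongrightarrow> - hderiv gmul i \<phi> x"
      by (simp add: diff_divide_distrib)
  qed
  obtain B where B: "B \<ge> 0" "\<And>x y. norm x \<le> max S 1 \<Longrightarrow> norm y \<le> max S 1 \<Longrightarrow> norm (gmul x y) \<le> B"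
    using gmul_bounded by blast
  obtain A where A: "A \<ge> 0" "\<And>x. norm x \<le> B \<Longrightarrow> norm (a x) \<le> A"
    using continuous_bounded_on_cball[OF a(1)] by blast
  have rb: "\<bar>?r n x\<bar> \<le> (A * L) * indicator (cball 0 S) x" for n x
  proof (cases "norm x \<le> S")
    case True
    then have "norm (?s n x) \<le> B" using t(2)[of n] by (intro B(2)) auto
    then have "\<bar>a (?s n x)\<bar> \<le> A" using A(2) by simp
    moreover have "\<bar>(\<phi> x - \<phi> (?s n x)) / t n\<bar> \<le> L"
      using hlipD[OF L(2) t(2)[of n], of x] t(1)[of n] by (simp add: pos_divide_le_eq abs_minus_commute)
    ultimately have "\<bar>?r n x\<bar> \<le> A * L" unfolding abs_mult using A by (intro mult_mono) auto
    then show ?thesis using True by (simp add: dist_norm)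
  next
    case False
    then have "\<phi> x = 0" "\<phi> (?s n x) = 0" using supportedD[OF sup(1)] supportedD[OF sup(2)] by auto
    then show ?thesis using A(1) L(1) by simp
  qed
  have rm: "?r n \<in> borel_measurable lebesgue" for n
    using t by (intro continuous_lebesgue_measurable continuous_intros cas c\<phi> c\<phi>s) auto
  have m': "(\<lambda>x. a x * - hderiv gmul i \<phi> x) \<in> borel_measurable lebesgue"
    by (intro continuous_lebesgue_measurable continuous_intros a(1) ch)
  have lim2: "(\<lambda>n. integral\<^sup>L lebesgue (?r n)) \<longlonglongrightarrow> integral\<^sup>L lebesgue (\<lambda>x. a x * - hderiv gmul i \<phi> x)"
    by (rule dominated_convergence_supported(2)[OF m' rm AE_I2[OF rl] AE_I2[OF rb]])
  have "integral\<^sup>L lebesgue (?q n) = integral\<^sup>L lebesgue (?r n)" for n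
  proof -
    have sp: "supported S (\<lambda>x. f x * \<phi> x)" "supported S (\<lambda>x. f x * \<phi> (?s n x))" for f
      using sup(2) sup(1)[of n] unfolding supported_def by auto
    have i1: "integrable lebesgue (\<lambda>x. a (?s n x) * \<phi> x)"
      by (rule integrable_continuous_supported[OF continuous_on_mult[OF cas c\<phi>] sp(1)])
    have i2: "integrable lebesgue (\<lambda>x. a x * \<phi> x)"
      by (rule integrable_continuous_supported[OF continuous_on_mult[OF a(1) c\<phi>] sp(1)])
    have i3: "integrable lebesgue (\<lambda>x. a (?s n x) * \<phi> (?s n x))"
      by (rule integrable_continuous_supported[OF continuous_on_mult[OF cas c\<phi>s] sp(2)])
    have "integral\<^sup>L lebesgue (?q n) = integral\<^sup>L lebesgue (\<lambda>x. (a (?s n x) * \<phi> x - a x * \<phi> x) / t n)"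
      by (simp add: algebra_simps)
    also have "\<dots> = (integral\<^sup>L lebesgue (\<lambda>x. a (?s n x) * \<phi> x) - integral\<^sup>L lebesgue (\<lambda>x. a x * \<phi> x)) / t n"
      by (simp add: Bochner_Integration.integral_diff[OF i1 i2])
    \<comment> \<open>Translation invariance enters here: the product of \<open>a\<close> and
      \<open>\<phi>\<close> is shifted as a whole.\<close>
    also have "integral\<^sup>L lebesgue (\<lambda>x. a x * \<phi> x) = integral\<^sup>L lebesgue (\<lambda>x. a (?s n x) * \<phi> (?s n x))"
      by (rule integral_right_translate[symmetric, of "\<lambda>x. a x * \<phi> x"]) (intro continuous_intros a c\<phi>)
    also have "(integral\<^sup>L lebesgue (\<lambda>x. a (?s n x) * \<phi> x) - \<dots>) / t n =
        integral\<^sup>L lebesgue (\<lambda>x. (a (?s n x) * \<phi> x - a (?s n x) * \<phi> (?s n x)) / t n)"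
      by (simp add: Bochner_Integration.integral_diff[OF i1 i3])
    also have "\<dots> = integral\<^sup>L lebesgue (?r n)" by (simp add: algebra_simps)
    finally show ?thesis .
  qed
  with lim2 have "(\<lambda>n. integral\<^sup>L lebesgue (?q n)) \<longlonglongrightarrow> integral\<^sup>L lebesgue (\<lambda>x. a x * - hderiv gmul i \<phi> x)"
    by (simp only:)
  from LIMSEQ_unique[OF dc(2) this]
  show "integral\<^sup>L lebesgue (\<lambda>x. hderiv gmul i a x * \<phi> x) = - integral\<^sup>L lebesgue (\<lambda>x. a x * hderiv gmul i \<phi> x)"
    by simp
qed

end

section \<open>Mollification by left translations\<close>

lemma bump_supported: "r > 0 \<Longrightarrow> supported r (bump r)"
  unfolding supported_def using bump_eq_0 by (metis linear)

lemma continuous_on_bump: "continuous_on S (bump r)"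
  by (rule Ck_imp_continuous_on[OF Ck_bump])

lemma integrable_bump: "r > 0 \<Longrightarrow> integrable lebesgue (bump r)"
  by (rule integrable_continuous_supported[OF continuous_on_bump bump_supported])

lemma integral_bump_pos:
  assumes "r > 0" shows "integral\<^sup>L lebesgue (bump r :: 'a::euclidean_space \<Rightarrow> real) > 0"
proof (rule ccontr)
  let ?b = "bump r :: 'a \<Rightarrow> real"
  assume "\<not> integral\<^sup>L lebesgue ?b > 0"
  moreover have "integral\<^sup>L lebesgue ?b \<ge> 0" by (intro integral_nonneg_AE AE_I2 bump_nonneg)
  ultimately have "integral\<^sup>L lebesgue ?b = 0" by simp
  then have "AE x in lebesgue. ?b x = 0"
    using integral_nonneg_eq_0_iff_AE[OF integrable_bump[OF assms]] bump_nonneg by (metis AE_I2)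
  then have ae: "AE x in lebesgue. x \<in> {x. ?b x = 0}" by simp
  have cl: "closed {x. ?b x = 0}"
    by (intro closed_Collect_eq continuous_on_bump continuous_on_const)
  from mem_closed_if_AE_lebesgue[OF cl ae, of 0] bump_0_pos[OF assms, where 'a='a] show False by simp
qed

definition \<delta> :: "nat \<Rightarrow> real" where "\<delta> n = 1 / real (Suc n)"

lemma \<delta>: "\<delta> n > 0" "\<delta> n \<le> 1" "\<bar>\<delta> n\<bar> \<le> 1" "\<delta> n \<noteq> 0" "\<delta> \<longlonglongrightarrow> 0" "filterlim \<delta> (at 0) sequentially"
proof -
  show p: "\<delta> n > 0" "\<delta> n \<le> 1" "\<bar>\<delta> n\<bar> \<le> 1" "\<delta> n \<noteq> 0" for n by (simp_all add: \<delta>_def)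
  show l: "\<delta> \<longlonglongrightarrow> 0"
    unfolding \<delta>_def[abs_def] using LIMSEQ_inverse_real_of_nat by (simp add: inverse_eq_divide)
  show "filterlim \<delta> (at 0) sequentially" using l p(4) by (simp add: filterlim_at)
qed

context carnot
begin

definition moll :: "real \<Rightarrow> (real^'n \<Rightarrow> real) \<Rightarrow> real^'n \<Rightarrow> real" where
  "moll r h x = integral\<^sup>L lebesgue (\<lambda>z. bump r z * h (gmul z x)) / integral\<^sup>L lebesgue (bump r :: real^'n \<Rightarrow> real)"

lemma integrable_moll:
  assumes "r > 0" "continuous_on UNIV h"
  shows "integrable lebesgue (\<lambda>z. bump r z * h (gmul z x))"
proof (rule integrable_continuous_supported)
  have "continuous_on UNIV (\<lambda>z. h (gmul z x))"
    by (rule continuous_on_compose2[OF assms(2) continuous_on_gmul[OF continuous_on_id continuous_on_const]]) simp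
  then show "continuous_on UNIV (\<lambda>z. bump r z * h (gmul z x))"
    by (intro continuous_on_mult continuous_on_bump)
  show "supported r (\<lambda>z. bump r z * h (gmul z x))"
    using bump_supported[OF assms(1), where 'a="real^'n"] by (simp add: supported_def)
qed

text \<open>One estimate serves for bounds (\<open>c\<close> zero, \<open>e\<close> the bound), for
  supports (both zero) and for convergence (\<open>c\<close> the value at \<open>x\<close>,
  \<open>e\<close> small).\<close>

lemma moll_close:
  assumes r: "r > 0" and h: "continuous_on UNIV h" and c: "\<And>z. norm z < r \<Longrightarrow> \<bar>h (gmul z x) - c\<bar> \<le> e"
  shows "\<bar>moll r h x - c\<bar> \<le> e"
proof -
  let ?J = "integral\<^sup>L lebesgue (bump r :: real^'n \<Rightarrow> real)"
  have J: "?J > 0" by (rule integral_bump_pos[OF r])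
  have i: "integrable lebesgue (\<lambda>z :: real^'n. bump r z * k)" for k :: real
    using integrable_bump[OF r] by (rule integrable_mult_left)
  have i2: "integrable lebesgue (\<lambda>z. bump r z * (h (gmul z x) - c))"
    using Bochner_Integration.integrable_diff[OF integrable_moll[OF r h, of x] i[of c]] by (simp add: right_diff_distrib)
  have "integral\<^sup>L lebesgue (\<lambda>z. bump r z * (h (gmul z x) - c)) =
      integral\<^sup>L lebesgue (\<lambda>z. bump r z * h (gmul z x) - bump r z * c)"
    by (simp only: right_diff_distrib)
  also have "\<dots> = integral\<^sup>L lebesgue (\<lambda>z. bump r z * h (gmul z x)) - ?J * c"
    using Bochner_Integration.integral_diff[OF integrable_moll[OF r h, of x] i[of c]] by simp
  finally have eq: "moll r h x - c = integral\<^sup>L lebesgue (\<lambda>z. bump r z * (h (gmul z x) - c)) / ?J"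
    using J by (simp add: moll_def field_simps)
  have "\<bar>integral\<^sup>L lebesgue (\<lambda>z. bump r z * (h (gmul z x) - c))\<bar> \<le> integral\<^sup>L lebesgue (\<lambda>z :: real^'n. bump r z * e)"
  proof (rule integral_abs_bound[THEN order_trans], rule integral_mono[OF integrable_abs[OF i2] i])
    fix z :: "real^'n"
    show "\<bar>bump r z * (h (gmul z x) - c)\<bar> \<le> bump r z * e"
    proof (cases "norm z < r")
      case True
      then show ?thesis using c[OF True] bump_nonneg[of r z] by (simp add: abs_mult mult_left_mono)
    next
      case False
      then have "bump r z = 0" using bump_eq_0[OF r, of z] by simp
      then show ?thesis by simp
    qed
  qed
  also have "\<dots> = ?J * e" by simp
  finally show ?thesis unfolding eq using J by (simp add: abs_divide pos_divide_le_eq mult.commute)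
qed

lemma moll_bound: "r > 0 \<Longrightarrow> continuous_on UNIV h \<Longrightarrow> (\<And>x. \<bar>h x\<bar> \<le> B) \<Longrightarrow> \<bar>moll r h x\<bar> \<le> B"
  using moll_close[of r h x 0 B] by simp

lemma moll_eq_0: "r > 0 \<Longrightarrow> continuous_on UNIV h \<Longrightarrow> (\<And>z. norm z < r \<Longrightarrow> h (gmul z x) = 0) \<Longrightarrow> moll r h x = 0"
  using moll_close[of r h x 0 0] by simp

lemma moll_nonneg: "(\<And>x. h x \<ge> 0) \<Longrightarrow> moll r h x \<ge> 0"
  unfolding moll_def by (intro divide_nonneg_nonneg integral_nonneg_AE AE_I2 mult_nonneg_nonneg bump_nonneg)

lemma moll_diff:
  assumes "r > 0" "continuous_on UNIV f" "continuous_on UNIV g"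
  shows "moll r (\<lambda>x. (f x - g x) / c) x = (moll r f x - moll r g x) / c"
proof -
  have "integral\<^sup>L lebesgue (\<lambda>z. bump r z * ((f (gmul z x) - g (gmul z x)) / c)) =
     integral\<^sup>L lebesgue (\<lambda>z. (bump r z * f (gmul z x) - bump r z * g (gmul z x)) / c)"
    by (simp add: right_diff_distrib)
  also have "\<dots> = (integral\<^sup>L lebesgue (\<lambda>z. bump r z * f (gmul z x)) - integral\<^sup>L lebesgue (\<lambda>z. bump r z * g (gmul z x))) / c"
    by (simp only: integral_divide_zero Bochner_Integration.integral_diff[OF integrable_moll[OF assms(1,2)] integrable_moll[OF assms(1,3)]])
  finally show ?thesis by (simp add: moll_def diff_divide_distrib mult.commute)
qed

lemma moll_translate: "moll r h (gmul x y) = moll r (\<lambda>x. h (gmul x y)) x"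
  by (simp add: moll_def gmul_assoc)

lemma moll_supported:
  assumes "continuous_on UNIV h" "supported R h"
  obtains S where "S \<ge> R" "\<And>r. 0 < r \<Longrightarrow> r \<le> 1 \<Longrightarrow> supported S (moll r h)"
proof -
  obtain S where S: "S \<ge> R" "\<And>y. norm y \<le> 1 \<Longrightarrow> supported S (\<lambda>x. h (gmul y x))"
    by (rule supported_left_translates[OF assms(2)]) (rule that)
  have "supported S (moll r h)" if "0 < r" "r \<le> 1" for r
    unfolding supported_def
  proof (intro allI impI, rule ccontr)
    fix x assume x: "moll r h x \<noteq> 0" "\<not> norm x \<le> S"
    have "h (gmul z x) = 0" if "norm z < r" for z
      using supportedD[OF S(2), of z x] x(2) that \<open>r \<le> 1\<close> by simp
    with moll_eq_0[OF that(1) assms(1)] x(1) show False by blast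
  qed
  with S(1) show ?thesis by (rule that)
qed

lemma moll_Ck:
  assumes r: "r > 0" and h: "continuous_on UNIV h" and s: "supported R h"
  shows "Ck k (moll r h)"
proof -
  let ?J = "integral\<^sup>L lebesgue (bump r :: real^'n \<Rightarrow> real)"
  obtain a b where ab: "cball 0 R \<subseteq> cbox a (b :: real^'n)"
    using bounded_subset_cbox_symmetric[OF bounded_cball] by metis
  have eq: "moll r h x = integral (cbox a b) (\<lambda>y. h y * bump r (gmul y (ginv x))) / ?J" for x
  proof -
    let ?f = "\<lambda>y. h y * bump r (gmul y (ginv x))"
    let ?g = "\<lambda>z. bump r z * h (gmul z x)"
    have ch: "continuous_on UNIV (\<lambda>z. h (gmul z x))"
      by (rule continuous_on_compose2[OF h continuous_on_gmul[OF continuous_on_id continuous_on_const]]) simp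
    then have cg: "continuous_on UNIV ?g" by (intro continuous_on_mult continuous_on_bump)
    have cb: "continuous_on UNIV (\<lambda>y. bump r (gmul y (ginv x)))"
      by (rule continuous_on_compose2[OF continuous_on_bump[of UNIV] continuous_on_gmul[OF continuous_on_id continuous_on_const]]) simp
    have cf: "continuous_on UNIV ?f" by (intro continuous_on_mult h cb)
    have sf: "supported R ?f" using s by (simp add: supported_def)
    \<comment> \<open>Substituting z = y x^-1 moves \<open>x\<close> from the continuous
      \<open>h\<close> into the smooth bump.\<close>
    have "integral\<^sup>L lebesgue ?g = integral\<^sup>L lebesgue (\<lambda>y. ?g (gmul y (ginv x)))"
      by (rule integral_right_translate[OF cg, symmetric])
    also have "\<dots> = integral\<^sup>L lebesgue ?f" by (simp add: mult.commute)
    also have "\<dots> = integral UNIV ?f"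
      by (rule integral_lebesgue[symmetric, OF integrable_continuous_supported[OF cf sf]])
    also have "?f = (\<lambda>y. if y \<in> cbox a b then ?f y else 0)"
    proof
      fix y
      show "?f y = (if y \<in> cbox a b then ?f y else 0)"
        using ab supportedD[OF s, of y] by (cases "norm y \<le> R") (auto simp: subset_iff)
    qed
    also have "integral UNIV \<dots> = integral (cbox a b) ?f" by (rule integral_restrict_UNIV)
    finally show ?thesis by (simp add: moll_def)
  qed
  have "Ck k (\<lambda>p :: (real^'n) \<times> (real^'n). bump r (gmul (snd p) (ginv (fst p))))"
    by (intro Ck_compose[OF Ck_bump] Ck_gmul Ck_ginv Ck_fst Ck_snd Ck_ident)
  from Ck_integral_parameter[OF this continuous_on_subset[OF h subset_UNIV], of a b]
  have "Ck k (\<lambda>x. integral (cbox a b) (\<lambda>y. h y * bump r (gmul y (ginv x))))" by simp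
  from Ck_bounded_linear_compose[OF bounded_linear_divide this, of ?J] show ?thesis unfolding eq[abs_def] .
qed

text \<open>Exchange the two integrals and use that left translations preserve the measure. The
  extended nonnegative reals are used so that Tonelli's theorem applies directly.\<close>

lemma moll_L1_contraction:
  assumes r: "0 < r" "r \<le> 1" and w: "continuous_on UNIV w" and s: "supported R w"
  shows "integral\<^sup>L lebesgue (\<lambda>x. \<bar>moll r w x\<bar>) \<le> integral\<^sup>L lebesgue (\<lambda>x. \<bar>w x\<bar>)"
proof -
  let ?J = "integral\<^sup>L lebesgue (bump r :: real^'n \<Rightarrow> real)"
  have J: "?J > 0" by (rule integral_bump_pos[OF r(1)])
  obtain S where S: "S \<ge> R" "\<And>r. 0 < r \<Longrightarrow> r \<le> 1 \<Longrightarrow> supported S (moll r w)"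
    by (rule moll_supported[OF w s]) (rule that)
  have cm: "continuous_on UNIV (moll r w)" by (rule Ck_imp_continuous_on[OF moll_Ck[OF r(1) w s]])
  let ?k = "\<lambda>x z. ennreal (bump r z * \<bar>w (gmul z x)\<bar>)"
  have mw: "(\<lambda>x. ennreal \<bar>w x\<bar>) \<in> borel_measurable borel"
    by (intro measurable_compose[OF borel_measurable_continuous_onI[OF continuous_on_rabs[OF w]]]) simp
  have cwm: "continuous_on UNIV (\<lambda>z. \<bar>w (gmul z x)\<bar>)" for x
    by (rule continuous_on_rabs, rule continuous_on_compose2[OF w continuous_on_gmul[OF continuous_on_id continuous_on_const]]) simp
  have bound: "ennreal \<bar>moll r w x\<bar> \<le> (\<integral>\<^sup>+z. ?k x z \<partial>lborel) / ennreal ?J" for x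
  proof -
    have i: "integrable lebesgue (\<lambda>z. bump r z * \<bar>w (gmul z x)\<bar>)"
      by (rule integrable_moll[OF r(1), of "\<lambda>y. \<bar>w y\<bar>"]) (rule continuous_on_rabs[OF w])
    have "\<bar>integral\<^sup>L lebesgue (\<lambda>z. bump r z * w (gmul z x))\<bar> \<le> integral\<^sup>L lebesgue (\<lambda>z. \<bar>bump r z * w (gmul z x)\<bar>)"
      by (rule integral_abs_bound)
    also have "\<dots> = integral\<^sup>L lebesgue (\<lambda>z. bump r z * \<bar>w (gmul z x)\<bar>)"
      by (simp add: abs_mult bump_nonneg)
    finally have "\<bar>moll r w x\<bar> \<le> integral\<^sup>L lebesgue (\<lambda>z. bump r z * \<bar>w (gmul z x)\<bar>) / ?J"
      unfolding moll_def abs_divide using J by (simp add: divide_right_mono)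
    then have "ennreal \<bar>moll r w x\<bar> \<le> ennreal (integral\<^sup>L lebesgue (\<lambda>z. bump r z * \<bar>w (gmul z x)\<bar>) / ?J)"
      by (rule ennreal_leI)
    also have "\<dots> = ennreal (integral\<^sup>L lebesgue (\<lambda>z. bump r z * \<bar>w (gmul z x)\<bar>)) / ennreal ?J"
      using J by (intro divide_ennreal[symmetric] integral_nonneg_AE AE_I2 mult_nonneg_nonneg bump_nonneg) simp_all
    also have "ennreal (integral\<^sup>L lebesgue (\<lambda>z. bump r z * \<bar>w (gmul z x)\<bar>)) = (\<integral>\<^sup>+z. ?k x z \<partial>lebesgue)"
      by (rule nn_integral_eq_integral[symmetric, OF i]) (simp add: bump_nonneg)
    also have "\<dots> = (\<integral>\<^sup>+z. ?k x z \<partial>lborel)" by (rule nn_integral_completion)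
    finally show ?thesis .
  qed
  have cp: "continuous_on UNIV (\<lambda>p :: (real^'n) \<times> (real^'n). bump r (snd p) * \<bar>w (gmul (snd p) (fst p))\<bar>)"
    by (intro continuous_on_mult continuous_on_rabs continuous_on_compose2[OF continuous_on_bump[of UNIV] continuous_on_snd[OF continuous_on_id]]
        continuous_on_compose2[OF w] continuous_on_gmul continuous_on_snd continuous_on_fst continuous_on_id) simp_all
  have mk: "(\<lambda>(x, z). ?k x z) \<in> borel_measurable (lborel \<Otimes>\<^sub>M lborel)"
  proof -
    have eq: "sets (lborel \<Otimes>\<^sub>M lborel) = sets (borel :: ((real^'n) \<times> (real^'n)) measure)"
      unfolding borel_prod[symmetric] by (rule sets_pair_measure_cong) simp_all
    show ?thesis
      using measurable_compose[OF borel_measurable_continuous_onI[OF cp] measurable_ennreal]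
      by (simp add: split_beta' measurable_cong_sets[OF eq refl])
  qed
  have tr: "(\<integral>\<^sup>+x. ?k x z \<partial>lborel) = ennreal (bump r z) * (\<integral>\<^sup>+x. ennreal \<bar>w x\<bar> \<partial>lborel)" for z
  proof -
    have g: "(\<lambda>x. gmul z x) \<in> borel_measurable borel"
      by (intro borel_measurable_continuous_onI continuous_on_gmul continuous_on_id continuous_on_const)
    have "(\<integral>\<^sup>+x. ennreal \<bar>w x\<bar> \<partial>lborel) = (\<integral>\<^sup>+x. ennreal \<bar>w x\<bar> \<partial>distr lborel borel (\<lambda>x. gmul z x))"
      by (simp only: distr_left_translation)
    also have "\<dots> = (\<integral>\<^sup>+x. ennreal \<bar>w (gmul z x)\<bar> \<partial>lborel)"
      using g mw by (intro nn_integral_distr) simp_all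
    finally show ?thesis
      using measurable_compose[OF g mw] by (simp add: ennreal_mult bump_nonneg nn_integral_cmult)
  qed
  have nb: "(\<integral>\<^sup>+z. ennreal (bump r z) \<partial>(lborel :: (real^'n) measure)) = ennreal ?J"
    using nn_integral_eq_integral[OF integrable_bump[OF r(1)]] by (simp add: bump_nonneg nn_integral_completion)
  have mkx: "(\<lambda>x. \<integral>\<^sup>+z. ?k x z \<partial>lborel) \<in> borel_measurable lborel"
    using mk by (rule lborel.borel_measurable_nn_integral)
  have "(\<integral>\<^sup>+x. ennreal \<bar>moll r w x\<bar> \<partial>lborel) \<le> (\<integral>\<^sup>+x. (\<integral>\<^sup>+z. ?k x z \<partial>lborel) / ennreal ?J \<partial>lborel)"
    by (intro nn_integral_mono bound)
  also have "\<dots> = (\<integral>\<^sup>+x. (\<integral>\<^sup>+z. ?k x z \<partial>lborel) \<partial>lborel) / ennreal ?J"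
    by (rule nn_integral_divide[OF mkx])
  also have "(\<integral>\<^sup>+x. (\<integral>\<^sup>+z. ?k x z \<partial>lborel) \<partial>lborel) = (\<integral>\<^sup>+z. (\<integral>\<^sup>+x. ?k x z \<partial>lborel) \<partial>lborel)"
    by (rule lborel_pair.Fubini'[OF mk, symmetric])
  also have "\<dots> = ennreal ?J * (\<integral>\<^sup>+x. ennreal \<bar>w x\<bar> \<partial>lborel)"
  proof -
    have "(\<lambda>z :: real^'n. ennreal (bump r z)) \<in> borel_measurable lborel"
      using measurable_compose[OF borel_measurable_continuous_onI[OF continuous_on_bump] measurable_ennreal, of r]
      by simp
    then show ?thesis unfolding tr nb[symmetric] by (rule nn_integral_multc)
  qed
  also have "\<dots> / ennreal ?J = (\<integral>\<^sup>+x. ennreal \<bar>w x\<bar> \<partial>lborel)"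
    using J by (metis ennreal_eq_0_iff ennreal_mult_divide_eq ennreal_neq_top mult.commute not_le)
  finally have le: "(\<integral>\<^sup>+x. ennreal \<bar>moll r w x\<bar> \<partial>lebesgue) \<le> (\<integral>\<^sup>+x. ennreal \<bar>w x\<bar> \<partial>lebesgue)"
    by (simp add: nn_integral_completion)
  have i1: "integrable lebesgue (\<lambda>x. \<bar>moll r w x\<bar>)" and i2: "integrable lebesgue (\<lambda>x. \<bar>w x\<bar>)"
    using integrable_abs[OF integrable_continuous_supported[OF cm S(2)[OF r]]]
      integrable_abs[OF integrable_continuous_supported[OF w s]] by simp_all
  from le show ?thesis
    unfolding nn_integral_eq_integral[OF i1 AE_I2[OF abs_ge_zero]] nn_integral_eq_integral[OF i2 AE_I2[OF abs_ge_zero]]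
    by (subst (asm) ennreal_le_iff) (auto intro: integral_nonneg_AE)
qed

lemma moll_tendsto:
  assumes h: "continuous_on UNIV h" shows "(\<lambda>n. moll (\<delta> n) h x) \<longlonglongrightarrow> h x"
proof (rule LIMSEQ_I)
  fix e :: real assume e: "e > 0"
  have "continuous_on UNIV (\<lambda>z. h (gmul z x))"
    by (rule continuous_on_compose2[OF h continuous_on_gmul[OF continuous_on_id continuous_on_const]]) simp
  then have "\<exists>s>0. \<forall>z\<in>UNIV. dist z 0 < s \<longrightarrow> dist (h (gmul z x)) (h (gmul 0 x)) < e / 2"
    unfolding continuous_on_iff using e by (elim ballE[of _ _ 0] allE[of _ "e / 2"]) simp_all
  then obtain s where "s > 0" "\<forall>z\<in>UNIV. dist z 0 < s \<longrightarrow> dist (h (gmul z x)) (h (gmul 0 x)) < e / 2"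
    by (elim exE conjE)
  then have s: "s > 0" "\<And>z. norm z < s \<Longrightarrow> \<bar>h (gmul z x) - h x\<bar> < e / 2"
    by (simp_all add: dist_real_def)
  obtain N where N: "\<And>n. n \<ge> N \<Longrightarrow> \<bar>\<delta> n\<bar> < s"
    using LIMSEQ_D[OF \<delta>(5) s(1)] by auto
  show "\<exists>N. \<forall>n\<ge>N. norm (moll (\<delta> n) h x - h x) < e"
  proof (intro exI[of _ N] allI impI)
    fix n assume n: "n \<ge> N"
    have "\<bar>moll (\<delta> n) h x - h x\<bar> \<le> e / 2"
    proof (rule moll_close[OF \<delta>(1) h])
      fix z :: "real^'n" assume "norm z < \<delta> n"
      then have "norm z < s" using N[OF n] by simp
      from s(2)[OF this] show "\<bar>h (gmul z x) - h x\<bar> \<le> e / 2" by simp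
    qed
    then show "norm (moll (\<delta> n) h x - h x) < e" using e by simp
  qed
qed

section \<open>Difference quotients of averages and L1 convergence of derivatives\<close>

definition quot :: "'n \<Rightarrow> nat \<Rightarrow> (real^'n \<Rightarrow> real) \<Rightarrow> real^'n \<Rightarrow> real" where
  "quot i j h x = (h (gmul x (\<delta> j *\<^sub>R axis i 1)) - h x) / \<delta> j"

lemma continuous_on_right_translate:
  assumes "continuous_on UNIV h" shows "continuous_on UNIV (\<lambda>x. h (gmul x y))"
  by (rule continuous_on_compose2[OF assms continuous_on_gmul[OF continuous_on_id continuous_on_const]]) simp

lemma continuous_on_quot: "continuous_on UNIV h \<Longrightarrow> continuous_on UNIV (quot i j h)"
proof -
  assume h: "continuous_on UNIV h"
  show ?thesis unfolding quot_def[abs_def]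
    by (rule continuous_on_divide[OF continuous_on_diff[OF continuous_on_right_translate[OF h] h] continuous_on_const])
      (simp add: \<delta>(4))
qed

lemma quot_bound: "hlip i L h \<Longrightarrow> \<bar>quot i j h x\<bar> \<le> L"
  unfolding quot_def abs_divide using hlipD[of i L h "\<delta> j" x] \<delta>(1,3)[of j] by (simp add: pos_divide_le_eq)

lemma quot_supported:
  assumes "supported R h" obtains S where "S \<ge> R" "\<And>j. supported S (quot i j h)"
proof -
  obtain S where S: "S \<ge> R" "\<And>y. norm y \<le> 1 \<Longrightarrow> supported S (\<lambda>x. h (gmul x y))"
    by (rule supported_right_translates[OF assms]) (rule that)
  have "supported S (quot i j h)" for j
    unfolding supported_def
  proof (intro allI impI, rule ccontr)
    fix x assume x: "quot i j h x \<noteq> 0" "\<not> norm x \<le> S"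
    have "norm (\<delta> j *\<^sub>R axis i 1 :: real^'n) \<le> 1" using \<delta>(3) by simp
    from supportedD[OF S(2)[OF this]] x(2) have "h (gmul x (\<delta> j *\<^sub>R axis i 1)) = 0" by simp
    moreover have "h x = 0" using supportedD[OF assms] x(2) S(1) by simp
    ultimately show False using x(1) by (simp add: quot_def)
  qed
  with S(1) show ?thesis by (rule that)
qed

text \<open>An exact identity for finite increments, and therefore available although
  \<open>h\<close> is differentiable only almost everywhere in the applications.\<close>

lemma quot_moll: "r > 0 \<Longrightarrow> continuous_on UNIV h \<Longrightarrow> quot i j (moll r h) x = moll r (quot i j h) x"
  unfolding quot_def[abs_def] moll_translate
  by (rule moll_diff[symmetric]) (auto intro: continuous_on_right_translate)

lemma quot_tendsto: "hdiff_at gmul i h x \<Longrightarrow> (\<lambda>j. quot i j h x) \<longlonglongrightarrow> hderiv gmul i h x"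
  unfolding quot_def by (rule filterlim_compose[OF hdiff_at_quotient_tendsto \<delta>(6)])

lemma abs_supported_le:
  fixes u B :: real and x :: "real^'n"
  assumes "\<bar>u\<bar> \<le> B" "norm x > S \<Longrightarrow> u = 0" shows "\<bar>u\<bar> \<le> B * indicator (cball 0 S) x"
  using assms by (cases "norm x \<le> S") (auto simp: dist_norm)

text \<open>The derivative of \<open>h\<close> is approached through one difference quotient
  \<open>?q\<close>, fixed before \<open>n\<close>. Averages of the continuous \<open>?q\<close>
  converge to it, and the L1 contraction bounds the distance from the derivative of an average to
  the average of \<open>?q\<close>, uniformly in \<open>n\<close>.\<close>

lemma moll_hderiv_L1:
  assumes h: "continuous_on UNIV h" and s: "supported R h" and l: "hlip i L h"
    and diff: "AE x in lebesgue. hdiff_at gmul i h x"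
  shows "integrable lebesgue (hderiv gmul i h)"
    and "(\<lambda>n. integral\<^sup>L lebesgue (\<lambda>x. \<bar>hderiv gmul i (moll (\<delta> n) h) x - hderiv gmul i h x\<bar>)) \<longlonglongrightarrow> 0"
proof -
  let ?k = "hderiv gmul i h"
  let ?I = "integral\<^sup>L (lebesgue :: (real^'n) measure)"
  obtain S where S: "S \<ge> R" "\<And>j. supported S (quot i j h)" by (rule quot_supported[OF s]) (rule that)
  have cq: "continuous_on UNIV (quot i j h)" for j by (rule continuous_on_quot[OF h])
  have qm: "quot i j h \<in> borel_measurable lebesgue" for j by (rule continuous_lebesgue_measurable[OF cq])
  have qb: "\<bar>quot i j h x\<bar> \<le> L * indicator (cball 0 S) x" for j x
    by (rule abs_supported_le[OF quot_bound[OF l] supportedD[OF S(2)]])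
  have ql: "AE x in lebesgue. (\<lambda>j. quot i j h x) \<longlonglongrightarrow> ?k x"
    using diff by eventually_elim (rule quot_tendsto)
  have km: "?k \<in> borel_measurable lebesgue" by (rule borel_measurable_lebesgue_AE_LIMSEQ[OF qm ql])
  show ik: "integrable lebesgue ?k"
    by (rule dominated_convergence_supported(1)[OF km qm ql AE_I2[OF qb]])
  have kb: "AE x in lebesgue. \<bar>?k x\<bar> \<le> L * indicator (cball 0 S) x"
    using ql
  proof eventually_elim
    case (elim x)
    show ?case by (rule LIMSEQ_le_const2[OF tendsto_rabs[OF elim]]) (use qb in blast)
  qed
  have iq: "integrable lebesgue (quot i j h)" for j by (rule integrable_continuous_supported[OF cq S(2)])
  have L1q: "(\<lambda>j. ?I (\<lambda>x. \<bar>quot i j h x - ?k x\<bar>)) \<longlonglongrightarrow> ?I (\<lambda>x. 0)"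
  proof (rule dominated_convergence_supported(2))
    show "(\<lambda>x. \<bar>quot i j h x - ?k x\<bar>) \<in> borel_measurable lebesgue" for j
      by (intro borel_measurable_abs borel_measurable_diff qm km)
    show "AE x in lebesgue. (\<lambda>j. \<bar>quot i j h x - ?k x\<bar>) \<longlonglongrightarrow> 0"
      using ql by eventually_elim (rule tendsto_rabs_zero, rule LIM_zero)
    show "AE x in lebesgue. \<bar>\<bar>quot i j h x - ?k x\<bar>\<bar> \<le> (2 * L) * indicator (cball 0 S) x" for j
      using kb
    proof eventually_elim
      case (elim x)
      then show ?case using qb[of j x] by (simp add: algebra_simps)
    qed
  qed simp
  show "(\<lambda>n. ?I (\<lambda>x. \<bar>hderiv gmul i (moll (\<delta> n) h) x - ?k x\<bar>)) \<longlonglongrightarrow> 0"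
  proof (rule LIMSEQ_I)
    fix e :: real assume e: "e > 0"
    then have "e / 3 > 0" by simp
    from LIMSEQ_D[OF L1q this] obtain J where J0: "norm (?I (\<lambda>x. \<bar>quot i J h x - ?k x\<bar>) - ?I (\<lambda>x. 0)) < e / 3" by blast
    then have J: "?I (\<lambda>x. \<bar>quot i J h x - ?k x\<bar>) < e / 3" by simp
    let ?q = "quot i J h"
    obtain S2 where S2: "S2 \<ge> S" "\<And>r. 0 < r \<Longrightarrow> r \<le> 1 \<Longrightarrow> supported S2 (moll r ?q)"
      by (rule moll_supported[OF cq S(2)]) (rule that)
    have cm: "continuous_on UNIV (moll (\<delta> n) (quot i j h))" for n j
      by (rule Ck_imp_continuous_on[OF moll_Ck[OF \<delta>(1) cq S(2)]])
    have "(\<lambda>n. ?I (\<lambda>x. \<bar>moll (\<delta> n) ?q x - ?q x\<bar>)) \<longlonglongrightarrow> ?I (\<lambda>x. 0)"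
    proof (rule dominated_convergence_supported(2))
      show "(\<lambda>x. \<bar>moll (\<delta> n) ?q x - ?q x\<bar>) \<in> borel_measurable lebesgue" for n
        by (intro continuous_lebesgue_measurable continuous_on_rabs continuous_on_diff cm cq)
      show "AE x in lebesgue. (\<lambda>n. \<bar>moll (\<delta> n) ?q x - ?q x\<bar>) \<longlonglongrightarrow> 0"
        by (intro AE_I2 tendsto_rabs_zero LIM_zero moll_tendsto cq)
      show "AE x in lebesgue. \<bar>\<bar>moll (\<delta> n) ?q x - ?q x\<bar>\<bar> \<le> (2 * L) * indicator (cball 0 S2) x" for n
      proof (rule AE_I2)
        fix x
        have "\<bar>moll (\<delta> n) ?q x\<bar> \<le> L" by (rule moll_bound[OF \<delta>(1) cq quot_bound[OF l]])
        then show "\<bar>\<bar>moll (\<delta> n) ?q x - ?q x\<bar>\<bar> \<le> (2 * L) * indicator (cball 0 S2) x"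
          using quot_bound[OF l, of J x] supportedD[OF S2(2)[OF \<delta>(1,2)], of x n] supportedD[OF S(2), of x J] S2(1)
          by (intro abs_supported_le) auto
      qed
    qed simp
    from LIMSEQ_D[OF this \<open>e / 3 > 0\<close>] obtain N where
      N0: "\<forall>n\<ge>N. norm (?I (\<lambda>x. \<bar>moll (\<delta> n) ?q x - ?q x\<bar>) - ?I (\<lambda>x. 0)) < e / 3" by blast
    show "\<exists>N. \<forall>n\<ge>N. norm (?I (\<lambda>x. \<bar>hderiv gmul i (moll (\<delta> n) h) x - ?k x\<bar>) - 0) < e"
    proof (intro exI[of _ N] allI impI)
      fix n assume n: "n \<ge> N"
      have N: "?I (\<lambda>x. \<bar>moll (\<delta> n) ?q x - ?q x\<bar>) < e / 3" using N0 n by simp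
      let ?\<phi> = "moll (\<delta> n) h"
      have C\<phi>: "Ck (Suc 0) ?\<phi>" by (rule moll_Ck[OF \<delta>(1) h s])
      have cZ: "continuous_on UNIV (hderiv gmul i ?\<phi>)" by (rule Ck_imp_continuous_on[OF hderiv_Ck[OF C\<phi>]])
      obtain S3 where S3: "S3 \<ge> R" "\<And>r. 0 < r \<Longrightarrow> r \<le> 1 \<Longrightarrow> supported S3 (moll r h)"
        by (rule moll_supported[OF h s]) (rule that)
      obtain S4 where S4: "S4 \<ge> S3" "\<And>j. supported S4 (quot i j ?\<phi>)"
        by (rule quot_supported[OF S3(2)[OF \<delta>(1,2)]]) (rule that)
      have iZ: "integrable lebesgue (hderiv gmul i ?\<phi>)"
        by (rule integrable_continuous_supported[OF cZ supported_hderiv[OF S3(2)[OF \<delta>(1,2)]]])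
      have im: "integrable lebesgue (moll (\<delta> n) ?q)"
        by (rule integrable_continuous_supported[OF cm S2(2)[OF \<delta>(1,2)]])
      \<comment> \<open>For fixed \<open>n\<close> let \<open>j\<close> tend to infinity: the
        quotients of the smooth average converge to its derivative.\<close>
      have "(\<lambda>j. ?I (\<lambda>x. \<bar>quot i j ?\<phi> x - moll (\<delta> n) ?q x\<bar>)) \<longlonglongrightarrow> ?I (\<lambda>x. \<bar>hderiv gmul i ?\<phi> x - moll (\<delta> n) ?q x\<bar>)"
      proof (rule dominated_convergence_supported(2))
        show "(\<lambda>x. \<bar>hderiv gmul i ?\<phi> x - moll (\<delta> n) ?q x\<bar>) \<in> borel_measurable lebesgue"
          by (intro continuous_lebesgue_measurable continuous_on_rabs continuous_on_diff cm cZ)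
        show "(\<lambda>x. \<bar>quot i j ?\<phi> x - moll (\<delta> n) ?q x\<bar>) \<in> borel_measurable lebesgue" for j
          by (intro continuous_lebesgue_measurable continuous_on_rabs continuous_on_diff cm continuous_on_quot Ck_imp_continuous_on[OF C\<phi>])
        show "AE x in lebesgue. (\<lambda>j. \<bar>quot i j ?\<phi> x - moll (\<delta> n) ?q x\<bar>) \<longlonglongrightarrow> \<bar>hderiv gmul i ?\<phi> x - moll (\<delta> n) ?q x\<bar>"
          by (intro AE_I2 tendsto_rabs tendsto_diff tendsto_const quot_tendsto hdiff_at_Ck C\<phi>)
        show "AE x in lebesgue. \<bar>\<bar>quot i j ?\<phi> x - moll (\<delta> n) ?q x\<bar>\<bar> \<le> (2 * L) * indicator (cball 0 (max S2 S4)) x" for j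
        proof (rule AE_I2)
          fix x
          have "\<bar>moll (\<delta> n) (quot i j' h) x\<bar> \<le> L" for j' by (rule moll_bound[OF \<delta>(1) cq quot_bound[OF l]])
          from this[of J] this[of j]
          have "\<bar>quot i j ?\<phi> x - moll (\<delta> n) ?q x\<bar> \<le> 2 * L" unfolding quot_moll[OF \<delta>(1) h] by linarith
          then show "\<bar>\<bar>quot i j ?\<phi> x - moll (\<delta> n) ?q x\<bar>\<bar> \<le> (2 * L) * indicator (cball 0 (max S2 S4)) x"
            using supportedD[OF S2(2)[OF \<delta>(1,2)], of x n] supportedD[OF S4(2), of x j]
            by (intro abs_supported_le) simp_all
        qed
      qed
      moreover have "(\<lambda>j. ?I (\<lambda>x. \<bar>quot i j h x - ?k x\<bar>) + ?I (\<lambda>x. \<bar>?q x - ?k x\<bar>)) \<longlonglongrightarrow> ?I (\<lambda>x. 0) + ?I (\<lambda>x. \<bar>?q x - ?k x\<bar>)"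
        by (intro tendsto_add L1q tendsto_const)
      \<comment> \<open>The bound does not depend on \<open>n\<close>: both terms on the left are
        averages of quotients of \<open>h\<close>, and averaging contracts their distance.\<close>
      moreover have "?I (\<lambda>x. \<bar>quot i j ?\<phi> x - moll (\<delta> n) ?q x\<bar>) \<le> ?I (\<lambda>x. \<bar>quot i j h x - ?k x\<bar>) + ?I (\<lambda>x. \<bar>?q x - ?k x\<bar>)" for j
      proof -
        \<comment> \<open>The division by 1 matches the shape of \<open>moll_diff\<close>.\<close>
        have cd: "continuous_on UNIV (\<lambda>x. (quot i j h x - ?q x) / 1)" by (intro continuous_on_divide continuous_on_diff cq continuous_on_const) simp
        have sd: "supported S (\<lambda>x. (quot i j h x - ?q x) / 1)"
          unfolding supported_def
        proof (intro allI impI, rule ccontr)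
          fix x assume "(quot i j h x - ?q x) / 1 \<noteq> 0" "\<not> norm x \<le> S"
          then show False using supportedD[OF S(2), of x j] supportedD[OF S(2), of x J] by simp
        qed
        have "quot i j ?\<phi> x - moll (\<delta> n) ?q x = moll (\<delta> n) (\<lambda>x. (quot i j h x - ?q x) / 1) x" for x
          unfolding quot_moll[OF \<delta>(1) h] moll_diff[OF \<delta>(1) cq cq] by simp
        then have "?I (\<lambda>x. \<bar>quot i j ?\<phi> x - moll (\<delta> n) ?q x\<bar>) = ?I (\<lambda>x. \<bar>moll (\<delta> n) (\<lambda>x. (quot i j h x - ?q x) / 1) x\<bar>)"
          by (simp only:)
        also have "\<dots> \<le> ?I (\<lambda>x. \<bar>(quot i j h x - ?q x) / 1\<bar>)"
          by (rule moll_L1_contraction[OF \<delta>(1,2) cd sd])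
        also have "\<dots> \<le> ?I (\<lambda>x. \<bar>quot i j h x - ?k x\<bar> + \<bar>?q x - ?k x\<bar>)"
          by (intro integral_mono integrable_abs Bochner_Integration.integrable_add Bochner_Integration.integrable_diff integrable_divide iq ik) simp
        also have "\<dots> = ?I (\<lambda>x. \<bar>quot i j h x - ?k x\<bar>) + ?I (\<lambda>x. \<bar>?q x - ?k x\<bar>)"
          by (intro Bochner_Integration.integral_add integrable_abs Bochner_Integration.integrable_diff iq ik)
        finally show ?thesis .
      qed
      ultimately have "?I (\<lambda>x. \<bar>hderiv gmul i ?\<phi> x - moll (\<delta> n) ?q x\<bar>) \<le> ?I (\<lambda>x. 0) + ?I (\<lambda>x. \<bar>?q x - ?k x\<bar>)"
        by (intro LIMSEQ_le) auto
      then have A: "?I (\<lambda>x. \<bar>hderiv gmul i ?\<phi> x - moll (\<delta> n) ?q x\<bar>) < e / 3" using J by simp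
      have "?I (\<lambda>x. \<bar>hderiv gmul i ?\<phi> x - ?k x\<bar>) \<le>
          ?I (\<lambda>x. \<bar>hderiv gmul i ?\<phi> x - moll (\<delta> n) ?q x\<bar> + (\<bar>moll (\<delta> n) ?q x - ?q x\<bar> + \<bar>?q x - ?k x\<bar>))"
        by (intro integral_mono integrable_abs Bochner_Integration.integrable_add Bochner_Integration.integrable_diff iZ im iq ik) simp
      also have "\<dots> = ?I (\<lambda>x. \<bar>hderiv gmul i ?\<phi> x - moll (\<delta> n) ?q x\<bar>) + (?I (\<lambda>x. \<bar>moll (\<delta> n) ?q x - ?q x\<bar>) + ?I (\<lambda>x. \<bar>?q x - ?k x\<bar>))"
        by (simp only: Bochner_Integration.integral_add integrable_abs Bochner_Integration.integrable_add Bochner_Integration.integrable_diff iZ im iq ik)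
      also have "\<dots> < e" using A N J by simp
      finally show "norm (?I (\<lambda>x. \<bar>hderiv gmul i ?\<phi> x - ?k x\<bar>) - 0) < e"
        by (simp add: integral_nonneg_AE)
    qed
  qed
qed

end

section \<open>Testing the Laplacian bound with non-smooth functions\<close>

text \<open>\<open>W\<close> stands for U' continued to negative arguments, so that continuity is
  available on the whole line when it is composed with \<open>d\<close>.\<close>

locale carnot_laplacian = carnot gmul deg for gmul :: "real^'n::finite \<Rightarrow> real^'n \<Rightarrow> real^'n" and deg +
  fixes W :: "real \<Rightarrow> real" and K c0 :: real
  assumes W_cont: "continuous_on UNIV W" and W_nonneg: "W r \<ge> 0"
    and K_pos: "K > 0" and c0_pos: "c0 > 0"
    and grad_d: "AE x in lebesgue. dnorm gmul deg x \<ge> 1 \<longrightarrow>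
      (\<forall>i\<in>horiz deg. hdiff_at gmul i (dnorm gmul deg) x) \<and> hgrad_norm gmul deg (dnorm gmul deg) x \<le> 1"
    and lap_d: "test_fun \<phi> \<Longrightarrow> (\<And>x. \<phi> x \<ge> 0) \<Longrightarrow> closure {x. \<phi> x \<noteq> 0} \<subseteq> {x. dnorm gmul deg x > 1} \<Longrightarrow>
      integral\<^sup>L lebesgue (\<lambda>x. dnorm gmul deg x * sublap gmul deg \<phi> x) \<le>
      integral\<^sup>L lebesgue (\<lambda>x. (K + W (dnorm gmul deg x) * ((hgrad_norm gmul deg (dnorm gmul deg) x)\<^sup>2 - c0)) * \<phi> x)"
begin

lemma continuous_on_comp_d: "continuous_on UNIV G \<Longrightarrow> continuous_on UNIV (\<lambda>x. G (d x) :: real)"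
  by (rule continuous_on_compose2[OF _ continuous_on_d_UNIV]) auto

text \<open>Zero inside the unit ball, where \<open>hderiv\<close> of \<open>d\<close> is not
  controlled. In this way it is measurable and almost everywhere bounded on the whole space.\<close>

definition gd :: "'n \<Rightarrow> real^'n \<Rightarrow> real" where
  "gd i x = (if d x \<ge> 1 then hderiv gmul i d x else 0)"

definition gd2 :: "real^'n \<Rightarrow> real" where
  "gd2 x = (\<Sum>i\<in>horiz deg. (gd i x)\<^sup>2)"

lemma gd2_eq: "d x \<ge> 1 \<Longrightarrow> (hgrad_norm gmul deg d x)\<^sup>2 = gd2 x"
  unfolding hgrad_norm_def gd2_def gd_def by (simp add: sum_nonneg)

lemma gd2_nonneg: "gd2 x \<ge> 0"
  by (simp add: gd2_def sum_nonneg)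

lemma gd2_le_1: "AE x in lebesgue. gd2 x \<le> 1"
  using grad_d
proof eventually_elim
  case (elim x)
  show ?case
  proof (cases "d x \<ge> 1")
    case True
    then have "hgrad_norm gmul deg d x \<le> 1" using elim by simp
    moreover have "hgrad_norm gmul deg d x \<ge> 0" by (simp add: hgrad_norm_def sum_nonneg)
    ultimately show ?thesis unfolding gd2_eq[OF True, symmetric] by (simp add: power_le_one)
  qed (simp add: gd2_def gd_def)
qed

lemma gd_le_1: assumes "i \<in> horiz deg" shows "AE x in lebesgue. \<bar>gd i x\<bar> \<le> 1"
  using gd2_le_1
proof eventually_elim
  case (elim x)
  have "(gd i x)\<^sup>2 \<le> gd2 x" unfolding gd2_def using assms by (intro member_le_sum) simp_all
  with elim have "(gd i x)\<^sup>2 \<le> 1" by simp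
  then show ?case by (simp add: abs_square_le_1)
qed

lemma gd_measurable: assumes i: "i \<in> horiz deg" shows "gd i \<in> borel_measurable lebesgue"
proof (rule borel_measurable_lebesgue_AE_LIMSEQ)
  have S: "{x. d x \<ge> 1} \<in> sets lebesgue"
    by (rule sets_completionI_sets) (simp add: closed_Collect_le continuous_on_const continuous_on_d_UNIV borel_closed)
  then show "(\<lambda>x. indicator {x. d x \<ge> 1} x * quot i j d x) \<in> borel_measurable lebesgue" for j
    by (intro borel_measurable_times borel_measurable_indicator continuous_lebesgue_measurable continuous_on_quot continuous_on_d_UNIV)
  show "AE x in lebesgue. (\<lambda>j. indicator {x. d x \<ge> 1} x * quot i j d x) \<longlonglongrightarrow> gd i x"
    using grad_d
  proof eventually_elim
    case (elim x)
    show ?case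
    proof (cases "d x \<ge> 1")
      case True
      then have "hdiff_at gmul i d x" using elim i by simp
      from quot_tendsto[OF this] True show ?thesis by (simp add: gd_def)
    qed (simp add: gd_def)
  qed
qed

lemma gd2_measurable: "gd2 \<in> borel_measurable lebesgue"
  unfolding gd2_def[abs_def] by (intro borel_measurable_sum borel_measurable_power gd_measurable)

lemma integrable_bounded_mult:
  fixes u v :: "real^'n \<Rightarrow> real"
  assumes "u \<in> borel_measurable lebesgue" "AE x in lebesgue. \<bar>u x\<bar> \<le> 1" "integrable lebesgue v"
  shows "integrable lebesgue (\<lambda>x. u x * v x)"
proof (rule Bochner_Integration.integrable_bound[OF integrable_abs[OF assms(3)]])
  show "(\<lambda>x. u x * v x) \<in> borel_measurable lebesgue"
    by (rule borel_measurable_times[OF assms(1) borel_measurable_integrable[OF assms(3)]])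
  show "AE x in lebesgue. norm (u x * v x) \<le> norm \<bar>v x\<bar>"
    using assms(2) by eventually_elim (simp add: abs_mult mult_left_le_one_le)
qed

definition pot :: "real^'n \<Rightarrow> real" where
  "pot x = K + W (d x) * (gd2 x - c0)"

lemma pot_measurable: "pot \<in> borel_measurable lebesgue"
  unfolding pot_def[abs_def]
  by (intro borel_measurable_add borel_measurable_times borel_measurable_diff borel_measurable_const gd2_measurable
      continuous_lebesgue_measurable continuous_on_comp_d W_cont)

lemma pot_bounded:
  obtains M where "M \<ge> 0" "AE x in lebesgue. norm x \<le> S \<longrightarrow> \<bar>pot x\<bar> \<le> M"
proof -
  obtain B where B: "B \<ge> 0" "\<And>x. norm x \<le> S \<Longrightarrow> norm (W (d x)) \<le> B"
    by (rule continuous_bounded_on_cball[OF continuous_on_comp_d[OF W_cont]]) (rule that)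
  have ae: "AE x in lebesgue. norm x \<le> S \<longrightarrow> \<bar>pot x\<bar> \<le> K + B * (1 + c0)"
    using gd2_le_1
  proof eventually_elim
    case (elim x)
    show ?case
    proof
      assume "norm x \<le> S"
      then have "\<bar>W (d x)\<bar> \<le> B" using B(2) by simp
      moreover have "\<bar>gd2 x - c0\<bar> \<le> 1 + c0" using elim gd2_nonneg[of x] c0_pos by linarith
      ultimately have "\<bar>W (d x) * (gd2 x - c0)\<bar> \<le> B * (1 + c0)"
        unfolding abs_mult using B(1) by (intro mult_mono) simp_all
      then show "\<bar>pot x\<bar> \<le> K + B * (1 + c0)" unfolding pot_def using K_pos by linarith
    qed
  qed
  have "K + B * (1 + c0) \<ge> 0" using K_pos B(1) c0_pos by simp
  then show ?thesis using ae by (rule that)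
qed

text \<open>One integration by parts brings the weak Laplacian bound into first-order form, which
  makes sense for less regular functions. The margin 5/4 keeps the closure of the support in the
  region d > 1.\<close>

lemma smooth_inequality:
  assumes C: "\<And>k. Ck k \<phi>" and s: "supported R \<phi>" and nn: "\<And>x. \<phi> x \<ge> 0"
    and away: "\<And>x. \<phi> x \<noteq> 0 \<Longrightarrow> d x \<ge> 5 / 4"
  shows "- (\<Sum>i\<in>horiz deg. integral\<^sup>L lebesgue (\<lambda>x. gd i x * hderiv gmul i \<phi> x))
    \<le> integral\<^sup>L lebesgue (\<lambda>x. pot x * \<phi> x)"
proof -
  have "closure {x. \<phi> x \<noteq> 0} \<subseteq> cball 0 R"
    using s by (intro closure_minimal) (auto simp: supported_def dist_norm)
  then have "compact (closure {x. \<phi> x \<noteq> 0})"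
    by (metis closed_closure compact_Int_closed compact_cball inf.absorb_iff2)
  then have t: "test_fun \<phi>" using C by (simp add: test_fun_def smooth_def)
  have "closed {x. d x \<ge> 5 / 4}" by (intro closed_Collect_le continuous_on_const continuous_on_d_UNIV)
  then have "closure {x. \<phi> x \<noteq> 0} \<subseteq> {x. d x \<ge> 5 / 4}"
    using away by (intro closure_minimal) auto
  then have cl: "closure {x. \<phi> x \<noteq> 0} \<subseteq> {x. d x > 1}" by force
  have op: "open {x. d x < 5 / 4}" by (intro open_Collect_less continuous_on_const continuous_on_d_UNIV)
  have z: "hderiv gmul i \<phi> x = 0" if "d x < 5 / 4" for i x
    using away that by (intro hderiv_zero[OF op]) force+
  have parts: "integral\<^sup>L lebesgue (\<lambda>x. d x * hderiv gmul i (hderiv gmul i \<phi>) x) =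
      - integral\<^sup>L lebesgue (\<lambda>x. gd i x * hderiv gmul i \<phi> x)" if i: "i \<in> horiz deg" for i
  proof -
    obtain L where L: "L \<ge> 0" "hlip i L d" by (rule hlip_d[OF i]) (rule that)
    have ae: "AE x in lebesgue. hderiv gmul i \<phi> x \<noteq> 0 \<longrightarrow> hdiff_at gmul i d x"
      using grad_d
    proof eventually_elim
      case (elim x)
      show ?case using z[of x i] elim i by (cases "d x \<ge> 1") simp_all
    qed
    have "integral\<^sup>L lebesgue (\<lambda>x. hderiv gmul i d x * hderiv gmul i \<phi> x) =
       - integral\<^sup>L lebesgue (\<lambda>x. d x * hderiv gmul i (hderiv gmul i \<phi>) x)"
      by (rule integration_by_parts(2)[OF continuous_on_d_UNIV L(2) hderiv_Ck[OF C] supported_hderiv[OF s] ae])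
    moreover have "(\<lambda>x. hderiv gmul i d x * hderiv gmul i \<phi> x) = (\<lambda>x. gd i x * hderiv gmul i \<phi> x)"
      using z by (auto simp: gd_def)
    ultimately show ?thesis by simp
  qed
  have int: "integrable lebesgue (\<lambda>x. d x * hderiv gmul i (hderiv gmul i \<phi>) x)" for i
  proof (rule integrable_continuous_supported[where R=R])
    show "continuous_on UNIV (\<lambda>x. d x * hderiv gmul i (hderiv gmul i \<phi>) x)"
      by (rule continuous_on_mult[OF continuous_on_d_UNIV Ck_imp_continuous_on[OF hderiv_Ck[OF hderiv_Ck[OF C]]]])
    show "supported R (\<lambda>x. d x * hderiv gmul i (hderiv gmul i \<phi>) x)"
      using supported_hderiv[OF supported_hderiv[OF s], of i i] unfolding supported_def by auto
  qed
  have "integral\<^sup>L lebesgue (\<lambda>x. d x * sublap gmul deg \<phi> x) =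
      (\<Sum>i\<in>horiz deg. integral\<^sup>L lebesgue (\<lambda>x. d x * hderiv gmul i (hderiv gmul i \<phi>) x))"
    unfolding sublap_def sum_distrib_left by (rule Bochner_Integration.integral_sum[OF int])
  also have "\<dots> = - (\<Sum>i\<in>horiz deg. integral\<^sup>L lebesgue (\<lambda>x. gd i x * hderiv gmul i \<phi> x))"
    by (simp add: parts sum_negf)
  finally have "- (\<Sum>i\<in>horiz deg. integral\<^sup>L lebesgue (\<lambda>x. gd i x * hderiv gmul i \<phi> x)) \<le>
      integral\<^sup>L lebesgue (\<lambda>x. (K + W (d x) * ((hgrad_norm gmul deg d x)\<^sup>2 - c0)) * \<phi> x)"
    using lap_d[OF t nn cl] by simp
  also have "(\<lambda>x. (K + W (d x) * ((hgrad_norm gmul deg d x)\<^sup>2 - c0)) * \<phi> x) = (\<lambda>x. pot x * \<phi> x)"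
  proof
    fix x
    show "(K + W (d x) * ((hgrad_norm gmul deg d x)\<^sup>2 - c0)) * \<phi> x = pot x * \<phi> x"
    proof (cases "\<phi> x = 0")
      case False
      then have "d x \<ge> 1" using away[of x] by simp
      then show ?thesis by (simp only: gd2_eq pot_def)
    qed simp
  qed
  finally show ?thesis .
qed

text \<open>Averages of \<open>h\<close> are admissible in \<open>smooth_inequality\<close>. On the
  left, boundedness of \<open>gd\<close> turns L1 convergence of derivatives into convergence of the
  integrals; on the right, \<open>pot\<close> is bounded on a ball containing all supports.\<close>

lemma limit_inequality:
  assumes h: "continuous_on UNIV h" and s: "supported R h" and nn: "\<And>x. h x \<ge> 0"
    and lip: "\<And>i. i \<in> horiz deg \<Longrightarrow> \<exists>L. hlip i L h"
    and diff: "\<And>i. i \<in> horiz deg \<Longrightarrow> AE x in lebesgue. hdiff_at gmul i h x"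
    and away: "\<And>x. h x \<noteq> 0 \<Longrightarrow> d x \<ge> 3 / 2"
  shows "- (\<Sum>i\<in>horiz deg. integral\<^sup>L lebesgue (\<lambda>x. gd i x * hderiv gmul i h x))
    \<le> integral\<^sup>L lebesgue (\<lambda>x. pot x * h x)"
    and "i \<in> horiz deg \<Longrightarrow> integrable lebesgue (\<lambda>x. gd i x * hderiv gmul i h x)"
    and "integrable lebesgue (\<lambda>x. pot x * h x)"
proof -
  let ?I = "integral\<^sup>L (lebesgue :: (real^'n) measure)"
  let ?\<phi> = "\<lambda>n. moll (\<delta> n) h"
  obtain S where S: "S \<ge> R" "\<And>r. 0 < r \<Longrightarrow> r \<le> 1 \<Longrightarrow> supported S (moll r h)"
    by (rule moll_supported[OF h s]) (rule that)
  have C: "Ck k (?\<phi> n)" for k n by (rule moll_Ck[OF \<delta>(1) h s])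
  have iZ: "integrable lebesgue (hderiv gmul i (?\<phi> n))" for i n
    by (rule integrable_continuous_supported[OF Ck_imp_continuous_on[OF hderiv_Ck[OF C]] supported_hderiv[OF S(2)[OF \<delta>(1,2)]]])
  have ih: "integrable lebesgue (hderiv gmul i h)"
    and L1: "(\<lambda>n. ?I (\<lambda>x. \<bar>hderiv gmul i (?\<phi> n) x - hderiv gmul i h x\<bar>)) \<longlonglongrightarrow> 0" if i: "i \<in> horiz deg" for i
  proof -
    from lip[OF i] obtain L where L: "hlip i L h" by blast
    show "integrable lebesgue (hderiv gmul i h)" by (rule moll_hderiv_L1(1)[OF h s L diff[OF i]])
    show "(\<lambda>n. ?I (\<lambda>x. \<bar>hderiv gmul i (?\<phi> n) x - hderiv gmul i h x\<bar>)) \<longlonglongrightarrow> 0"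
      by (rule moll_hderiv_L1(2)[OF h s L diff[OF i]])
  qed
  note ig = integrable_bounded_mult[OF gd_measurable gd_le_1]
  show "integrable lebesgue (\<lambda>x. gd i x * hderiv gmul i h x)" if "i \<in> horiz deg" for i
    by (rule ig[OF that that ih[OF that]])
  have lim1: "(\<lambda>n. ?I (\<lambda>x. gd i x * hderiv gmul i (?\<phi> n) x)) \<longlonglongrightarrow> ?I (\<lambda>x. gd i x * hderiv gmul i h x)"
    if i: "i \<in> horiz deg" for i
  proof -
    have "norm (?I (\<lambda>x. gd i x * hderiv gmul i (?\<phi> n) x) - ?I (\<lambda>x. gd i x * hderiv gmul i h x))
      \<le> ?I (\<lambda>x. \<bar>hderiv gmul i (?\<phi> n) x - hderiv gmul i h x\<bar>)" for n
    proof -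
      have idf: "integrable lebesgue (\<lambda>x. hderiv gmul i (?\<phi> n) x - hderiv gmul i h x)"
        by (rule Bochner_Integration.integrable_diff[OF iZ ih[OF i]])
      have i1: "integrable lebesgue (\<lambda>x. gd i x * hderiv gmul i (?\<phi> n) x)" by (rule ig[OF i i iZ])
      have i2: "integrable lebesgue (\<lambda>x. gd i x * hderiv gmul i h x)" by (rule ig[OF i i ih[OF i]])
      have i3: "integrable lebesgue (\<lambda>x. gd i x * (hderiv gmul i (?\<phi> n) x - hderiv gmul i h x))" by (rule ig[OF i i idf])
      have eq: "?I (\<lambda>x. gd i x * hderiv gmul i (?\<phi> n) x) - ?I (\<lambda>x. gd i x * hderiv gmul i h x) =
          ?I (\<lambda>x. gd i x * (hderiv gmul i (?\<phi> n) x - hderiv gmul i h x))"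
        unfolding right_diff_distrib by (rule Bochner_Integration.integral_diff[OF i1 i2, symmetric])
      have "norm (?I (\<lambda>x. gd i x * hderiv gmul i (?\<phi> n) x) - ?I (\<lambda>x. gd i x * hderiv gmul i h x))
          \<le> ?I (\<lambda>x. \<bar>gd i x * (hderiv gmul i (?\<phi> n) x - hderiv gmul i h x)\<bar>)"
        unfolding eq real_norm_def by (rule integral_abs_bound)
      also have "\<dots> \<le> ?I (\<lambda>x. \<bar>hderiv gmul i (?\<phi> n) x - hderiv gmul i h x\<bar>)"
      proof (rule integral_mono_AE[OF integrable_abs[OF i3] integrable_abs[OF idf]])
        show "AE x in lebesgue. \<bar>gd i x * (hderiv gmul i (?\<phi> n) x - hderiv gmul i h x)\<bar> \<le> \<bar>hderiv gmul i (?\<phi> n) x - hderiv gmul i h x\<bar>"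
          using gd_le_1[OF i] by eventually_elim (simp add: abs_mult mult_left_le_one_le)
      qed
      finally show ?thesis .
    qed
    then have "\<forall>\<^sub>F n in sequentially. norm (?I (\<lambda>x. gd i x * hderiv gmul i (?\<phi> n) x) - ?I (\<lambda>x. gd i x * hderiv gmul i h x))
      \<le> ?I (\<lambda>x. \<bar>hderiv gmul i (?\<phi> n) x - hderiv gmul i h x\<bar>)"
      by (intro always_eventually allI)
    then have "(\<lambda>n. ?I (\<lambda>x. gd i x * hderiv gmul i (?\<phi> n) x) - ?I (\<lambda>x. gd i x * hderiv gmul i h x)) \<longlonglongrightarrow> 0"
      using L1[OF i] by (rule Lim_null_comparison)
    then show ?thesis by (simp only: LIM_zero_iff)
  qed
  obtain M where M: "M \<ge> 0" "AE x in lebesgue. norm x \<le> S \<longrightarrow> \<bar>pot x\<bar> \<le> M" by (rule pot_bounded) (rule that)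
  obtain B where B: "B \<ge> 0" "\<And>x. \<bar>h x\<bar> \<le> B * indicator (cball 0 R) x" "\<And>x. \<bar>h x\<bar> \<le> B"
    by (rule continuous_supported_bounded[OF h s]) (rule that)
  have pm: "(\<lambda>x. pot x * h x) \<in> borel_measurable lebesgue" "(\<lambda>x. pot x * ?\<phi> n x) \<in> borel_measurable lebesgue" for n
    by (rule borel_measurable_times[OF pot_measurable continuous_lebesgue_measurable[OF h]],
        rule borel_measurable_times[OF pot_measurable continuous_lebesgue_measurable[OF Ck_imp_continuous_on[OF C]]])
  have pl: "AE x in lebesgue. (\<lambda>n. pot x * ?\<phi> n x) \<longlonglongrightarrow> pot x * h x"
    by (intro AE_I2 tendsto_mult_left moll_tendsto h)
  have pb: "AE x in lebesgue. \<bar>pot x * ?\<phi> n x\<bar> \<le> (M * B) * indicator (cball 0 S) x" for n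
    using M(2)
  proof eventually_elim
    case (elim x)
    show ?case
    proof (cases "norm x \<le> S")
      case True
      have "\<bar>?\<phi> n x\<bar> \<le> B" by (rule moll_bound[OF \<delta>(1) h B(3)])
      then have "\<bar>pot x * ?\<phi> n x\<bar> \<le> M * B" unfolding abs_mult using elim True M(1) by (intro mult_mono) simp_all
      then show ?thesis using True by (simp add: dist_norm)
    next
      case False
      then have "?\<phi> n x = 0" using supportedD[OF S(2)[OF \<delta>(1,2)]] by simp
      then show ?thesis using M(1) B(1) by simp
    qed
  qed
  note dc = dominated_convergence_supported[where f="\<lambda>x. pot x * h x" and s="\<lambda>n x. pot x * ?\<phi> n x", OF pm(1) pm(2) pl pb]
  show "integrable lebesgue (\<lambda>x. pot x * h x)" by (rule dc(1))
  \<comment> \<open>Translating by z with d z < 1/4 lowers \<open>d\<close> on the support by less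
    than 1/4, that is from 3/2 to no less than 5/4.\<close>
  have "isCont d 0" using continuous_on_d_UNIV by (simp add: continuous_on_eq_continuous_at)
  then have "(d \<longlongrightarrow> d 0) (nhds 0)" by (simp only: isCont_def tendsto_at_iff_tendsto_nhds)
  then have "(d \<longlongrightarrow> 0) (nhds 0)" by (simp only: d_0)
  then have "\<forall>\<^sub>F z in nhds 0. d z < 1 / 4" by (rule order_tendstoD) simp
  then obtain \<epsilon> where \<epsilon>: "\<epsilon> > 0" "\<And>z. dist z 0 < \<epsilon> \<Longrightarrow> d z < 1 / 4"
    unfolding eventually_nhds_metric by blast
  have "\<forall>\<^sub>F n in sequentially. \<delta> n < \<epsilon>" using \<delta>(5) \<epsilon>(1) by (rule order_tendstoD)
  then have ev: "\<forall>\<^sub>F n in sequentially. - (\<Sum>i\<in>horiz deg. ?I (\<lambda>x. gd i x * hderiv gmul i (?\<phi> n) x)) \<le> ?I (\<lambda>x. pot x * ?\<phi> n x)"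
  proof eventually_elim
    case (elim n)
    show ?case
    proof (rule smooth_inequality[OF C S(2)[OF \<delta>(1,2)] moll_nonneg[OF nn]])
      fix x assume x: "?\<phi> n x \<noteq> 0"
      have "\<exists>z. norm z < \<delta> n \<and> h (gmul z x) \<noteq> 0"
      proof (rule ccontr)
        assume "\<not> ?thesis"
        then have "\<And>z. norm z < \<delta> n \<Longrightarrow> h (gmul z x) = 0" by blast
        from moll_eq_0[OF \<delta>(1) h this] x show False by simp
      qed
      then obtain z where z: "norm z < \<delta> n" "h (gmul z x) \<noteq> 0" by blast
      have "d z < 1 / 4" using z(1) elim by (intro \<epsilon>(2)) (simp add: dist_norm)
      then show "d x \<ge> 5 / 4" using away[OF z(2)] d_gmul[of z x] by linarith
    qed
  qed
  show "- (\<Sum>i\<in>horiz deg. ?I (\<lambda>x. gd i x * hderiv gmul i h x)) \<le> ?I (\<lambda>x. pot x * h x)"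
  proof (rule tendsto_le[OF trivial_limit_sequentially _ _ ev])
    show "(\<lambda>n. ?I (\<lambda>x. pot x * ?\<phi> n x)) \<longlonglongrightarrow> ?I (\<lambda>x. pot x * h x)" by (rule dc(2))
    show "(\<lambda>n. - (\<Sum>i\<in>horiz deg. ?I (\<lambda>x. gd i x * hderiv gmul i (?\<phi> n) x))) \<longlonglongrightarrow>
        - (\<Sum>i\<in>horiz deg. ?I (\<lambda>x. gd i x * hderiv gmul i h x))"
      by (intro tendsto_minus tendsto_sum lim1)
  qed
qed

section \<open>Testing with a radial weight times a C^1 function\<close>

lemma hgrad_norm_nonneg: "hgrad_norm gmul deg F x \<ge> 0"
  by (simp add: hgrad_norm_def sum_nonneg)

lemma continuous_on_hgrad_norm: "Ck (Suc 0) F \<Longrightarrow> continuous_on UNIV (hgrad_norm gmul deg F)"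
  unfolding hgrad_norm_def[abs_def]
  by (intro continuous_on_real_sqrt continuous_on_sum continuous_on_power Ck_imp_continuous_on[OF hderiv_Ck])

lemma supported_hgrad_norm: "supported R F \<Longrightarrow> supported R (hgrad_norm gmul deg F)"
proof -
  assume "supported R F"
  then have "hderiv gmul i F x = 0" if "norm x > R" for i x using supportedD[OF supported_hderiv that] by blast
  then show ?thesis unfolding supported_def hgrad_norm_def by (metis (mono_tags, lifting) not_le power_zero_numeral real_sqrt_zero sum.neutral)
qed

lemma gd_inner_le:
  assumes "gd2 x \<le> 1" shows "(\<Sum>i\<in>horiz deg. gd i x * hderiv gmul i F x) \<le> hgrad_norm gmul deg F x"
proof -
  have "(\<Sum>i\<in>horiz deg. gd i x * hderiv gmul i F x) \<le> (\<Sum>i\<in>horiz deg. \<bar>gd i x\<bar> * \<bar>hderiv gmul i F x\<bar>)"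
    by (intro sum_mono) (metis abs_ge_self abs_mult)
  also have "\<dots> \<le> L2_set (\<lambda>i. gd i x) (horiz deg) * L2_set (\<lambda>i. hderiv gmul i F x) (horiz deg)"
    by (rule L2_set_mult_ineq)
  also have "L2_set (\<lambda>i. gd i x) (horiz deg) = sqrt (gd2 x)" by (simp add: L2_set_def gd2_def)
  also have "L2_set (\<lambda>i. hderiv gmul i F x) (horiz deg) = hgrad_norm gmul deg F x" by (simp add: L2_set_def hgrad_norm_def)
  also have "sqrt (gd2 x) * hgrad_norm gmul deg F x \<le> hgrad_norm gmul deg F x"
    using assms gd2_nonneg hgrad_norm_nonneg by (intro mult_left_le_one_le) simp_all
  finally show ?thesis .
qed

text \<open>The squared gradient of \<open>d\<close> appears with the coefficient
  \<open>W r * G r + G' r\<close>, bounded above by \<open>B\<close>. As \<open>B\<close> is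
  nonnegative and \<open>gd2\<close> lies between 0 and 1, the gradient disappears from the
  result.\<close>

lemma weighted_inequality:
  fixes G G' B :: "real \<Rightarrow> real" and F :: "real^'n \<Rightarrow> real"
  assumes G: "\<And>r. (G has_real_derivative G' r) (at r)" and G': "continuous_on UNIV G'"
    and G0: "\<And>r. r \<le> 3 / 2 \<Longrightarrow> G r = 0" and Gnn: "\<And>r. G r \<ge> 0"
    and B: "continuous_on UNIV B" "\<And>r. B r \<ge> 0" "\<And>r. r \<ge> 1 \<Longrightarrow> W r * G r + G' r \<le> B r"
    and F: "Ck (Suc 0) F" "supported R F" "\<And>x. F x \<ge> 0"
  shows "0 \<le> integral\<^sup>L lebesgue (\<lambda>x. (K * G (d x) + B (d x) - c0 * (W (d x) * G (d x))) * F x + G (d x) * hgrad_norm gmul deg F x)"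
proof -
  define h where "h x = G (d x) * F x" for x
  have cG: "continuous_on UNIV G" using G by (intro continuous_at_imp_continuous_on ballI DERIV_isCont)
  have cF: "continuous_on UNIV F" by (rule Ck_imp_continuous_on[OF F(1)])
  have ch: "continuous_on UNIV h" unfolding h_def[abs_def] by (intro continuous_on_mult continuous_on_comp_d cG cF)
  have sh: "supported R h" using F(2) by (simp add: supported_def h_def)
  have lip: "\<exists>L. hlip i L h" if i: "i \<in> horiz deg" for i
  proof -
    obtain C where C: "C \<ge> 0" "hlip i C d" by (rule hlip_d[OF i]) (rule that)
    obtain L where L': "L \<ge> 0" "\<And>i. hlip i L F" by (rule hlip_Ck[OF F(1,2)]) (rule that)
    obtain S where S: "S \<ge> R" "\<And>y. norm y \<le> 1 \<Longrightarrow> supported S (\<lambda>x. F (gmul x y))"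
      by (rule supported_right_translates[OF F(2)]) (rule that)
    obtain T where T: "T \<ge> 0" "\<And>x y. norm x \<le> max S 1 \<Longrightarrow> norm y \<le> max S 1 \<Longrightarrow> norm (gmul x y) \<le> T"
      by (rule gmul_bounded) (rule that)
    \<comment> \<open>On the points concerned \<open>d\<close> is bounded by \<open>D\<close>, so
      \<open>G\<close> is evaluated on a bounded interval, where it is Lipschitz.\<close>
    obtain D where D: "D \<ge> 0" "\<And>x. norm x \<le> max S T \<Longrightarrow> norm (d x) \<le> D"
      by (rule continuous_bounded_on_cball[OF continuous_on_d_UNIV]) (rule that)
    have "Ck (Suc 0) G"
      using G[unfolded has_field_derivative_def] by (rule Ck_SucI) (simp add: G')
    then obtain LG where LG: "LG \<ge> 0" "\<And>r s. norm r \<le> D \<Longrightarrow> norm s \<le> D \<Longrightarrow> norm (G r - G s) \<le> LG * norm (r - s)"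
      by (rule Ck_Lipschitz_on_cball) (rule that)
    obtain BG where BG: "BG \<ge> 0" "\<And>r. norm r \<le> D \<Longrightarrow> norm (G r) \<le> BG"
      by (rule continuous_bounded_on_cball[OF cG]) (rule that)
    obtain BF where BF: "BF \<ge> 0" "\<And>x. \<bar>F x\<bar> \<le> BF * indicator (cball 0 R) x" "\<And>x. \<bar>F x\<bar> \<le> BF"
      by (rule continuous_supported_bounded[OF cF F(2)]) (rule that)
    let ?L = "LG * C * BF + BG * L"
    have "hlip i ?L h"
      unfolding hlip_def
    proof (intro allI impI)
      fix x and t :: real assume t: "\<bar>t\<bar> \<le> 1"
      let ?y = "gmul x (t *\<^sub>R axis i 1)"
      have nt: "norm (t *\<^sub>R axis i 1 :: real^'n) \<le> 1" using t by simp
      show "\<bar>h ?y - h x\<bar> \<le> ?L * \<bar>t\<bar>"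
      proof (cases "norm x \<le> S")
        case True
        then have "norm ?y \<le> T" using nt by (intro T(2)) simp_all
        then have dD: "norm (d ?y) \<le> D" "norm (d x) \<le> D" using True by (intro D(2); simp)+
        have "\<bar>G (d ?y) - G (d x)\<bar> \<le> LG * \<bar>d ?y - d x\<bar>" using LG(2)[OF dD] by simp
        also have "\<dots> \<le> LG * (C * \<bar>t\<bar>)" by (rule mult_left_mono[OF hlipD[OF C(2) t] LG(1)])
        finally have 1: "\<bar>G (d ?y) - G (d x)\<bar> * \<bar>F ?y\<bar> \<le> (LG * (C * \<bar>t\<bar>)) * BF"
          using LG(1) C(1) BF(3) by (intro mult_mono) simp_all
        have 2: "\<bar>G (d x)\<bar> * \<bar>F ?y - F x\<bar> \<le> BG * (L * \<bar>t\<bar>)"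
          using BG(2)[OF dD(2)] hlipD[OF L'(2) t] BG(1) by (intro mult_mono) simp_all
        have "h ?y - h x = (G (d ?y) - G (d x)) * F ?y + G (d x) * (F ?y - F x)"
          by (simp add: h_def algebra_simps)
        then have "\<bar>h ?y - h x\<bar> \<le> \<bar>G (d ?y) - G (d x)\<bar> * \<bar>F ?y\<bar> + \<bar>G (d x)\<bar> * \<bar>F ?y - F x\<bar>"
          by (metis abs_mult abs_triangle_ineq)
        also have "\<dots> \<le> ?L * \<bar>t\<bar>" using 1 2 by (simp add: algebra_simps)
        finally show ?thesis .
      next
        case False
        then have "F ?y = 0" "F x = 0" using supportedD[OF S(2)[OF nt], of x] supportedD[OF F(2), of x] S(1) by simp_all
        then show ?thesis using LG(1) C(1) BF(1) BG(1) L'(1) by (simp add: h_def)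
      qed
    qed
    then show ?thesis by blast
  qed
  have der: "AE x in lebesgue. hdiff_at gmul i h x \<and> hderiv gmul i h x = G' (d x) * gd i x * F x + G (d x) * hderiv gmul i F x"
    if i: "i \<in> horiz deg" for i
    using grad_d
  proof eventually_elim
    case (elim x)
    let ?y = "\<lambda>t. gmul x (t *\<^sub>R axis i 1)"
    have "((\<lambda>t. h (?y t)) has_real_derivative G' (d x) * gd i x * F x + G (d x) * hderiv gmul i F x) (at 0)"
    proof (cases "d x \<ge> 1")
      case True
      then have "hdiff_at gmul i d x" using elim i by simp
      then have dd: "((\<lambda>t. d (?y t)) has_real_derivative gd i x) (at 0)"
        using True unfolding gd_def hdiff_at_def hderiv_def by (simp add: DERIV_deriv_iff_real_differentiable)
      have "(G has_real_derivative G' (d x)) (at (d (?y 0)))" using G by simp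
      from DERIV_chain2[OF this dd] have 1: "((\<lambda>t. G (d (?y t))) has_real_derivative G' (d x) * gd i x) (at 0)" .
      have 2: "((\<lambda>t. F (?y t)) has_real_derivative hderiv gmul i F x) (at 0)"
        using hdiff_at_Ck[OF F(1), of i x] unfolding hdiff_at_def hderiv_def by (simp add: DERIV_deriv_iff_real_differentiable)
      from DERIV_mult[OF 1 2] show ?thesis by (simp add: h_def mult_ac)
    next
      case False
      have "continuous_on UNIV (\<lambda>t. d (?y t))"
        by (intro continuous_on_d continuous_on_gmul continuous_on_scaleR continuous_on_const continuous_on_id)
      \<comment> \<open>Here d x < 1, where nothing is known about derivatives of \<open>d\<close>;
        but \<open>G\<close> vanishes up to 3/2, so \<open>h\<close> is zero along the curve near
        0.\<close>
      then have op: "open {t. d (?y t) < 3 / 2}" by (intro open_Collect_less continuous_on_const)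
      have "((\<lambda>t. h (?y t)) has_real_derivative 0) (at 0)"
        by (rule has_field_derivative_transform_within_open[OF DERIV_const op]) (use False G0 in \<open>simp_all add: h_def\<close>)
      then show ?thesis using False G0[of "d x"] by (simp add: gd_def)
    qed
    then show ?case unfolding hdiff_at_def hderiv_def by (auto simp: DERIV_imp_deriv real_differentiable_def)
  qed
  have nn: "h x \<ge> 0" for x by (simp add: h_def Gnn F(3))
  have away: "d x \<ge> 3 / 2" if "h x \<noteq> 0" for x
    using that G0[of "d x"] by (cases "d x \<le> 3 / 2") (simp_all add: h_def)
  have dh: "AE x in lebesgue. hdiff_at gmul i h x" if "i \<in> horiz deg" for i
    using der[OF that] by eventually_elim simp
  note li = limit_inequality[OF ch sh nn lip dh away]
  let ?J = "\<lambda>x. pot x * h x + (\<Sum>i\<in>horiz deg. gd i x * hderiv gmul i h x)"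
  have iJ: "integrable lebesgue ?J"
    by (intro Bochner_Integration.integrable_add Bochner_Integration.integrable_sum li(2,3))
  have "0 \<le> integral\<^sup>L lebesgue (\<lambda>x. pot x * h x) + (\<Sum>i\<in>horiz deg. integral\<^sup>L lebesgue (\<lambda>x. gd i x * hderiv gmul i h x))"
    using li(1) by linarith
  also have "\<dots> = integral\<^sup>L lebesgue ?J"
    using li(2,3) by (simp add: Bochner_Integration.integral_add Bochner_Integration.integral_sum Bochner_Integration.integrable_sum)
  also have "\<dots> \<le> integral\<^sup>L lebesgue (\<lambda>x. (K * G (d x) + B (d x) - c0 * (W (d x) * G (d x))) * F x + G (d x) * hgrad_norm gmul deg F x)"
  proof (rule integral_mono_AE[OF iJ])
    show "integrable lebesgue (\<lambda>x. (K * G (d x) + B (d x) - c0 * (W (d x) * G (d x))) * F x + G (d x) * hgrad_norm gmul deg F x)"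
    proof (rule integrable_continuous_supported[where R=R])
      show "continuous_on UNIV (\<lambda>x. (K * G (d x) + B (d x) - c0 * (W (d x) * G (d x))) * F x + G (d x) * hgrad_norm gmul deg F x)"
        by (intro continuous_on_add continuous_on_mult continuous_on_diff continuous_on_const continuous_on_comp_d
            cG cF B(1) W_cont continuous_on_hgrad_norm F(1))
      show "supported R (\<lambda>x. (K * G (d x) + B (d x) - c0 * (W (d x) * G (d x))) * F x + G (d x) * hgrad_norm gmul deg F x)"
        unfolding supported_def
      proof (intro allI impI, rule ccontr)
        fix x assume "(K * G (d x) + B (d x) - c0 * (W (d x) * G (d x))) * F x + G (d x) * hgrad_norm gmul deg F x \<noteq> 0" "\<not> norm x \<le> R"
        then show False using supportedD[OF F(2), of x] supportedD[OF supported_hgrad_norm[OF F(2)], of x] by simp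
      qed
    qed
    have "AE x in lebesgue. \<forall>i\<in>horiz deg. hdiff_at gmul i h x \<and> hderiv gmul i h x = G' (d x) * gd i x * F x + G (d x) * hderiv gmul i F x"
      using der by (intro AE_finite_allI) simp_all
    then show "AE x in lebesgue. ?J x \<le> (K * G (d x) + B (d x) - c0 * (W (d x) * G (d x))) * F x + G (d x) * hgrad_norm gmul deg F x"
      using gd2_le_1
    proof eventually_elim
      case (elim x)
      have "(\<Sum>i\<in>horiz deg. gd i x * hderiv gmul i h x) =
          (\<Sum>i\<in>horiz deg. G' (d x) * F x * (gd i x)\<^sup>2 + G (d x) * (gd i x * hderiv gmul i F x))"
        using elim(1) by (intro sum.cong) (simp_all add: power2_eq_square algebra_simps)
      also have "\<dots> = G' (d x) * F x * gd2 x + G (d x) * (\<Sum>i\<in>horiz deg. gd i x * hderiv gmul i F x)"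
        by (simp add: sum.distrib sum_distrib_left gd2_def)
      finally have "?J x = (K * G (d x) - c0 * (W (d x) * G (d x))) * F x + ((W (d x) * G (d x) + G' (d x)) * gd2 x) * F x
          + G (d x) * (\<Sum>i\<in>horiz deg. gd i x * hderiv gmul i F x)"
        by (simp add: pot_def h_def algebra_simps)
      \<comment> \<open>Outside the unit ball \<open>gd2\<close> is at most 1; inside it is zero by
        the definition of \<open>gd\<close>.\<close>
      moreover have "(W (d x) * G (d x) + G' (d x)) * gd2 x \<le> B (d x)"
      proof (cases "d x \<ge> 1")
        case True
        have "(W (d x) * G (d x) + G' (d x)) * gd2 x \<le> B (d x) * gd2 x"
          by (rule mult_right_mono[OF B(3)[OF True] gd2_nonneg])
        also have "\<dots> \<le> B (d x)" using elim(2) B(2) by (simp add: mult_left_le)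
        finally show ?thesis .
      next
        case False
        then have "gd2 x = 0" by (simp add: gd2_def gd_def)
        then show ?thesis using B(2) by simp
      qed
      then have "((W (d x) * G (d x) + G' (d x)) * gd2 x) * F x \<le> B (d x) * F x"
        by (rule mult_right_mono[OF _ F(3)])
      moreover have "G (d x) * (\<Sum>i\<in>horiz deg. gd i x * hderiv gmul i F x) \<le> G (d x) * hgrad_norm gmul deg F x"
        by (rule mult_left_mono[OF gd_inner_le[OF elim(2)] Gnn])
      ultimately show ?case by (simp add: algebra_simps)
    qed
  qed
  finally show ?thesis .
qed

end

section \<open>Scalar auxiliary functions\<close>

text \<open>The forward averages of a decreasing function are C^1 with a derivative of known sign.
  They lie between 0 and the function itself, which provides the domination in the limit.\<close>

lemma steklov_average:
  fixes P :: "real \<Rightarrow> real"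
  assumes cont: "continuous_on UNIV P" and anti: "\<And>r s. r \<le> s \<Longrightarrow> P s \<le> P r" and nn: "\<And>r. P r \<ge> 0"
  obtains A A' :: "nat \<Rightarrow> real \<Rightarrow> real"
  where "\<And>n r. (A n has_real_derivative A' n r) (at r)" "\<And>n. continuous_on UNIV (A' n)" "\<And>n r. A' n r \<le> 0"
    "\<And>n r. 0 \<le> A n r" "\<And>n r. A n r \<le> P r" "\<And>r. (\<lambda>n. A n r) \<longlonglongrightarrow> P r"
proof -
  \<comment> \<open>An antiderivative on the whole line turns averages into difference quotients of
    \<open>Q\<close>.\<close>
  have "\<exists>F. \<forall>x :: real. - \<infinity> < ereal x \<longrightarrow> ereal x < \<infinity> \<longrightarrow> (F has_vector_derivative P x) (at x)"
    using cont by (intro einterval_antiderivative) (simp_all add: continuous_on_eq_continuous_at)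
  then obtain Q where Q: "\<And>r. (Q has_real_derivative P r) (at r)"
    by (auto simp: has_real_derivative_iff_has_vector_derivative)
  define A where "A n r = (Q (r + \<delta> n) - Q r) / \<delta> n" for n r
  define A' where "A' n r = (P (r + \<delta> n) - P r) / \<delta> n" for n r
  have shift: "((\<lambda>r. Q (r + \<delta> n)) has_real_derivative P (r + \<delta> n)) (at r)" for n r
    using DERIV_shift[of Q "P (r + \<delta> n)" r "\<delta> n"] Q by simp
  have 1: "(A n has_real_derivative A' n r) (at r)" for n r
    unfolding A_def[abs_def] A'_def by (intro DERIV_cdivide DERIV_diff shift Q)
  have 2: "continuous_on UNIV (A' n)" for n
  proof -
    have "continuous_on UNIV (\<lambda>r. P (r + \<delta> n))"
      by (rule continuous_on_compose2[OF cont continuous_on_add[OF continuous_on_id continuous_on_const]]) simp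
    then show ?thesis unfolding A'_def[abs_def] using \<delta>(4)[of n] by (intro continuous_on_divide continuous_on_diff cont continuous_on_const) simp_all
  qed
  have 3: "A' n r \<le> 0" for n r
    using anti[of r "r + \<delta> n"] \<delta>(1)[of n] unfolding A'_def by (simp add: divide_le_0_iff)
  have "\<exists>\<xi>\<ge>r. A n r = P \<xi>" for n r
  proof -
    have "r < r + \<delta> n" using \<delta>(1)[of n] by simp
    from MVT2[OF this, of Q P] Q obtain z where "z > r" "Q (r + \<delta> n) - Q r = (r + \<delta> n - r) * P z" by blast
    then show ?thesis using \<delta>(4)[of n] by (intro exI[of _ z]) (simp add: A_def)
  qed
  then have 4: "0 \<le> A n r" "A n r \<le> P r" for n r using anti nn by metis+
  have 5: "(\<lambda>n. A n r) \<longlonglongrightarrow> P r" for r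
  proof -
    have "((\<lambda>h. (Q (r + h) - Q r) / h) \<longlongrightarrow> P r) (at 0)" using Q[of r] by (simp add: DERIV_def)
    from filterlim_compose[OF this \<delta>(6)] show ?thesis by (simp add: A_def)
  qed
  from 1 2 3 4 5 show ?thesis by (rule that)
qed

section \<open>Powers, the cutoff and Young's inequality\<close>

lemma pos_powr_has_derivative:
  assumes "p > 0"
  shows "((\<lambda>s. max 0 s powr (p + 1)) has_real_derivative (p + 1) * max 0 s powr p) (at s)"
proof (cases s "0::real" rule: linorder_cases)
  case less
  have "((\<lambda>s. max 0 s powr (p + 1)) has_real_derivative 0) (at s)"
    by (rule has_field_derivative_transform_within_open[OF DERIV_const, of "{..<0}"]) (use less in auto)
  then show ?thesis using less by simp
next
  case greater
  have "((\<lambda>s. s powr (p + 1)) has_real_derivative (p + 1) * s powr (p + 1 - 1)) (at s)"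
    by (rule has_real_derivative_powr[OF greater])
  then have "((\<lambda>s. max 0 s powr (p + 1)) has_real_derivative (p + 1) * s powr (p + 1 - 1)) (at s)"
    by (rule has_field_derivative_transform_within_open[of _ _ _ "{0<..}"]) (use greater in auto)
  then show ?thesis using greater by simp
next
  case equal
  have "continuous_on UNIV (\<lambda>h::real. max 0 h powr p)"
    using assms by (intro continuous_on_powr' continuous_on_max continuous_on_const continuous_on_id) auto
  then have "((\<lambda>h. max 0 h powr p) \<longlongrightarrow> max 0 0 powr p) (at 0)"
    by (simp only: continuous_on_eq_continuous_at[OF open_UNIV] isCont_def UNIV_I ball_UNIV)
  \<comment> \<open>At the origin the difference quotient is \<open>max 0 h powr p\<close>, which
    tends to 0 because p > 0.\<close>
  moreover have "(max 0 h powr (p + 1) - max 0 0 powr (p + 1)) / (h - 0) = max 0 h powr p" for h :: real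
    by (cases "h > 0") (simp_all add: powr_add max_def)
  ultimately show ?thesis using equal by (simp add: has_field_derivative_iff)
qed

text \<open>The splitting into positive and negative parts avoids the sign function and makes the
  derivative visibly continuous.\<close>

lemma abs_powr_has_derivative:
  assumes "p > 0"
  shows "((\<lambda>s. \<bar>s\<bar> powr (p + 1)) has_real_derivative (p + 1) * (max 0 s powr p - max 0 (- s) powr p)) (at s)"
proof -
  have "((\<lambda>s. max 0 (- s) powr (p + 1)) has_real_derivative ((p + 1) * max 0 (- s) powr p) * (- 1)) (at s)"
    by (rule DERIV_chain2[OF pos_powr_has_derivative[OF assms] DERIV_minus[OF DERIV_ident]])
  from DERIV_add[OF pos_powr_has_derivative[OF assms, of s] this]
  have "((\<lambda>s. max 0 s powr (p + 1) + max 0 (- s) powr (p + 1)) has_real_derivative (p + 1) * (max 0 s powr p - max 0 (- s) powr p)) (at s)"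
    by (simp add: algebra_simps)
  moreover have "(\<lambda>s. max 0 s powr (p + 1) + max 0 (- s) powr (p + 1)) = (\<lambda>s. \<bar>s\<bar> powr (p + 1))"
    by (auto simp: max_def)
  ultimately show ?thesis by simp
qed

lemma Ck_abs_powr:
  assumes "p > 0" shows "Ck (Suc 0) (\<lambda>s::real. \<bar>s\<bar> powr (p + 1))"
proof (rule Ck_SucI[OF abs_powr_has_derivative[OF assms, unfolded has_field_derivative_def]])
  fix v :: real
  have "continuous_on UNIV (\<lambda>s. (p + 1) * (max 0 s powr p - max 0 (- s) powr p) * v)"
    using assms by (intro continuous_on_mult continuous_on_diff continuous_on_powr' continuous_on_max
        continuous_on_minus continuous_on_const continuous_on_id) auto
  then show "Ck 0 (\<lambda>s. (p + 1) * (max 0 s powr p - max 0 (- s) powr p) * v)" by simp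
qed

text \<open>A C^1 step function: 4 - 2 r is 1 at r = 3/2 and 0 at r = 2, so the value is 0 up to 3/2
  and 1 from 2 on. The two outer squares smooth the two corners.\<close>

definition cut :: "real \<Rightarrow> real" where
  "cut r = (max 0 (1 - (max 0 (4 - 2 * r))\<^sup>2))\<^sup>2"

text \<open>The derivative of \<open>cut\<close>; 8 is the product of the three factors 2 from the
  chain rule.\<close>

definition cut' :: "real \<Rightarrow> real" where
  "cut' r = 8 * max 0 (1 - (max 0 (4 - 2 * r))\<^sup>2) * max 0 (4 - 2 * r)"

lemma pos_square_has_derivative: "((\<lambda>s::real. (max 0 s)\<^sup>2) has_real_derivative 2 * max 0 s) (at s)"
  using pos_powr_has_derivative[of 1 s] by simp

lemma cut_has_derivative: "(cut has_real_derivative cut' r) (at r)"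
proof -
  have "((\<lambda>r. 4 - 2 * r) has_real_derivative - 2) (at r)"
    by (auto intro!: derivative_eq_intros)
  from DERIV_diff[OF DERIV_const[of 1] DERIV_chain2[OF pos_square_has_derivative this]]
  have "((\<lambda>r. 1 - (max 0 (4 - 2 * r))\<^sup>2) has_real_derivative 4 * max 0 (4 - 2 * r)) (at r)"
    by simp
  from DERIV_chain2[OF pos_square_has_derivative this] show ?thesis
    by (simp add: cut_def[abs_def] cut'_def mult_ac)
qed

lemma continuous_on_cut: "continuous_on UNIV cut" "continuous_on UNIV cut'"
  unfolding cut_def[abs_def] cut'_def[abs_def]
  by (intro continuous_on_power continuous_on_max continuous_on_diff continuous_on_mult continuous_on_const continuous_on_id)+

lemma cut_0: "r \<le> 3 / 2 \<Longrightarrow> cut r = 0 \<and> cut' r = 0"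
proof -
  assume "r \<le> 3 / 2"
  then have "max 0 (4 - 2 * r) \<ge> 1" by simp
  then have "(max 0 (4 - 2 * r))\<^sup>2 \<ge> 1" by (rule one_le_power)
  then have "max 0 (1 - (max 0 (4 - 2 * r))\<^sup>2) = 0" by simp
  then show ?thesis unfolding cut_def cut'_def by (simp only:) simp
qed

lemma cut_1: "r \<ge> 2 \<Longrightarrow> cut r = 1 \<and> cut' r = 0"
  by (simp add: cut_def cut'_def)

lemma cut_nonneg: "cut r \<ge> 0" "cut' r \<ge> 0"
  by (simp_all add: cut_def cut'_def)

lemma cut_le: "cut r \<le> 1" "cut' r \<le> 8"
proof -
  let ?a = "max 0 (4 - 2 * r)" and ?b = "max 0 (1 - (max 0 (4 - 2 * r))\<^sup>2)"
  have b: "0 \<le> ?b" "?b \<le> 1" by simp_all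
  show "cut r \<le> 1" unfolding cut_def using b by (intro power_le_one)
  show "cut' r \<le> 8"
  \<comment> \<open>Where \<open>?a\<close> exceeds 1 the factor \<open>?b\<close> vanishes, so the
    product never exceeds 1.\<close>
  proof (cases "?a \<le> 1")
    case True
    have "?b * ?a \<le> 1 * 1" using b True by (intro mult_mono) simp_all
    then show ?thesis unfolding cut'_def by linarith
  next
    case False
    then have "?a\<^sup>2 \<ge> 1" by (intro one_le_power) linarith
    then have "?b = 0" by simp
    then show ?thesis unfolding cut'_def by (simp only:)
  qed
qed

text \<open>Either \<open>b\<close> is at most \<open>e * a\<close> and the first term dominates, or
  \<open>a\<close> is at most \<open>b / e\<close> and the second does. The constant is not optimal,
  but explicit and free of the conjugate exponent.\<close>

lemma young_powr:
  fixes a b e p :: real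
  assumes "a \<ge> 0" "b \<ge> 0" "e > 0" "p > 0"
  shows "a powr p * b \<le> e * a powr (p + 1) + e powr (- p) * b powr (p + 1)"
proof -
  have s: "x powr p * x = x powr (p + 1)" if "x \<ge> 0" for x :: real
    using that by (cases "x = 0") (simp_all add: powr_add)
  show ?thesis
  proof (cases "b \<le> e * a")
    case True
    then have "a powr p * b \<le> a powr p * (e * a)" by (intro mult_left_mono) simp_all
    also have "\<dots> = e * a powr (p + 1)" using s[OF assms(1)] by (simp add: mult_ac)
    finally show ?thesis by (simp add: add_increasing2)
  next
    case False
    then have "a \<le> b / e" using assms(3) by (simp add: field_simps)
    then have "a powr p * b \<le> (b / e) powr p * b" using assms by (intro mult_right_mono powr_mono2) simp_all
    also have "\<dots> = e powr (- p) * b powr (p + 1)"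
      using assms s[OF assms(2)] by (simp add: powr_divide powr_minus divide_simps mult_ac)
    finally show ?thesis using assms by (simp add: add_increasing)
  qed
qed

section \<open>The inequality for \<open>|f|\<^sup>q\<close>\<close>

locale carnot_potential = carnot_laplacian gmul deg W K c0
  for gmul :: "real^'n::finite \<Rightarrow> real^'n \<Rightarrow> real^'n" and deg W K c0 +
  fixes U :: "real \<Rightarrow> real"
  assumes U_cont: "continuous_on UNIV U" and U_deriv: "\<And>r. r > 0 \<Longrightarrow> (U has_real_derivative W r) (at r)"
begin

text \<open>\<open>p\<close> is q - 1. By \<open>dec\<close>, from radius 1 on the power of
  \<open>W\<close> splits into a decreasing factor, which is averaged, and an exponential of rate
  \<open>p * \<beta>\<close>, whose derivative produces the term \<open>p * \<beta>\<close> next to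
  \<open>K\<close>.\<close>

lemma weight_limit_inequality:
  assumes p: "p > 0" and \<beta>: "\<beta> > 0"
    and dec: "\<And>r s. 1 \<le> r \<Longrightarrow> r \<le> s \<Longrightarrow> W s * exp (- \<beta> * s) \<le> W r * exp (- \<beta> * r)"
    and F: "Ck (Suc 0) F" "supported R F" "\<And>x. F x \<ge> 0"
  shows "0 \<le> integral\<^sup>L lebesgue (\<lambda>x. exp (- U (d x)) * (W (d x) powr p *
    (((K + p * \<beta>) * cut (d x) + cut' (d x) - c0 * (W (d x) * cut (d x))) * F x + cut (d x) * hgrad_norm gmul deg F x)))"
proof -
  \<comment> \<open>Frozen below 1, where \<open>dec\<close> gives no information; the cutoff
    vanishes there.\<close>
  define V where "V r = W (max 1 r) * exp (- \<beta> * max 1 r)" for r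
  define P where "P r = V r powr p" for r
  have Vnn: "V r \<ge> 0" for r unfolding V_def using W_nonneg by simp
  have cm: "continuous_on UNIV (\<lambda>r::real. max 1 r)" by (intro continuous_on_max continuous_on_const continuous_on_id)
  have "continuous_on UNIV V" unfolding V_def[abs_def]
    by (intro continuous_on_mult continuous_on_exp continuous_on_const cm) (rule continuous_on_compose2[OF W_cont cm], simp)
  then have cP: "continuous_on UNIV P" unfolding P_def[abs_def]
    using Vnn p by (intro continuous_on_powr' continuous_on_const) auto
  have aP: "P s \<le> P r" if "r \<le> s" for r s
    unfolding P_def
  proof (rule powr_mono2)
    show "V s \<le> V r" unfolding V_def using that by (intro dec) simp_all
  qed (use p Vnn in simp_all)
  have nP: "P r \<ge> 0" for r by (simp add: P_def)
  obtain A A' where A: "\<And>n r. (A n has_real_derivative A' n r) (at r)" "\<And>n. continuous_on UNIV (A' n)" "\<And>n r. A' n r \<le> 0"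
    "\<And>n r. 0 \<le> A n r" "\<And>n r. A n r \<le> P r" "\<And>r. (\<lambda>n. A n r) \<longlonglongrightarrow> P r"
    by (rule steklov_average[OF cP _ nP]) (erule aP, rule that)
  have cA: "continuous_on UNIV (A n)" for n using A(1) by (intro continuous_at_imp_continuous_on ballI DERIV_isCont)
  \<comment> \<open>The growing exponential undoes the decaying one in \<open>P\<close>, so from
    radius 1 on the product of \<open>P\<close> and \<open>E\<close> is
    \<open>W r powr p * exp (- U r)\<close>.\<close>
  define E where "E r = exp (p * \<beta> * r) * exp (- U r)" for r
  have Epos: "E r > 0" for r by (simp add: E_def)
  have cE: "continuous_on UNIV E" unfolding E_def[abs_def]
    by (intro continuous_on_mult continuous_on_exp continuous_on_minus continuous_on_const continuous_on_id U_cont)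
  define Y where "Y x = E (d x) * (((K + p * \<beta>) * cut (d x) + cut' (d x) - c0 * (W (d x) * cut (d x))) * F x + cut (d x) * hgrad_norm gmul deg F x)" for x
  have ch: "continuous_on UNIV (hgrad_norm gmul deg F)" by (rule continuous_on_hgrad_norm[OF F(1)])
  have cY: "continuous_on UNIV Y" unfolding Y_def[abs_def]
    by (intro continuous_on_add continuous_on_mult continuous_on_diff continuous_on_const continuous_on_comp_d
        cE continuous_on_cut W_cont Ck_imp_continuous_on[OF F(1)] ch)
  have sY: "supported R (\<lambda>x. u x * Y x)" for u
    unfolding supported_def
  proof (intro allI impI, rule ccontr)
    fix x assume "u x * Y x \<noteq> 0" "\<not> norm x \<le> R"
    then show False using supportedD[OF F(2), of x] supportedD[OF supported_hgrad_norm[OF F(2)], of x] by (simp add: Y_def)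
  qed
  have pos: "0 \<le> integral\<^sup>L lebesgue (\<lambda>x. A n (d x) * Y x)" for n
  proof -
    define G where "G r = cut r * (A n r * E r)" for r
    define G' where "G' r = (cut' r * A n r + cut r * (p * \<beta> * A n r + A' n r - A n r * W r)) * E r" for r
    define B where "B r = (cut' r + p * \<beta> * cut r) * A n r * E r" for r
    have "0 \<le> integral\<^sup>L lebesgue (\<lambda>x. (K * G (d x) + B (d x) - c0 * (W (d x) * G (d x))) * F x + G (d x) * hgrad_norm gmul deg F x)"
    proof (rule weighted_inequality[where G'=G' and R=R])
      show "(G has_real_derivative G' r) (at r)" for r
      proof (cases "r > 0")
        case True
        have "(E has_real_derivative (p * \<beta> - W r) * E r) (at r)"
          unfolding E_def[abs_def] using U_deriv[OF True] by (auto intro!: derivative_eq_intros simp: algebra_simps)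
        from DERIV_mult[OF cut_has_derivative DERIV_mult[OF A(1) this]]
        show ?thesis unfolding G_def[abs_def] G'_def by (rule DERIV_cong) (simp add: algebra_simps)
      next
        case False
        \<comment> \<open>\<open>U_deriv\<close> says nothing for r \<le> 0, but the cutoff makes
          \<open>G\<close> zero in a neighbourhood.\<close>
        have "(G has_real_derivative 0) (at r)"
          by (rule has_field_derivative_transform_within_open[OF DERIV_const, of "{..<1}"]) (use False cut_0 in \<open>auto simp: G_def\<close>)
        then show ?thesis using False cut_0[of r] by (simp add: G'_def)
      qed
      show "continuous_on UNIV G'" unfolding G'_def[abs_def]
        by (intro continuous_on_mult continuous_on_add continuous_on_diff continuous_on_const continuous_on_cut cA A(2) cE W_cont)
      show "continuous_on UNIV B" unfolding B_def[abs_def]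
        by (intro continuous_on_mult continuous_on_add continuous_on_const continuous_on_cut cA cE)
      show "G r = 0" if "r \<le> 3 / 2" for r using cut_0[OF that] by (simp add: G_def)
      show "G r \<ge> 0" for r unfolding G_def using cut_nonneg A(4) Epos[of r] by simp
      show "B r \<ge> 0" for r unfolding B_def using cut_nonneg A(4) Epos[of r] p \<beta> by simp
      show "W r * G r + G' r \<le> B r" for r
      proof -
        \<comment> \<open>The derivative of exp (- U) has cancelled \<open>W r * G r\<close>. The
          extra term has the sign of \<open>A'\<close>, so no size of \<open>A'\<close> enters and
          the later limit is unaffected by it.\<close>
        have "W r * G r + G' r = B r + cut r * A' n r * E r" by (simp add: G_def G'_def B_def algebra_simps)
        moreover have "cut r * A' n r * E r \<le> 0"
          using cut_nonneg(1)[of r] A(3)[of n r] Epos[of r] by (intro mult_nonpos_nonneg mult_nonneg_nonpos) simp_all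
        ultimately show ?thesis by linarith
      qed
    qed (rule F)+
    also have "(\<lambda>x. (K * G (d x) + B (d x) - c0 * (W (d x) * G (d x))) * F x + G (d x) * hgrad_norm gmul deg F x) = (\<lambda>x. A n (d x) * Y x)"
      by (rule ext) (simp add: G_def B_def Y_def algebra_simps)
    finally show ?thesis .
  qed
  have cAY: "continuous_on UNIV (\<lambda>x. A n (d x) * Y x)" for n by (intro continuous_on_mult continuous_on_comp_d cA cY)
  have cPY: "continuous_on UNIV (\<lambda>x. P (d x) * Y x)" by (intro continuous_on_mult continuous_on_comp_d cP cY)
  obtain M where M: "M \<ge> 0" "\<And>x. \<bar>P (d x) * Y x\<bar> \<le> M * indicator (cball 0 R) x" "\<And>x. \<bar>P (d x) * Y x\<bar> \<le> M"
    by (rule continuous_supported_bounded[OF cPY sY]) (rule that)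
  have "(\<lambda>n. integral\<^sup>L lebesgue (\<lambda>x. A n (d x) * Y x)) \<longlonglongrightarrow> integral\<^sup>L lebesgue (\<lambda>x. P (d x) * Y x)"
  proof (rule dominated_convergence_supported(2)[where B=M and R=R])
    show "(\<lambda>x. P (d x) * Y x) \<in> borel_measurable lebesgue" by (rule continuous_lebesgue_measurable[OF cPY])
    show "(\<lambda>x. A n (d x) * Y x) \<in> borel_measurable lebesgue" for n by (rule continuous_lebesgue_measurable[OF cAY])
    show "AE x in lebesgue. (\<lambda>n. A n (d x) * Y x) \<longlonglongrightarrow> P (d x) * Y x"
      by (intro AE_I2 tendsto_mult_right A(6))
    show "AE x in lebesgue. \<bar>A n (d x) * Y x\<bar> \<le> M * indicator (cball 0 R) x" for n
    proof (rule AE_I2)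
      fix x
      \<comment> \<open>Since the averages lie below \<open>P\<close>, the limit function itself
        dominates, and it is continuous with bounded support.\<close>
      have "\<bar>A n (d x) * Y x\<bar> \<le> \<bar>P (d x) * Y x\<bar>"
        unfolding abs_mult using A(4)[of n "d x"] A(5)[of n "d x"] by (intro mult_right_mono) simp_all
      then show "\<bar>A n (d x) * Y x\<bar> \<le> M * indicator (cball 0 R) x" using M(2)[of x] by linarith
    qed
  qed
  then have "0 \<le> integral\<^sup>L lebesgue (\<lambda>x. P (d x) * Y x)"
    by (rule LIMSEQ_le_const) (use pos in blast)
  also have "(\<lambda>x. P (d x) * Y x) = (\<lambda>x. exp (- U (d x)) * (W (d x) powr p *
    (((K + p * \<beta>) * cut (d x) + cut' (d x) - c0 * (W (d x) * cut (d x))) * F x + cut (d x) * hgrad_norm gmul deg F x)))"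
  proof
    fix x
    show "P (d x) * Y x = exp (- U (d x)) * (W (d x) powr p *
      (((K + p * \<beta>) * cut (d x) + cut' (d x) - c0 * (W (d x) * cut (d x))) * F x + cut (d x) * hgrad_norm gmul deg F x))"
    proof (cases "d x \<ge> 1")
      case True
      then have "P (d x) = W (d x) powr p * exp (- (p * \<beta> * d x))"
        by (simp add: P_def V_def powr_mult exp_powr_real mult_ac)
      then have PE: "W (d x) powr p = P (d x) * exp (p * \<beta> * d x)" by (simp add: mult.assoc flip: exp_add)
      show ?thesis unfolding Y_def E_def PE by (simp only: mult_ac)
    next
      case False
      then have "cut (d x) = 0" "cut' (d x) = 0" using cut_0[of "d x"] by simp_all
      then show ?thesis by (simp add: Y_def)
    qed
  qed
  finally show ?thesis .
qed

lemma hgrad_norm_abs_powr: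
  assumes p: "p > 0" and f: "Ck (Suc 0) f"
  shows "hgrad_norm gmul deg (\<lambda>x. \<bar>f x\<bar> powr (p + 1)) x = (p + 1) * \<bar>f x\<bar> powr p * hgrad_norm gmul deg f x"
proof -
  let ?c = "(p + 1) * (max 0 (f x) powr p - max 0 (- f x) powr p)"
  have "hderiv gmul i (\<lambda>x. \<bar>f x\<bar> powr (p + 1)) x = ?c * hderiv gmul i f x" for i
  proof -
    have 1: "((\<lambda>t. f (gmul x (t *\<^sub>R axis i 1))) has_real_derivative hderiv gmul i f x) (at 0)"
      using hdiff_at_Ck[OF f, of i x] unfolding hdiff_at_def hderiv_def by (simp add: DERIV_deriv_iff_real_differentiable)
    have "((\<lambda>s. \<bar>s\<bar> powr (p + 1)) has_real_derivative ?c) (at (f (gmul x (0 *\<^sub>R axis i 1))))"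
      using abs_powr_has_derivative[OF p, of "f x"] by simp
    from DERIV_chain2[OF this 1] show ?thesis unfolding hderiv_def by (rule DERIV_imp_deriv)
  qed
  then have "hgrad_norm gmul deg (\<lambda>x. \<bar>f x\<bar> powr (p + 1)) x = sqrt (?c\<^sup>2 * (\<Sum>i\<in>horiz deg. (hderiv gmul i f x)\<^sup>2))"
    by (simp add: hgrad_norm_def power_mult_distrib sum_distrib_left)
  also have "\<dots> = \<bar>?c\<bar> * hgrad_norm gmul deg f x" by (simp add: real_sqrt_mult hgrad_norm_def)
  \<comment> \<open>One of the two powers vanishes, since 0 powr p = 0.\<close>
  also have "\<bar>?c\<bar> = (p + 1) * \<bar>f x\<bar> powr p" using p by (cases "f x \<ge> 0") (simp_all add: abs_mult max_def)
  finally show ?thesis .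
qed

text \<open>The absorption at one point: \<open>u\<close>, \<open>v\<close>, \<open>g\<close> stand
  for \<open>W (d x)\<close>, |f| and |grad f|, while \<open>c\<close> and \<open>c'\<close> are the
  values of the cutoff and its derivative. With e = c0 / 4 the two applications of
  \<open>young_powr\<close> use up half of the good term \<open>c0 * (u * c)\<close>. The other half
  yields the c0 / 2 on the left, except where c \<noteq> 1, and there u \<le> M.\<close>

lemma pointwise_bound:
  fixes u v g c c' k M p :: real
  assumes "u \<ge> 0" "v \<ge> 0" "g \<ge> 0" "0 \<le> c" "c \<le> 1" "p > 0" "k \<ge> 0" "c' \<ge> 0"
    and c1: "c \<noteq> 1 \<Longrightarrow> u \<le> M" and c'M: "c' * u powr p \<le> 8 * M powr p"
  shows "u powr p * ((k * c + c' - c0 * (u * c)) * v powr (p + 1) + c * ((p + 1) * v powr p * g)) + c0 / 2 * (u powr (p + 1) * v powr (p + 1))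
    \<le> ((c0 / 4) powr (- p) * k powr (p + 1) + 8 * M powr p + c0 / 2 * M powr (p + 1)) * v powr (p + 1)
      + (c0 / 4) powr (- p) * (p + 1) powr (p + 1) * g powr (p + 1)"
proof -
  define e where "e = c0 / 4"
  have e: "e > 0" "c0 = 4 * e" using c0_pos by (simp_all add: e_def)
  let ?v = "v powr (p + 1)" and ?u = "u powr (p + 1)" and ?N = "e powr (- p)"
  have s: "x powr p * x = x powr (p + 1)" if "x \<ge> 0" for x :: real
    using that by (cases "x = 0") (simp_all add: powr_add)
  have y1: "u powr p * k \<le> e * ?u + ?N * k powr (p + 1)" by (rule young_powr) (use assms e in simp_all)
  have "(u * v) powr p * ((p + 1) * g) \<le> e * (u * v) powr (p + 1) + ?N * ((p + 1) * g) powr (p + 1)"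
    by (rule young_powr) (use assms e in simp_all)
  then have y2: "u powr p * v powr p * ((p + 1) * g) \<le> e * (?u * ?v) + ?N * ((p + 1) powr (p + 1) * g powr (p + 1))"
    by (simp only: powr_mult)
  have a1: "c * ?v * (u powr p * k) \<le> c * ?v * (e * ?u) + 1 * ?v * (?N * k powr (p + 1))"
  proof -
    have "c * ?v * (u powr p * k) \<le> c * ?v * (e * ?u + ?N * k powr (p + 1))"
      using y1 assms by (intro mult_left_mono) simp_all
    also have "\<dots> = c * ?v * (e * ?u) + c * ?v * (?N * k powr (p + 1))" by (rule distrib_left)
    also have "c * ?v * (?N * k powr (p + 1)) \<le> 1 * ?v * (?N * k powr (p + 1))"
      using assms by (intro mult_right_mono) simp_all
    finally show ?thesis by simp
  qed
  have a2: "c * (u powr p * v powr p * ((p + 1) * g)) \<le> c * (e * (?u * ?v)) + 1 * (?N * ((p + 1) powr (p + 1) * g powr (p + 1)))"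
  proof -
    have "c * (u powr p * v powr p * ((p + 1) * g)) \<le> c * (e * (?u * ?v) + ?N * ((p + 1) powr (p + 1) * g powr (p + 1)))"
      using y2 assms by (intro mult_left_mono) simp_all
    also have "\<dots> = c * (e * (?u * ?v)) + c * (?N * ((p + 1) powr (p + 1) * g powr (p + 1)))" by (rule distrib_left)
    also have "c * (?N * ((p + 1) powr (p + 1) * g powr (p + 1))) \<le> 1 * (?N * ((p + 1) powr (p + 1) * g powr (p + 1)))"
      using assms by (intro mult_right_mono) simp_all
    finally show ?thesis by simp
  qed
  have a3: "c' * u powr p * ?v \<le> 8 * M powr p * ?v" by (rule mult_right_mono[OF c'M]) simp
  have a4: "?u * ?v \<le> c * (?u * ?v) + M powr (p + 1) * ?v"
  proof (cases "c = 1")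
    case False
    have "?u \<le> M powr (p + 1)" using c1[OF False] assms by (intro powr_mono2) simp_all
    then have "?u * ?v \<le> M powr (p + 1) * ?v" by (rule mult_right_mono) simp
    then show ?thesis using assms by (simp add: add_increasing)
  qed simp
  have "u powr p * ((k * c + c' - c0 * (u * c)) * ?v + c * ((p + 1) * v powr p * g)) =
      c * ?v * (u powr p * k) + c' * u powr p * ?v - c0 * c * ((u powr p * u) * ?v) + c * (u powr p * v powr p * ((p + 1) * g))"
    by (simp add: algebra_simps)
  then have eq: "u powr p * ((k * c + c' - c0 * (u * c)) * ?v + c * ((p + 1) * v powr p * g)) =
      c * ?v * (u powr p * k) + c' * u powr p * ?v - 4 * e * (c * (?u * ?v)) + c * (u powr p * v powr p * ((p + 1) * g))"
    by (simp only: s[OF assms(1)] e(2) mult.assoc)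
  have b1: "c * ?v * (e * ?u) = e * (c * (?u * ?v))" "c * (e * (?u * ?v)) = e * (c * (?u * ?v))" by (simp_all add: mult_ac)
  have a4': "2 * e * (?u * ?v) \<le> 2 * e * (c * (?u * ?v)) + 2 * e * (M powr (p + 1) * ?v)"
    using mult_left_mono[OF a4, of "2 * e"] e(1) by (simp add: distrib_left)
  have r: "(e powr (- p) * k powr (p + 1) + 8 * M powr p + 2 * e * M powr (p + 1)) * ?v + e powr (- p) * (p + 1) powr (p + 1) * g powr (p + 1)
     = 1 * ?v * (?N * k powr (p + 1)) + 8 * M powr p * ?v + 2 * e * (M powr (p + 1) * ?v) + 1 * (?N * ((p + 1) powr (p + 1) * g powr (p + 1)))"
    by (simp add: algebra_simps)
  have h: "c0 / 4 = e" "c0 / 2 = 2 * e" using e by simp_all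
  show ?thesis unfolding h eq r using a1 a2 a3 a4' b1 by linarith
qed

lemma weighted_Lq_inequality:
  assumes p: "p > 0" and \<beta>: "\<beta> > 0"
    and dec: "\<And>r s. 1 \<le> r \<Longrightarrow> r \<le> s \<Longrightarrow> W s * exp (- \<beta> * s) \<le> W r * exp (- \<beta> * r)"
    and M: "M \<ge> 0" "\<And>r. 0 \<le> r \<Longrightarrow> r \<le> 2 \<Longrightarrow> W r \<le> M"
    and f: "Ck (Suc 0) f" "supported R f"
  shows "c0 / 2 * integral\<^sup>L lebesgue (\<lambda>x. exp (- U (d x)) * (W (d x) powr (p + 1) * \<bar>f x\<bar> powr (p + 1)))
    \<le> ((c0 / 4) powr (- p) * (K + p * \<beta>) powr (p + 1) + 8 * M powr p + c0 / 2 * M powr (p + 1))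
        * integral\<^sup>L lebesgue (\<lambda>x. exp (- U (d x)) * \<bar>f x\<bar> powr (p + 1))
      + (c0 / 4) powr (- p) * (p + 1) powr (p + 1)
        * integral\<^sup>L lebesgue (\<lambda>x. exp (- U (d x)) * hgrad_norm gmul deg f x powr (p + 1))"
proof -
  let ?I = "integral\<^sup>L (lebesgue :: (real^'n) measure)"
  let ?\<rho> = "\<lambda>x. exp (- U (d x))"
  define F where "F x = \<bar>f x\<bar> powr (p + 1)" for x
  define g where "g = hgrad_norm gmul deg f"
  define k where "k = K + p * \<beta>"
  define a where "a = (c0 / 4) powr (- p) * k powr (p + 1) + 8 * M powr p + c0 / 2 * M powr (p + 1)"
  define b where "b = (c0 / 4) powr (- p) * (p + 1) powr (p + 1)"
  have CF: "Ck (Suc 0) F" unfolding F_def[abs_def] by (rule Ck_compose[OF Ck_abs_powr[OF p] f(1)])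
  have sF: "supported R F" using f(2) by (simp add: supported_def F_def)
  have hF: "hgrad_norm gmul deg F x = (p + 1) * \<bar>f x\<bar> powr p * g x" for x
    unfolding F_def[abs_def] g_def by (rule hgrad_norm_abs_powr[OF p f(1)])
  define T where "T x = W (d x) powr p * ((k * cut (d x) + cut' (d x) - c0 * (W (d x) * cut (d x))) * F x + cut (d x) * hgrad_norm gmul deg F x)" for x
  have c\<rho>: "continuous_on UNIV ?\<rho>" by (intro continuous_on_exp continuous_on_minus continuous_on_comp_d U_cont)
  have cW: "continuous_on UNIV (\<lambda>x. W (d x))" by (rule continuous_on_comp_d[OF W_cont])
  have cWp: "continuous_on UNIV (\<lambda>x. W (d x) powr r)" if "r > 0" for r
    using that W_nonneg by (intro continuous_on_powr' cW continuous_on_const) auto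
  have cg: "continuous_on UNIV (\<lambda>x. g x powr (p + 1))"
    unfolding g_def using p hgrad_norm_nonneg by (intro continuous_on_powr' continuous_on_hgrad_norm f(1) continuous_on_const) auto
  have sg: "supported R g" unfolding g_def by (rule supported_hgrad_norm[OF f(2)])
  have cF: "continuous_on UNIV F" by (rule Ck_imp_continuous_on[OF CF])
  have i1: "integrable lebesgue (\<lambda>x. ?\<rho> x * (W (d x) powr (p + 1) * F x))"
  proof (rule integrable_continuous_supported[where R=R])
    show "continuous_on UNIV (\<lambda>x. ?\<rho> x * (W (d x) powr (p + 1) * F x))"
      using p by (intro continuous_on_mult c\<rho> cWp cF) simp
  qed (use sF in \<open>simp add: supported_def\<close>)
  have i2: "integrable lebesgue (\<lambda>x. ?\<rho> x * F x)"
    by (rule integrable_continuous_supported[where R=R, OF continuous_on_mult[OF c\<rho> cF]]) (use sF in \<open>simp add: supported_def\<close>)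
  have i3: "integrable lebesgue (\<lambda>x. ?\<rho> x * g x powr (p + 1))"
    by (rule integrable_continuous_supported[where R=R, OF continuous_on_mult[OF c\<rho> cg]]) (use sg in \<open>simp add: supported_def\<close>)
  have i4: "integrable lebesgue (\<lambda>x. ?\<rho> x * T x)"
  proof (rule integrable_continuous_supported[where R=R])
    show "continuous_on UNIV (\<lambda>x. ?\<rho> x * T x)"
      unfolding T_def[abs_def]
      by (intro continuous_on_mult continuous_on_add continuous_on_diff continuous_on_const continuous_on_comp_d
          c\<rho> cWp[OF p] cF W_cont continuous_on_cut continuous_on_hgrad_norm CF)
    show "supported R (\<lambda>x. ?\<rho> x * T x)"
      unfolding supported_def
    proof (intro allI impI, rule ccontr)
      fix x assume "?\<rho> x * T x \<noteq> 0" "\<not> norm x \<le> R"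
      then show False using supportedD[OF sF, of x] supportedD[OF supported_hgrad_norm[OF sF], of x] by (simp add: T_def)
    qed
  qed
  have pw: "T x + c0 / 2 * (W (d x) powr (p + 1) * F x) \<le> a * F x + b * g x powr (p + 1)" for x
    unfolding T_def hF F_def a_def b_def
  proof (rule pointwise_bound)
    \<comment> \<open>The cutoff differs from 1 only for d < 2, where \<open>M\<close> bounds
      \<open>W\<close>.\<close>
    show "W (d x) \<le> M" if "cut (d x) \<noteq> 1"
      using that cut_1[of "d x"] by (intro M(2) d_nonneg) (cases "d x \<ge> 2", simp_all)
    show "cut' (d x) * W (d x) powr p \<le> 8 * M powr p"
    proof (cases "d x \<ge> 2")
      case True
      then show ?thesis using cut_1[of "d x"] by simp
    next
      case False
      then have "W (d x) \<le> M" by (intro M(2) d_nonneg) simp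
      then have "W (d x) powr p \<le> M powr p" using W_nonneg p by (intro powr_mono2) simp_all
      then show ?thesis using cut_le(2) cut_nonneg(2) by (intro mult_mono) simp_all
    qed
    show "0 \<le> k" using K_pos p \<beta> by (simp add: k_def)
  qed (simp_all add: W_nonneg g_def hgrad_norm_nonneg cut_nonneg cut_le p)
  have "0 \<le> ?I (\<lambda>x. ?\<rho> x * T x)"
    using weight_limit_inequality[OF p \<beta> dec CF sF] by (simp add: T_def k_def F_def)
  then have "c0 / 2 * ?I (\<lambda>x. ?\<rho> x * (W (d x) powr (p + 1) * F x)) \<le>
      ?I (\<lambda>x. ?\<rho> x * T x) + ?I (\<lambda>x. c0 / 2 * (?\<rho> x * (W (d x) powr (p + 1) * F x)))"
    by simp
  also have "\<dots> = ?I (\<lambda>x. ?\<rho> x * T x + c0 / 2 * (?\<rho> x * (W (d x) powr (p + 1) * F x)))"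
    by (rule Bochner_Integration.integral_add[OF i4 integrable_mult_right[OF i1], symmetric])
  also have "\<dots> \<le> ?I (\<lambda>x. a * (?\<rho> x * F x) + b * (?\<rho> x * g x powr (p + 1)))"
  proof (rule integral_mono)
    show "integrable lebesgue (\<lambda>x. ?\<rho> x * T x + c0 / 2 * (?\<rho> x * (W (d x) powr (p + 1) * F x)))"
      by (rule Bochner_Integration.integrable_add[OF i4 integrable_mult_right[OF i1]])
    show "integrable lebesgue (\<lambda>x. a * (?\<rho> x * F x) + b * (?\<rho> x * g x powr (p + 1)))"
      by (rule Bochner_Integration.integrable_add[OF integrable_mult_right[OF i2] integrable_mult_right[OF i3]])
    fix x
    have "?\<rho> x * (T x + c0 / 2 * (W (d x) powr (p + 1) * F x)) \<le> ?\<rho> x * (a * F x + b * g x powr (p + 1))"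
      by (rule mult_left_mono[OF pw]) simp
    then show "?\<rho> x * T x + c0 / 2 * (?\<rho> x * (W (d x) powr (p + 1) * F x)) \<le> a * (?\<rho> x * F x) + b * (?\<rho> x * g x powr (p + 1))"
      by (simp only: distrib_left mult_ac)
  qed
  also have "\<dots> = a * ?I (\<lambda>x. ?\<rho> x * F x) + b * ?I (\<lambda>x. ?\<rho> x * g x powr (p + 1))"
    using Bochner_Integration.integral_add[OF integrable_mult_right[OF i2, of a] integrable_mult_right[OF i3, of b]] by simp
  finally show ?thesis unfolding F_def g_def a_def b_def k_def .
qed

end

section \<open>The coercive inequalities\<close>

lemma mono_on_has_derivative_nonneg:
  fixes U :: "real \<Rightarrow> real"
  assumes m: "mono_on {0..} U" and r: "r \<ge> 0" and D: "(U has_real_derivative D) (at r within {0..})"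
  shows "D \<ge> 0"
proof (rule tendsto_lowerbound)
  show "((\<lambda>y. (U y - U r) / (y - r)) \<longlongrightarrow> D) (at r within {0..})"
    using D by (simp add: has_field_derivative_iff)
  have "0 \<le> (U y - U r) / (y - r)" if "y \<in> {0..}" for y
  proof (cases "y \<ge> r")
    case True
    then have "U r \<le> U y" using m r by (intro mono_onD[OF m]) auto
    then show ?thesis using True by simp
  next
    case False
    then have "U y \<le> U r" using m r that by (intro mono_onD[OF m]) auto
    then show ?thesis using False by (simp add: divide_nonpos_neg)
  qed
  then show "\<forall>\<^sub>F y in at r within {0..}. 0 \<le> (U y - U r) / (y - r)"
    by (simp add: eventually_at_filter)
  have "at r within {r<..} \<le> at r within {0..}" using r by (intro at_le) auto
  then show "at r within {0..} \<noteq> bot" using trivial_limit_at_right_real[of r] by (metis bot.extremum_uniqueI)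
qed

lemma test_fun_Ck: "test_fun f \<Longrightarrow> Ck k f"
  by (simp add: test_fun_def smooth_Ck)

lemma test_fun_supported:
  assumes "test_fun f" obtains R where "supported R f"
proof -
  have "bounded (closure {x. f x \<noteq> 0})" using assms by (simp add: test_fun_def compact_imp_bounded)
  then obtain R where R: "\<forall>x\<in>closure {x. f x \<noteq> 0}. norm x \<le> R" unfolding bounded_iff by (elim exE)
  have "supported R f"
    unfolding supported_def
  proof (intro allI impI)
    fix x assume "f x \<noteq> 0"
    then have "x \<in> closure {x. f x \<noteq> 0}" using closure_subset[of "{x. f x \<noteq> 0}"] by blast
    then show "norm x \<le> R" using R by blast
  qed
  then show ?thesis by (rule that)
qed

text \<open>Reduces the extended integrals of the theorem to real ones. For Z = 0 both sides vanish,
  by x / 0 = 0.\<close>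

lemma nn_integral_density_eq:
  fixes \<rho> g :: "'a::euclidean_space \<Rightarrow> real"
  assumes \<rho>: "continuous_on UNIV \<rho>" "\<And>x. \<rho> x \<ge> 0" and Z: "Z \<ge> 0"
    and g: "continuous_on UNIV g" "\<And>x. g x \<ge> 0" "supported R g"
  shows "(\<integral>\<^sup>+x. ennreal (g x) \<partial>density lebesgue (\<lambda>x. ennreal (\<rho> x / Z))) =
    ennreal (integral\<^sup>L lebesgue (\<lambda>x. \<rho> x * g x) / Z)"
proof -
  have m: "(\<lambda>x. ennreal (\<rho> x / Z)) \<in> borel_measurable lebesgue" "(\<lambda>x. ennreal (g x)) \<in> borel_measurable lebesgue"
    using measurable_compose[OF borel_measurable_divide[OF continuous_lebesgue_measurable[OF \<rho>(1)] borel_measurable_const[of Z]] measurable_ennreal]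
      measurable_compose[OF continuous_lebesgue_measurable[OF g(1)] measurable_ennreal] by simp_all
  have i: "integrable lebesgue (\<lambda>x. \<rho> x * g x)"
    by (rule integrable_continuous_supported[where R=R, OF continuous_on_mult[OF \<rho>(1) g(1)]])
      (use g(3) in \<open>simp add: supported_def\<close>)
  have "(\<integral>\<^sup>+x. ennreal (g x) \<partial>density lebesgue (\<lambda>x. ennreal (\<rho> x / Z))) =
      (\<integral>\<^sup>+x. ennreal (\<rho> x / Z) * ennreal (g x) \<partial>lebesgue)"
    by (rule nn_integral_density[OF m])
  also have "\<dots> = (\<integral>\<^sup>+x. ennreal (\<rho> x * g x / Z) \<partial>lebesgue)"
    using \<rho>(2) g(2) Z by (intro nn_integral_cong) (simp flip: ennreal_mult)
  also have "\<dots> = ennreal (integral\<^sup>L lebesgue (\<lambda>x. \<rho> x * g x / Z))"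
    using \<rho>(2) g(2) Z i by (intro nn_integral_eq_integral integrable_divide) simp_all
  finally show ?thesis by simp
qed

lemma ennreal_combination_le:
  assumes "a \<le> C * b + D * c" "C \<ge> 0" "D \<ge> 0" "b \<ge> 0" "c \<ge> 0" "Z \<ge> 0"
  shows "ennreal (a / Z) \<le> ennreal C * ennreal (b / Z) + ennreal D * ennreal (c / Z)"
proof -
  have "ennreal (a / Z) \<le> ennreal (C * (b / Z) + D * (c / Z))"
    using divide_right_mono[OF assms(1,6)] by (intro ennreal_leI) (simp add: add_divide_distrib)
  also have "\<dots> = ennreal C * ennreal (b / Z) + ennreal D * ennreal (c / Z)"
    using assms ennreal_mult[of C "b / Z"] ennreal_mult[of D "c / Z"] ennreal_plus[of "C * (b / Z)" "D * (c / Z)"]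
    by (simp del: times_divide_eq_right)
  finally show ?thesis .
qed

context carnot
begin

text \<open>One point outside the unit ball gives all positive values by dilation. Bounds assumed at
  values of \<open>d\<close> thereby become bounds on a half-line.\<close>

lemma d_range: assumes "d x \<ge> 1" "r > 0" shows "\<exists>y. d y = r"
proof -
  have "d (dil deg (r / d x) x) = r" using assms by (subst d_dil) simp_all
  then show ?thesis by blast
qed

end

context carnot_potential
begin

text \<open>\<open>dec\<close> is stated relative to a point with d \<ge> 1, because the hypotheses
  on the potential are given at values of \<open>d\<close>. If no such point existed,
  \<open>W (d x)\<close> would be bounded by \<open>M\<close> and the claim immediate.\<close>

lemma coercive_inequality:
  assumes p: "p > 0" and \<beta>: "\<beta> > 0"
    and dec: "\<And>x r s. d x \<ge> 1 \<Longrightarrow> 1 \<le> r \<Longrightarrow> r \<le> s \<Longrightarrow> W s * exp (- \<beta> * s) \<le> W r * exp (- \<beta> * r)"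
  shows "\<exists>C D. C > 0 \<and> D > 0 \<and> (\<forall>f. test_fun f \<longrightarrow>
    integral\<^sup>L lebesgue (\<lambda>x. exp (- U (d x)) * (\<bar>f x\<bar> powr (p + 1) * W (d x) powr (p + 1)))
    \<le> C * integral\<^sup>L lebesgue (\<lambda>x. exp (- U (d x)) * hgrad_norm gmul deg f x powr (p + 1))
      + D * integral\<^sup>L lebesgue (\<lambda>x. exp (- U (d x)) * \<bar>f x\<bar> powr (p + 1)))"
proof -
  let ?I = "integral\<^sup>L (lebesgue :: (real^'n) measure)"
  let ?\<rho> = "\<lambda>x. exp (- U (d x))"
  obtain M where M: "M \<ge> 0" "\<And>r. norm r \<le> 2 \<Longrightarrow> norm (W r) \<le> M"
    by (rule continuous_bounded_on_cball[OF W_cont]) (rule that)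
  have M': "W r \<le> M" if "0 \<le> r" "r \<le> 2" for r using M(2)[of r] that by simp
  have nonneg: "?I (\<lambda>x. ?\<rho> x * \<bar>u x\<bar> powr (p + 1)) \<ge> 0" "?I (\<lambda>x. ?\<rho> x * hgrad_norm gmul deg u x powr (p + 1)) \<ge> 0" for u
    by (intro integral_nonneg_AE AE_I2; simp)+
  show ?thesis
  proof (cases "\<exists>x. d x \<ge> 1")
    case True
    then obtain x0 where x0: "d x0 \<ge> 1" ..
    let ?a = "(c0 / 4) powr (- p) * (K + p * \<beta>) powr (p + 1) + 8 * M powr p + c0 / 2 * M powr (p + 1)"
    let ?b = "(c0 / 4) powr (- p) * (p + 1) powr (p + 1)"
    have "K + p * \<beta> > 0" using K_pos p \<beta> by (simp add: add_pos_pos)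
    then have pos: "?a > 0" "?b > 0" using c0_pos p by (simp_all add: add_pos_nonneg)
    show ?thesis
    proof (rule exI[of _ "2 / c0 * ?b"], rule exI[of _ "2 / c0 * ?a"], intro conjI allI impI)
      show "2 / c0 * ?b > 0" "2 / c0 * ?a > 0" using pos c0_pos by (simp_all only: mult_pos_pos divide_pos_pos zero_less_numeral)
      fix f :: "real^'n \<Rightarrow> real" assume f: "test_fun f"
      from f obtain R where R: "supported R f" by (rule test_fun_supported)
      \<comment> \<open>The factor c0 / 2 on the left is divided out, whence 2 / c0 in the
        constants.\<close>
      have key: "X \<le> 2 / c0 * b * G + 2 / c0 * a * F" if "c0 / 2 * X \<le> a * F + b * G" for X a b F G :: real
        using that c0_pos by (simp add: field_simps)
      have eq: "(\<lambda>x. ?\<rho> x * (\<bar>f x\<bar> powr (p + 1) * W (d x) powr (p + 1))) = (\<lambda>x. ?\<rho> x * (W (d x) powr (p + 1) * \<bar>f x\<bar> powr (p + 1)))"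
        by (rule ext) simp
      show "?I (\<lambda>x. ?\<rho> x * (\<bar>f x\<bar> powr (p + 1) * W (d x) powr (p + 1)))
        \<le> 2 / c0 * ?b * ?I (\<lambda>x. ?\<rho> x * hgrad_norm gmul deg f x powr (p + 1)) + 2 / c0 * ?a * ?I (\<lambda>x. ?\<rho> x * \<bar>f x\<bar> powr (p + 1))"
        unfolding eq by (rule key[OF weighted_Lq_inequality[OF p \<beta> dec[OF x0] M(1) M' test_fun_Ck[OF f] R]])
    qed
  next
    case False
    then have small: "d x \<le> 2" for x by (meson linear one_le_numeral order_trans)
    show ?thesis
    \<comment> \<open>The summand 1 makes the second constant positive even if M = 0.\<close>
    proof (rule exI[of _ 1], rule exI[of _ "M powr (p + 1) + 1"], intro conjI allI impI)
      fix f :: "real^'n \<Rightarrow> real" assume f: "test_fun f"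
      from f obtain R where R: "supported R f" by (rule test_fun_supported)
      have C: "Ck (Suc 0) (\<lambda>x. \<bar>f x\<bar> powr (p + 1))" by (rule Ck_compose[OF Ck_abs_powr[OF p] test_fun_Ck[OF f]])
      have c: "continuous_on UNIV (\<lambda>x. ?\<rho> x * \<bar>f x\<bar> powr (p + 1))"
        by (intro continuous_on_mult continuous_on_exp continuous_on_minus continuous_on_comp_d U_cont Ck_imp_continuous_on[OF C])
      have i: "integrable lebesgue (\<lambda>x. ?\<rho> x * \<bar>f x\<bar> powr (p + 1))"
        by (rule integrable_continuous_supported[OF c, of R]) (use R in \<open>simp add: supported_def\<close>)
      have "?I (\<lambda>x. ?\<rho> x * (\<bar>f x\<bar> powr (p + 1) * W (d x) powr (p + 1))) \<le> ?I (\<lambda>x. M powr (p + 1) * (?\<rho> x * \<bar>f x\<bar> powr (p + 1)))"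
      proof (rule integral_mono')
        show "integrable lebesgue (\<lambda>x. M powr (p + 1) * (?\<rho> x * \<bar>f x\<bar> powr (p + 1)))" by (rule integrable_mult_right[OF i])
        fix x
        have "W (d x) powr (p + 1) \<le> M powr (p + 1)" using p W_nonneg M'[OF d_nonneg small] by (intro powr_mono2) simp_all
        from mult_left_mono[OF this, of "?\<rho> x * \<bar>f x\<bar> powr (p + 1)"]
        show "?\<rho> x * (\<bar>f x\<bar> powr (p + 1) * W (d x) powr (p + 1)) \<le> M powr (p + 1) * (?\<rho> x * \<bar>f x\<bar> powr (p + 1))"
          by (simp add: mult_ac)
      qed simp
      also have "\<dots> = M powr (p + 1) * ?I (\<lambda>x. ?\<rho> x * \<bar>f x\<bar> powr (p + 1))" by simp
      also have "\<dots> \<le> 1 * ?I (\<lambda>x. ?\<rho> x * hgrad_norm gmul deg f x powr (p + 1)) + (M powr (p + 1) + 1) * ?I (\<lambda>x. ?\<rho> x * \<bar>f x\<bar> powr (p + 1))"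
        using nonneg[of f] by (simp add: distrib_right)
      finally show "?I (\<lambda>x. ?\<rho> x * (\<bar>f x\<bar> powr (p + 1) * W (d x) powr (p + 1))) \<le>
        1 * ?I (\<lambda>x. ?\<rho> x * hgrad_norm gmul deg f x powr (p + 1)) + (M powr (p + 1) + 1) * ?I (\<lambda>x. ?\<rho> x * \<bar>f x\<bar> powr (p + 1))" .
    qed (simp_all add: add_nonneg_pos)
  qed
qed

text \<open>Outside the unit ball the hypothesis reduces the potential to the quantity estimated in
  \<open>coercive_inequality\<close>; inside, monotonicity bounds it by \<open>U 1\<close>.\<close>

lemma coercive_inequality_potential:
  assumes "p > 0" "\<gamma> > 0" and U_mono: "\<And>r s. 0 \<le> r \<Longrightarrow> r \<le> s \<Longrightarrow> U r \<le> U s" and U_nonneg: "\<And>r. U r \<ge> 0"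
    and bound: "\<And>x. d x \<ge> 1 \<Longrightarrow> U (d x) \<le> \<gamma> * W (d x) powr (p + 1)"
    and f: "test_fun f"
  shows "integral\<^sup>L lebesgue (\<lambda>x. exp (- U (d x)) * (\<bar>f x\<bar> powr (p + 1) * U (d x)))
    \<le> \<gamma> * integral\<^sup>L lebesgue (\<lambda>x. exp (- U (d x)) * (\<bar>f x\<bar> powr (p + 1) * W (d x) powr (p + 1)))
      + U 1 * integral\<^sup>L lebesgue (\<lambda>x. exp (- U (d x)) * \<bar>f x\<bar> powr (p + 1))"
proof -
  let ?I = "integral\<^sup>L (lebesgue :: (real^'n) measure)"
  let ?F = "\<lambda>x. exp (- U (d x)) * \<bar>f x\<bar> powr (p + 1)"
  from f obtain R where R: "supported R f" by (rule test_fun_supported)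
  have C: "Ck (Suc 0) (\<lambda>x. \<bar>f x\<bar> powr (p + 1))" by (rule Ck_compose[OF Ck_abs_powr[OF assms(1)] test_fun_Ck[OF f]])
  have c: "continuous_on UNIV ?F"
    by (intro continuous_on_mult continuous_on_exp continuous_on_minus continuous_on_comp_d U_cont Ck_imp_continuous_on[OF C])
  have cW: "continuous_on UNIV (\<lambda>x. W (d x) powr (p + 1))"
    using assms(1) W_nonneg by (intro continuous_on_powr' continuous_on_comp_d W_cont continuous_on_const) auto
  have i1: "integrable lebesgue ?F"
    by (rule integrable_continuous_supported[OF c, of R]) (use R in \<open>simp add: supported_def\<close>)
  have i2: "integrable lebesgue (\<lambda>x. ?F x * W (d x) powr (p + 1))"
    by (rule integrable_continuous_supported[OF continuous_on_mult[OF c cW], of R]) (use R in \<open>simp add: supported_def\<close>)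
  have "?I (\<lambda>x. exp (- U (d x)) * (\<bar>f x\<bar> powr (p + 1) * U (d x))) \<le> ?I (\<lambda>x. \<gamma> * (?F x * W (d x) powr (p + 1)) + U 1 * ?F x)"
  proof (rule integral_mono')
    show "integrable lebesgue (\<lambda>x. \<gamma> * (?F x * W (d x) powr (p + 1)) + U 1 * ?F x)"
      by (rule Bochner_Integration.integrable_add[OF integrable_mult_right[OF i2] integrable_mult_right[OF i1]])
    fix x
    have "U (d x) \<le> \<gamma> * W (d x) powr (p + 1) + U 1"
    proof (cases "d x \<ge> 1")
      case True
      then show ?thesis using bound[OF True] U_nonneg[of 1] by linarith
    next
      case False
      then have "U (d x) \<le> U 1" by (intro U_mono d_nonneg) simp
      moreover have "0 \<le> \<gamma> * W (d x) powr (p + 1)" using assms(2) by simp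
      ultimately show ?thesis by linarith
    qed
    then have "?F x * U (d x) \<le> ?F x * (\<gamma> * W (d x) powr (p + 1) + U 1)" by (rule mult_left_mono) simp
    then show "exp (- U (d x)) * (\<bar>f x\<bar> powr (p + 1) * U (d x)) \<le> \<gamma> * (?F x * W (d x) powr (p + 1)) + U 1 * ?F x"
      by (simp add: algebra_simps)
    show "0 \<le> \<gamma> * (?F x * W (d x) powr (p + 1)) + U 1 * ?F x" using U_nonneg[of 1] assms(2) by simp
  qed
  also have "\<dots> = \<gamma> * ?I (\<lambda>x. ?F x * W (d x) powr (p + 1)) + U 1 * ?I ?F"
    using Bochner_Integration.integral_add[OF integrable_mult_right[OF i2, of \<gamma>] integrable_mult_right[OF i1, of "U 1"]] by simp
  finally show ?thesis by (simp only: mult.assoc)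
qed

end

theorem theorem8:
  fixes gmul :: "real^'n::finite \<Rightarrow> real^'n \<Rightarrow> real^'n" and deg :: "'n \<Rightarrow> nat"
    and U U' U'' :: "real \<Rightarrow> real" and K c0 :: real
  defines "d \<equiv> dnorm gmul deg"
  defines "Z \<equiv> integral\<^sup>L lebesgue (\<lambda>x. exp (- U (d x)))"
  defines "\<mu> \<equiv> density lebesgue (\<lambda>x. ennreal (exp (- U (d x)) / Z))"
  assumes G: "carnot_group gmul deg"
    and U_nonneg: "\<forall>r\<ge>0. U r \<ge> 0"
    and U_mono: "mono_on {0..} U"
    and U_D1: "\<forall>r\<ge>0. (U has_real_derivative U' r) (at r within {0..})"
    and U_D2: "\<forall>r\<ge>0. (U' has_real_derivative U'' r) (at r within {0..})"
    and Z_fin: "integrable lebesgue (\<lambda>x. exp (- U (d x)))"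
    and K_pos: "K > 0" and c0_pos: "c0 > 0"
    and grad_d: "AE x in lebesgue. d x \<ge> 1 \<longrightarrow>
                   (\<forall>i\<in>horiz deg. hdiff_at gmul i d x) \<and> hgrad_norm gmul deg d x \<le> 1"
    and lap_d: "\<forall>\<phi>. test_fun \<phi> \<and> (\<forall>x. \<phi> x \<ge> 0) \<and> closure {x. \<phi> x \<noteq> 0} \<subseteq> {x. d x > 1} \<longrightarrow>
                   integral\<^sup>L lebesgue (\<lambda>x. d x * sublap gmul deg \<phi> x)
                   \<le> integral\<^sup>L lebesgue (\<lambda>x. (K + U' (d x) * ((hgrad_norm gmul deg d x)\<^sup>2 - c0)) * \<phi> x)"
  shows
    "(\<forall>\<beta>>0. (\<forall>x. d x \<ge> 1 \<longrightarrow> U'' (d x) \<le> \<beta> * U' (d x)) \<longrightarrow>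
        (\<forall>q>1. \<exists>C D. C > 0 \<and> D > 0 \<and> (\<forall>f. test_fun f \<longrightarrow>
           (\<integral>\<^sup>+x. ennreal (\<bar>f x\<bar> powr q * \<bar>U' (d x)\<bar> powr q) \<partial>\<mu>)
           \<le> ennreal C * (\<integral>\<^sup>+x. ennreal (hgrad_norm gmul deg f x powr q) \<partial>\<mu>)
             + ennreal D * (\<integral>\<^sup>+x. ennreal (\<bar>f x\<bar> powr q) \<partial>\<mu>))))
     \<and>
     (\<forall>\<beta>>0. \<forall>\<gamma>>0. \<forall>q>1. (\<forall>x. d x \<ge> 1 \<longrightarrow> U'' (d x) \<le> \<beta> * U' (d x)) \<longrightarrow>
        (\<forall>x. d x \<ge> 1 \<longrightarrow> U (d x) \<le> \<gamma> * U' (d x) powr q) \<longrightarrow>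
        (\<exists>C D. C > 0 \<and> D > 0 \<and> (\<forall>f. test_fun f \<longrightarrow>
           (\<integral>\<^sup>+x. ennreal (\<bar>f x\<bar> powr q * U (d x)) \<partial>\<mu>)
           \<le> ennreal C * (\<integral>\<^sup>+x. ennreal (hgrad_norm gmul deg f x powr q) \<partial>\<mu>)
             + ennreal D * (\<integral>\<^sup>+x. ennreal (\<bar>f x\<bar> powr q) \<partial>\<mu>))))"
proof -
  interpret carnot gmul deg by unfold_locales (rule G)
  \<comment> \<open>Both functions are continued to the left of 0 by their value at 0; as d \<ge> 0,
    their compositions with \<open>d\<close> do not change.\<close>
  define W where "W r = U' (max 0 r)" for r
  define V where "V r = U (max 0 r)" for r
  have dW: "W (d x) = U' (d x)" and dV: "V (d x) = U (d x)" for x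
    using d_nonneg[of x] by (simp_all add: W_def V_def d_def)
  have cm: "continuous_on UNIV (\<lambda>r::real. max 0 r)" by (intro continuous_on_max continuous_on_const continuous_on_id)
  have "continuous_on {0..} U" "continuous_on {0..} U'"
    using U_D1 U_D2 by (auto simp: continuous_on_eq_continuous_within intro: DERIV_continuous)
  then have cW: "continuous_on UNIV W" and cV: "continuous_on UNIV V"
    unfolding W_def[abs_def] V_def[abs_def] by (auto intro: continuous_on_compose2[OF _ cm])
  have Wnn: "W r \<ge> 0" for r
    unfolding W_def by (rule mono_on_has_derivative_nonneg[OF U_mono _ U_D1[rule_format]]) simp_all
  \<comment> \<open>The given derivatives are relative to {0..}; at interior points they are
    two-sided.\<close>
  have at0: "at r within {0..} = at r" if "r > 0" for r :: real
    using that by (intro at_within_interior) (simp add: interior_real_atLeast)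
  have VD: "(V has_real_derivative W r) (at r)" if "r > 0" for r
  proof -
    have "(U has_real_derivative U' r) (at r)" using U_D1 that at0[OF that] by (metis less_imp_le)
    then have "(V has_real_derivative U' r) (at r)"
      by (rule has_field_derivative_transform_within_open[of _ _ _ "{0<..}"]) (use that in \<open>auto simp: V_def\<close>)
    then show ?thesis using that by (simp add: W_def)
  qed
  interpret carnot_potential gmul deg W K c0 V
  proof unfold_locales
    show "AE x in lebesgue. dnorm gmul deg x \<ge> 1 \<longrightarrow>
      (\<forall>i\<in>horiz deg. hdiff_at gmul i (dnorm gmul deg) x) \<and> hgrad_norm gmul deg (dnorm gmul deg) x \<le> 1"
      using grad_d unfolding d_def .
    fix \<phi> :: "real^'n \<Rightarrow> real"
    assume "test_fun \<phi>" "\<And>x. \<phi> x \<ge> 0" "closure {x. \<phi> x \<noteq> 0} \<subseteq> {x. dnorm gmul deg x > 1}"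
    then show "integral\<^sup>L lebesgue (\<lambda>x. dnorm gmul deg x * sublap gmul deg \<phi> x) \<le>
      integral\<^sup>L lebesgue (\<lambda>x. (K + W (dnorm gmul deg x) * ((hgrad_norm gmul deg (dnorm gmul deg) x)\<^sup>2 - c0)) * \<phi> x)"
      using lap_d dW unfolding d_def by simp
  qed (fact cW Wnn K_pos c0_pos cV VD)+
  have Z0: "Z \<ge> 0" unfolding Z_def by (intro integral_nonneg_AE AE_I2) simp
  have c\<rho>: "continuous_on UNIV (\<lambda>x. exp (- U (d x)))"
    using continuous_on_exp[OF continuous_on_minus[OF continuous_on_comp_d[OF cV]]] dV unfolding d_def by simp
  note nn = nn_integral_density_eq[OF c\<rho> exp_ge_zero Z0, folded \<mu>_def]
  let ?I = "integral\<^sup>L (lebesgue :: (real^'n) measure)"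
  have core: "\<exists>C D. C > 0 \<and> D > 0 \<and> (\<forall>f. test_fun f \<longrightarrow>
      ?I (\<lambda>x. exp (- U (d x)) * (\<bar>f x\<bar> powr q * \<bar>U' (d x)\<bar> powr q))
      \<le> C * ?I (\<lambda>x. exp (- U (d x)) * hgrad_norm gmul deg f x powr q) + D * ?I (\<lambda>x. exp (- U (d x)) * \<bar>f x\<bar> powr q))"
    if \<beta>: "\<beta> > 0" and U'': "\<forall>x. d x \<ge> 1 \<longrightarrow> U'' (d x) \<le> \<beta> * U' (d x)" and q: "q > 1" for \<beta> q
  proof -
    \<comment> \<open>The derivative of \<open>W t * exp (- \<beta> * t)\<close> is (U'' - \<beta>
      U') times the exponential, and its sign alone is used.\<close>
    have dec: "W s * exp (- \<beta> * s) \<le> W r * exp (- \<beta> * r)" if x: "d x \<ge> 1" and rs: "1 \<le> r" "r \<le> s" for x r s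
    proof (rule DERIV_nonpos_imp_nonincreasing[OF rs(2), of "\<lambda>t. W t * exp (- \<beta> * t)"])
      fix t assume "r \<le> t" "t \<le> s"
      then have t: "t > 0" "t \<ge> 1" using rs by linarith+
      \<comment> \<open>The bound on U'' is assumed at values of \<open>d\<close>, so
        \<open>t\<close> has to be exhibited as one.\<close>
      obtain y where "d y = t" using d_range[of x t] x t(1) unfolding d_def by blast
      then have le: "U'' t \<le> \<beta> * U' t" using U'' t(2) by auto
      have "(U' has_real_derivative U'' t) (at t)" using U_D2 t(1) at0[OF t(1)] by (metis less_imp_le)
      then have "(W has_real_derivative U'' t) (at t)"
        by (rule has_field_derivative_transform_within_open[of _ _ _ "{0<..}"]) (use t in \<open>auto simp: W_def\<close>)
      moreover have "((\<lambda>t. exp (- \<beta> * t)) has_real_derivative - \<beta> * exp (- \<beta> * t)) (at t)"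
        by (auto intro!: derivative_eq_intros)
      ultimately have "((\<lambda>t. W t * exp (- \<beta> * t)) has_real_derivative U'' t * exp (- \<beta> * t) + - \<beta> * exp (- \<beta> * t) * W t) (at t)"
        by (rule DERIV_mult)
      moreover have "U'' t * exp (- \<beta> * t) + - \<beta> * exp (- \<beta> * t) * W t = (U'' t - \<beta> * U' t) * exp (- \<beta> * t)"
        using t(1) by (simp add: W_def algebra_simps)
      ultimately have "((\<lambda>t. W t * exp (- \<beta> * t)) has_real_derivative (U'' t - \<beta> * U' t) * exp (- \<beta> * t)) (at t)"
        by (simp only:)
      moreover have "(U'' t - \<beta> * U' t) * exp (- \<beta> * t) \<le> 0" using le by (intro mult_nonpos_nonneg) simp_all
      ultimately show "\<exists>y. ((\<lambda>t. W t * exp (- \<beta> * t)) has_real_derivative y) (at t) \<and> y \<le> 0" by blast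
    qed
    have "q - 1 > 0" using q by simp
    from coercive_inequality[OF this \<beta>] dec
    show ?thesis unfolding d_def[symmetric] dW dV using Wnn[of "d _"] by (simp add: dW abs_of_nonneg)
  qed
  have cf: "continuous_on UNIV (\<lambda>x. \<bar>f x\<bar> powr q)" if "test_fun f" "q > 1" for f :: "real^'n \<Rightarrow> real" and q
    using Ck_imp_continuous_on[OF Ck_compose[OF Ck_abs_powr[of "q - 1"] test_fun_Ck[OF that(1)]]] that(2) by simp
  have cu: "continuous_on UNIV (\<lambda>x. \<bar>U' (d x)\<bar> powr q)" if "q > 1" for q
    using continuous_on_powr'[OF continuous_on_rabs[OF continuous_on_comp_d[OF cW]] continuous_on_const[of _ q]] that dW
    unfolding d_def by simp
  have cUd: "continuous_on UNIV (\<lambda>x. U (d x))" using continuous_on_comp_d[OF cV] dV unfolding d_def by simp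
  have cg: "continuous_on UNIV (\<lambda>x. hgrad_norm gmul deg f x powr q)" if "test_fun f" "q > 1" for f q
    using that(2) hgrad_norm_nonneg
    by (intro continuous_on_powr' continuous_on_hgrad_norm test_fun_Ck[OF that(1)] continuous_on_const) auto
  have Inn: "?I (\<lambda>x. exp (- U (d x)) * v x) \<ge> 0" if "\<And>x. v x \<ge> 0" for v
    using that by (intro integral_nonneg_AE AE_I2) simp
  have rhs: "(\<integral>\<^sup>+x. ennreal (hgrad_norm gmul deg f x powr q) \<partial>\<mu>) = ennreal (?I (\<lambda>x. exp (- U (d x)) * hgrad_norm gmul deg f x powr q) / Z)"
      "(\<integral>\<^sup>+x. ennreal (\<bar>f x\<bar> powr q) \<partial>\<mu>) = ennreal (?I (\<lambda>x. exp (- U (d x)) * \<bar>f x\<bar> powr q) / Z)"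
    if f: "test_fun f" "q > 1" for f q
  proof -
    from f(1) obtain R where R: "supported R f" by (rule test_fun_supported)
    have "supported R (\<lambda>x. hgrad_norm gmul deg f x powr q)" "supported R (\<lambda>x. \<bar>f x\<bar> powr q)"
      using supported_hgrad_norm[OF R] R by (simp_all add: supported_def)
    then show "(\<integral>\<^sup>+x. ennreal (hgrad_norm gmul deg f x powr q) \<partial>\<mu>) = ennreal (?I (\<lambda>x. exp (- U (d x)) * hgrad_norm gmul deg f x powr q) / Z)"
      "(\<integral>\<^sup>+x. ennreal (\<bar>f x\<bar> powr q) \<partial>\<mu>) = ennreal (?I (\<lambda>x. exp (- U (d x)) * \<bar>f x\<bar> powr q) / Z)"
      by (auto intro: nn[OF cg[OF f] powr_ge_zero] nn[OF cf[OF f] powr_ge_zero])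
  qed
  have first: "\<exists>C D. C > 0 \<and> D > 0 \<and> (\<forall>f. test_fun f \<longrightarrow>
           (\<integral>\<^sup>+x. ennreal (\<bar>f x\<bar> powr q * \<bar>U' (d x)\<bar> powr q) \<partial>\<mu>)
           \<le> ennreal C * (\<integral>\<^sup>+x. ennreal (hgrad_norm gmul deg f x powr q) \<partial>\<mu>)
             + ennreal D * (\<integral>\<^sup>+x. ennreal (\<bar>f x\<bar> powr q) \<partial>\<mu>))"
    if \<beta>: "\<beta> > 0" and U'': "\<forall>x. d x \<ge> 1 \<longrightarrow> U'' (d x) \<le> \<beta> * U' (d x)" and q: "q > 1" for \<beta> q
  proof -
    from core[OF that] obtain C D where CD: "C > 0" "D > 0" "\<forall>f. test_fun f \<longrightarrow>
      ?I (\<lambda>x. exp (- U (d x)) * (\<bar>f x\<bar> powr q * \<bar>U' (d x)\<bar> powr q))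
      \<le> C * ?I (\<lambda>x. exp (- U (d x)) * hgrad_norm gmul deg f x powr q) + D * ?I (\<lambda>x. exp (- U (d x)) * \<bar>f x\<bar> powr q)"
      by (elim exE conjE)
    show ?thesis
    proof (rule exI[of _ C], rule exI[of _ D], intro conjI CD(1,2) allI impI)
      fix f :: "real^'n \<Rightarrow> real" assume f: "test_fun f"
      from f obtain R where R: "supported R f" by (rule test_fun_supported)
      have "(\<integral>\<^sup>+x. ennreal (\<bar>f x\<bar> powr q * \<bar>U' (d x)\<bar> powr q) \<partial>\<mu>) =
          ennreal (?I (\<lambda>x. exp (- U (d x)) * (\<bar>f x\<bar> powr q * \<bar>U' (d x)\<bar> powr q)) / Z)"
        by (rule nn[OF continuous_on_mult[OF cf[OF f q] cu[OF q]], of R]) (use R in \<open>simp_all add: supported_def\<close>)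
      also have "\<dots> \<le> ennreal C * ennreal (?I (\<lambda>x. exp (- U (d x)) * hgrad_norm gmul deg f x powr q) / Z)
          + ennreal D * ennreal (?I (\<lambda>x. exp (- U (d x)) * \<bar>f x\<bar> powr q) / Z)"
        using CD f Z0 by (intro ennreal_combination_le Inn) simp_all
      finally show "(\<integral>\<^sup>+x. ennreal (\<bar>f x\<bar> powr q * \<bar>U' (d x)\<bar> powr q) \<partial>\<mu>)
           \<le> ennreal C * (\<integral>\<^sup>+x. ennreal (hgrad_norm gmul deg f x powr q) \<partial>\<mu>)
             + ennreal D * (\<integral>\<^sup>+x. ennreal (\<bar>f x\<bar> powr q) \<partial>\<mu>)"
        by (simp only: rhs[OF f q])
    qed
  qed
  have second: "\<exists>C D. C > 0 \<and> D > 0 \<and> (\<forall>f. test_fun f \<longrightarrow>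
           (\<integral>\<^sup>+x. ennreal (\<bar>f x\<bar> powr q * U (d x)) \<partial>\<mu>)
           \<le> ennreal C * (\<integral>\<^sup>+x. ennreal (hgrad_norm gmul deg f x powr q) \<partial>\<mu>)
             + ennreal D * (\<integral>\<^sup>+x. ennreal (\<bar>f x\<bar> powr q) \<partial>\<mu>))"
    if \<beta>: "\<beta> > 0" and \<gamma>: "\<gamma> > 0" and q: "q > 1" and U'': "\<forall>x. d x \<ge> 1 \<longrightarrow> U'' (d x) \<le> \<beta> * U' (d x)"
      and UU: "\<forall>x. d x \<ge> 1 \<longrightarrow> U (d x) \<le> \<gamma> * U' (d x) powr q" for \<beta> \<gamma> q
  proof -
    from core[OF \<beta> U'' q] obtain C D where CD: "C > 0" "D > 0" "\<forall>f. test_fun f \<longrightarrow>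
      ?I (\<lambda>x. exp (- U (d x)) * (\<bar>f x\<bar> powr q * \<bar>U' (d x)\<bar> powr q))
      \<le> C * ?I (\<lambda>x. exp (- U (d x)) * hgrad_norm gmul deg f x powr q) + D * ?I (\<lambda>x. exp (- U (d x)) * \<bar>f x\<bar> powr q)"
      by (elim exE conjE)
    have V1: "V 1 \<ge> 0" using U_nonneg by (simp add: V_def)
    have q': "q - 1 > 0" using q by simp
    show ?thesis
    \<comment> \<open>\<open>\<gamma>\<close> times the constants of the first inequality;
      \<open>V 1\<close> pays for the unit ball.\<close>
    proof (rule exI[of _ "\<gamma> * C"], rule exI[of _ "\<gamma> * D + V 1"], intro conjI allI impI)
      show "\<gamma> * C > 0" "\<gamma> * D + V 1 > 0" using \<gamma> CD V1 by (simp_all add: add_pos_nonneg)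
      fix f :: "real^'n \<Rightarrow> real" assume f: "test_fun f"
      from f obtain R where R: "supported R f" by (rule test_fun_supported)
      let ?G = "?I (\<lambda>x. exp (- U (d x)) * hgrad_norm gmul deg f x powr q)"
      let ?F = "?I (\<lambda>x. exp (- U (d x)) * \<bar>f x\<bar> powr q)"
      let ?W = "?I (\<lambda>x. exp (- U (d x)) * (\<bar>f x\<bar> powr q * \<bar>U' (d x)\<bar> powr q))"
      have U'abs: "\<bar>U' (d x)\<bar> = U' (d x)" for x using Wnn[of "d x"] by (simp add: dW)
      have mono: "V r \<le> V s" if "0 \<le> r" "r \<le> s" for r s
        unfolding V_def using that by (intro mono_onD[OF U_mono]) auto
      have Vnn: "V r \<ge> 0" for r using U_nonneg by (simp add: V_def)
      have "?I (\<lambda>x. exp (- V (d x)) * (\<bar>f x\<bar> powr (q - 1 + 1) * V (d x)))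
        \<le> \<gamma> * ?I (\<lambda>x. exp (- V (d x)) * (\<bar>f x\<bar> powr (q - 1 + 1) * W (d x) powr (q - 1 + 1)))
          + V 1 * ?I (\<lambda>x. exp (- V (d x)) * \<bar>f x\<bar> powr (q - 1 + 1))"
        unfolding d_def using UU[unfolded d_def] dW[unfolded d_def] dV[unfolded d_def]
        by (intro coercive_inequality_potential[OF q' \<gamma> mono Vnn _ f]) simp_all
      then have "?I (\<lambda>x. exp (- U (d x)) * (\<bar>f x\<bar> powr q * U (d x))) \<le> \<gamma> * ?W + V 1 * ?F"
        by (simp only: dV dW U'abs diff_add_cancel)
      also have "\<dots> \<le> \<gamma> * (C * ?G + D * ?F) + V 1 * ?F"
        using CD(3) f \<gamma> by (intro add_right_mono mult_left_mono) simp_all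
      finally have le: "?I (\<lambda>x. exp (- U (d x)) * (\<bar>f x\<bar> powr q * U (d x))) \<le> \<gamma> * C * ?G + (\<gamma> * D + V 1) * ?F"
        by (simp add: algebra_simps)
      have Unn: "U (d x) \<ge> 0" for x using Vnn[of "d x"] by (simp add: dV)
      have "(\<integral>\<^sup>+x. ennreal (\<bar>f x\<bar> powr q * U (d x)) \<partial>\<mu>) =
          ennreal (?I (\<lambda>x. exp (- U (d x)) * (\<bar>f x\<bar> powr q * U (d x))) / Z)"
        by (rule nn[OF continuous_on_mult[OF cf[OF f q] cUd], of R]) (use R Unn in \<open>simp_all add: supported_def\<close>)
      also have "\<dots> \<le> ennreal (\<gamma> * C) * ennreal (?G / Z) + ennreal (\<gamma> * D + V 1) * ennreal (?F / Z)"
        using le CD \<gamma> V1 Z0 by (intro ennreal_combination_le Inn) simp_all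
      finally show "(\<integral>\<^sup>+x. ennreal (\<bar>f x\<bar> powr q * U (d x)) \<partial>\<mu>)
           \<le> ennreal (\<gamma> * C) * (\<integral>\<^sup>+x. ennreal (hgrad_norm gmul deg f x powr q) \<partial>\<mu>)
             + ennreal (\<gamma> * D + V 1) * (\<integral>\<^sup>+x. ennreal (\<bar>f x\<bar> powr q) \<partial>\<mu>)"
        by (simp only: rhs[OF f q])
    qed
  qed
  show ?thesis
    by (intro conjI allI impI) (rule first second, assumption+)+
qed

end
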